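(* Let $X := I_{C_{\mathbb{T}}} + \theta$, where $\theta\in L^\infty_a(\mu_{\mathbb{T}}, H_{\mathbb{T}})$, and let $\kappa_X : L^2_a(\mu_{\mathbb{T}}, H_{\mathbb{T}}) \to L^2_a(\mu_{\mathbb{T}}, H_{\mathbb{T}})$ be the (possibly nonlinear) operator $\kappa_X[h] := I_{C_{\mathbb{T}}} - X\circ\tau_h = -h-\theta\circ(I_{C_{\mathbb{T}}}+h)$, where $\tau_h := I_{C_{\mathbb{T}}}+h$. Assume that: (i) the operator $\kappa_X$ is continuous; (ii) there exists $K\in[0,1)$ such that for every $h\in L^2_a(\mu_{\mathbb{T}}, H_{\mathbb{T}})$ there exists $\epsilon\in(0,1]$ satisfying $$\int_{C_{\mathbb{T}}} \|X\circ \tau_{h+\epsilon\kappa_X[h]} - X\circ\tau_h - \epsilon\kappa_X[h]\|_{H_{\mathbb{T}}}^2\, d\mu_{\mathbb{T}} \leq K\epsilon^2\int_{C_{\mathbb{T}}}\|\kappa_X[h]\|_{H_{\mathbb{T}}}^2\, d\mu_{\mathbb{T}}.$$ Then there exists a Borel probability measure $\nu$ on $C_{\mathbb{T}}$, equivalent to $\mu_{\mathbb{T}}$, such that $(X_t)_{t\in\mathbb{T}}$ is a generating sampled Brownian motion on $(C_{\mathbb{T}}, \mathcal{B}(C_{\mathbb{T}})^\nu,\nu)$. In particular, $\mathcal{G}_t^X=\mathcal{F}_t^\nu$ for all $t\in\mathbb{T}$.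
   Context: $\mathbb{T}$ is a closed subset of $\mathbb{R}$ with $\{0,1\}\subset\mathbb{T}\subset[0,1]$; for an interval $I\subset[0,1]$, $I_{\mathbb{T}}:=I\cap\mathbb{T}$. Let $\bar\rho:[0,1]\to\mathbb{T}$ be $\bar\rho(t):=\sup\{u\in\mathbb{T}:u<t\}$ for $t\in(0,1]$ and $\bar\rho(0):=0$; $\lambda_\Delta:=\bar\rho_\star\lambda$ is the pushforward to $(\mathbb{T},\mathcal{B}(\mathbb{T}))$ of Lebesgue measure $\lambda$ on $[0,1]$. A point $t\in\mathbb{T}\setminus\{1\}$ is right-scattered if $\inf\{u\in\mathbb{T}:u>t\}>t$; $\mathbb{T}_{rs}$ is the set of right-scattered points. $C_{\mathbb{T}}$ is the Banach space of continuous $\omega:\mathbb{T}\to\mathbb{R}$ with $\omega(0)=0$, with the sup norm; $W_t(\omega):=\omega(t)$ is evaluation. $I_{C_{\mathbb{T}}}$ is the identity map of $C_{\mathbb{T}}$. The sampled Wiener measure $\mu_{\mathbb{T}}$ is the law on $C_{\mathbb{T}}$ of $(B_t)_{t\in\mathbb{T}}$, where $(B_t)_{t\in[0,1]}$ is a standard Brownian motion started at $0$. A process indexed by $\mathbb{T}$ is a sampled Brownian motion on a probability space if its law, as a random element of $C_{\mathbb{T}}$, is $\mu_{\mathbb{T}}$. $H_{\mathbb{T}}$ is the separable Hilbert space of $h\in C_{\mathbb{T}}$ of the form $h(t)=\int_{[0,t)_{\mathbb{T}}}h^\Delta(s)\lambda_\Delta(ds)$, $t\in\mathbb{T}$, with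 $h^\Delta\in L^2(\lambda_\Delta)$, with scalar product $\langle h,k\rangle_{H_{\mathbb{T}}}=\int_{\mathbb{T}}h^\Delta k^\Delta\,d\lambda_\Delta$. For a Borel probability $\nu$ on $C_{\mathbb{T}}$, $\mathcal{B}(C_{\mathbb{T}})^\nu$ is the $\nu$-completion of the Borel $\sigma$-field (and $\nu$ also denotes its extension to it); for a sub-$\sigma$-field $\mathcal{F}$, $\mathcal{F}^\nu$ is the smallest $\sigma$-field containing $\mathcal{F}$ and all $\nu$-negligible sets of $\mathcal{B}(C_{\mathbb{T}})^\nu$. Set $\mathcal{F}_t:=\sigma(W_s:s\in[0,t]_{\mathbb{T}})$ and $\mathcal{F}_t^\nu:=(\mathcal{F}_t)^\nu$. $L^2(\mu_{\mathbb{T}},H_{\mathbb{T}})$ is the Hilbert space of $\mu_{\mathbb{T}}$-equivalence classes of Borel measurable $u:C_{\mathbb{T}}\to C_{\mathbb{T}}$ with $\int\|u(\omega)\|_{H_{\mathbb{T}}}^2\mu_{\mathbb{T}}(d\omega)<\infty$. $L^2_a(\mu_{\mathbb{T}},H_{\mathbb{T}})$ is the subset of those $u=\int_{[0,\cdot)_{\mathbb{T}}}u^\Delta_s\lambda_\Delta(ds)$ such that $u_t:=W_t\circ u$ is $\mathcal{F}_t^{\mu_{\mathbb{T}}}$-measurable for all $t\in\mathbb{T}$ and $u^\Delta_t$ is $\mathcal{F}_t^{\mu_{\mathbb{T}}}$-measurable for all $t\in\mathbb{T}_{rs}$. $L^\infty_a(\mu_{\mathbb{T}},H_{\mathbb{T}})$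 is the set of $h\in L^2_a(\mu_{\mathbb{T}},H_{\mathbb{T}})$ for which there is $c>0$ with $\|h\|_{H_{\mathbb{T}}}<c$ $\mu_{\mathbb{T}}$-a.s. For $h\in L^2_a(\mu_{\mathbb{T}},H_{\mathbb{T}})$ the pushforward of $\mu_{\mathbb{T}}$ by $\tau_h$ is absolutely continuous with respect to $\mu_{\mathbb{T}}$, so that compositions of $\mu_{\mathbb{T}}$-equivalence classes with $\tau_h$ are well defined, and $\kappa_X$ indeed takes values in $L^2_a(\mu_{\mathbb{T}},H_{\mathbb{T}})$. For measurable $X:C_{\mathbb{T}}\to C_{\mathbb{T}}$, put $X_t:=W_t\circ X$ and $\mathcal{G}_t^X:=\sigma(X_s:s\in[0,t]_{\mathbb{T}})^\nu$. $X$ is a generating sampled Brownian motion on $(C_{\mathbb{T}},\mathcal{B}(C_{\mathbb{T}})^\nu,\nu)$ if $(X_t)_{t\in\mathbb{T}}$ is a sampled Brownian motion on this probability space and $\mathcal{G}_t^X=\mathcal{F}_t^\nu$ for all $t\in\mathbb{T}$. *)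

theory Defs
  imports "HOL-Probability.Probability" "HOL-Library.Function_Algebras"
begin

section \<open>Time scales\<close>

definition time_scale :: "real set \<Rightarrow> bool" where
  "time_scale T \<longleftrightarrow> closed T \<and> {0, 1} \<subseteq> T \<and> T \<subseteq> {0..1}"

definition rho_bar :: "real set \<Rightarrow> real \<Rightarrow> real" where
  "rho_bar T t = (if 0 < t then Sup {u \<in> T. u < t} else 0)"

definition lambda_Delta :: "real set \<Rightarrow> real measure" where
  "lambda_Delta T = distr (restrict_space lborel {0..1}) (restrict_space borel T) (rho_bar T)"

definition right_scattered :: "real set \<Rightarrow> real set" where
  "right_scattered T = {t \<in> T - {1}. Inf {u \<in> T. t < u} > t}"


section \<open>Path space\<close>

text \<open>
  A path on \<open>T\<close> is encoded as a function on the whole real line that vanishes outside \<open>T\<close>,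
  so that the vector space operations of the path space are the pointwise ones
  and \<open>id + h\<close> is the perturbation of the identity by \<open>h\<close>.
\<close>

definition CT :: "real set \<Rightarrow> (real \<Rightarrow> real) set" where
  "CT T = {\<omega>. continuous_on T \<omega> \<and> \<omega> 0 = 0 \<and> (\<forall>t. t \<notin> T \<longrightarrow> \<omega> t = 0)}"

text \<open>The value \<open>0\<close> off the carrier is there because \<open>Metric_space\<close> requires a
  nonnegative function on the whole type.\<close>

definition CT_dist :: "real set \<Rightarrow> (real \<Rightarrow> real) \<Rightarrow> (real \<Rightarrow> real) \<Rightarrow> real" where
  "CT_dist T \<omega> \<eta> =
     (if \<omega> \<in> CT T \<and> \<eta> \<in> CT T then SUP t\<in>T. \<bar>\<omega> t - \<eta> t\<bar> else 0)"

lemma CT_Metric_space: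
  assumes "time_scale T"
  shows "Metric_space (CT T) (CT_dist T)"
proof
  have T: "compact T" "0 \<in> T"
    using assms compact_Int_closed[of "{0..1::real}" T]
    by (auto simp: time_scale_def Int_absorb1)
  have bdd: "bdd_above ((\<lambda>t. \<bar>\<omega> t - \<eta> t\<bar>) ` T)" if "\<omega> \<in> CT T" "\<eta> \<in> CT T" for \<omega> \<eta>
    using that unfolding CT_def
    by (intro bounded_imp_bdd_above compact_imp_bounded compact_continuous_image T continuous_intros) auto
  have upper: "\<bar>\<omega> t - \<eta> t\<bar> \<le> CT_dist T \<omega> \<eta>" if "\<omega> \<in> CT T" "\<eta> \<in> CT T" "t \<in> T" for \<omega> \<eta> t
    using cSUP_upper[OF that(3) bdd[OF that(1,2)]] that by (simp add: CT_dist_def)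
  fix x y z
  show nn: "0 \<le> CT_dist T x y"
  proof (cases "x \<in> CT T \<and> y \<in> CT T")
    case True
    then show ?thesis using upper[of x y 0] T by linarith
  qed (auto simp: CT_dist_def)
  show "CT_dist T x y = CT_dist T y x"
    by (auto simp: CT_dist_def abs_minus_commute)
  show "CT_dist T x y = 0 \<longleftrightarrow> x = y" if xy: "x \<in> CT T" "y \<in> CT T"
  proof
    assume 0: "CT_dist T x y = 0"
    show "x = y"
    proof
      fix t show "x t = y t"
        using upper[OF xy, of t] 0 xy by (cases "t \<in> T") (auto simp: CT_def)
    qed
  next
    assume "x = y"
    moreover have "T \<noteq> {}" using T by auto
    ultimately show "CT_dist T x y = 0" by (simp add: CT_dist_def)
  qed
  show "CT_dist T x z \<le> CT_dist T x y + CT_dist T y z"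
    if xyz: "x \<in> CT T" "y \<in> CT T" "z \<in> CT T"
  proof -
    have "\<bar>x t - z t\<bar> \<le> CT_dist T x y + CT_dist T y z" if "t \<in> T" for t
      using upper[OF xyz(1,2) that] upper[OF xyz(2,3) that] by linarith
    then have "(SUP t\<in>T. \<bar>x t - z t\<bar>) \<le> CT_dist T x y + CT_dist T y z"
      using T by (intro cSUP_least) auto
    then show ?thesis using xyz by (simp add: CT_dist_def)
  qed
qed

definition borel_CT :: "real set \<Rightarrow> (real \<Rightarrow> real) measure" where
  "borel_CT T = sigma (CT T) {U. openin (Metric_space.mtopology (CT T) (CT_dist T)) U}"


section \<open>Brownian motion and sampled Wiener measure\<close>

definition standard_BM :: "'p measure \<Rightarrow> (real \<Rightarrow> 'p \<Rightarrow> real) \<Rightarrow> bool" where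
  "standard_BM M B \<longleftrightarrow>
     prob_space M \<and>
     (\<forall>t\<in>{0..1}. B t \<in> borel_measurable M) \<and>
     (\<forall>p\<in>space M. B 0 p = 0 \<and> continuous_on {0..1} (\<lambda>t. B t p)) \<and>
     (\<forall>s t. 0 \<le> s \<and> s < t \<and> t \<le> 1 \<longrightarrow>
        distributed M lborel (\<lambda>p. B t p - B s p) (normal_density 0 (sqrt (t - s)))) \<and>
     (\<forall>(n::nat) \<tau>. mono \<tau> \<and> range \<tau> \<subseteq> {0..1} \<longrightarrow>
        prob_space.indep_vars M (\<lambda>_. borel) (\<lambda>i p. B (\<tau> (Suc i)) p - B (\<tau> i) p) {..<n})"

definition sampled_wiener ::
  "real set \<Rightarrow> 'p measure \<Rightarrow> (real \<Rightarrow> 'p \<Rightarrow> real) \<Rightarrow> (real \<Rightarrow> real) measure" where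
  "sampled_wiener T M B = distr M (borel_CT T) (\<lambda>p t. if t \<in> T then B t p else 0)"


section \<open>The Cameron--Martin space\<close>

definition is_delta_deriv :: "real set \<Rightarrow> (real \<Rightarrow> real) \<Rightarrow> (real \<Rightarrow> real) \<Rightarrow> bool" where
  "is_delta_deriv T h g \<longleftrightarrow>
     g \<in> borel_measurable (lambda_Delta T) \<and>
     integrable (lambda_Delta T) (\<lambda>s. (g s)\<^sup>2) \<and>
     (\<forall>t\<in>T. h t = (LINT s:({0..<t} \<inter> T)|lambda_Delta T. g s))"

definition HT :: "real set \<Rightarrow> (real \<Rightarrow> real) set" where
  "HT T = {h \<in> CT T. \<exists>g. is_delta_deriv T h g}"

text \<open>The derivative is unique up to \<open>lambda_Delta T\<close>-null sets. Right-scattered points are atoms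
  of \<open>lambda_Delta T\<close>, so its value there does not depend on the choice.\<close>

definition delta_deriv :: "real set \<Rightarrow> (real \<Rightarrow> real) \<Rightarrow> real \<Rightarrow> real" where
  "delta_deriv T h = (SOME g. is_delta_deriv T h g)"

text \<open>The norm is extended by \<open>\<infinity>\<close> to paths outside the Cameron--Martin space; finiteness of its
  second moment therefore includes that the random path is almost surely in \<open>HT T\<close>.\<close>

definition HT_norm :: "real set \<Rightarrow> (real \<Rightarrow> real) \<Rightarrow> ennreal" where
  "HT_norm T h =
     (if h \<in> HT T then ennreal (sqrt (LINT s|lambda_Delta T. (delta_deriv T h s)\<^sup>2)) else \<infinity>)"


section \<open>Filtrations\<close>

definition aug :: "'a measure \<Rightarrow> 'a measure \<Rightarrow> 'a measure" where
  "aug \<nu> F = sigma (space \<nu>) (sets F \<union> null_sets (completion \<nu>))"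

definition sigma_upto ::
  "real set \<Rightarrow> ((real \<Rightarrow> real) \<Rightarrow> (real \<Rightarrow> real)) \<Rightarrow> real \<Rightarrow> (real \<Rightarrow> real) measure" where
  "sigma_upto T X t =
     sigma (CT T) {{\<omega> \<in> CT T. X \<omega> s \<in> A} | s A. s \<in> {0..t} \<inter> T \<and> A \<in> sets borel}"

definition Filt :: "real set \<Rightarrow> (real \<Rightarrow> real) measure \<Rightarrow> real \<Rightarrow> (real \<Rightarrow> real) measure" where
  "Filt T \<nu> t = aug \<nu> (sigma_upto T id t)"

definition GFilt ::
  "real set \<Rightarrow> (real \<Rightarrow> real) measure \<Rightarrow> ((real \<Rightarrow> real) \<Rightarrow> (real \<Rightarrow> real)) \<Rightarrow> real \<Rightarrow>
   (real \<Rightarrow> real) measure" where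
  "GFilt T \<nu> X t = aug \<nu> (sigma_upto T X t)"


section \<open>Random elements of the Cameron--Martin space\<close>

text \<open>All spaces below consist of representatives; they are closed under almost sure equality
  among Borel maps. \<open>L2_sq\<close> is the squared \<open>L\<^sup>2\<close> (semi)norm.\<close>

definition L2_sq ::
  "real set \<Rightarrow> (real \<Rightarrow> real) measure \<Rightarrow> ((real \<Rightarrow> real) \<Rightarrow> (real \<Rightarrow> real)) \<Rightarrow> ennreal" where
  "L2_sq T \<mu> u = (\<integral>\<^sup>+\<omega>. (HT_norm T (u \<omega>))\<^sup>2 \<partial>\<mu>)"

definition L2 ::
  "real set \<Rightarrow> (real \<Rightarrow> real) measure \<Rightarrow> ((real \<Rightarrow> real) \<Rightarrow> (real \<Rightarrow> real)) set" where
  "L2 T \<mu> = {u. u \<in> borel_CT T \<rightarrow>\<^sub>M borel_CT T \<and> L2_sq T \<mu> u < \<infinity>}"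

definition L2_a ::
  "real set \<Rightarrow> (real \<Rightarrow> real) measure \<Rightarrow> ((real \<Rightarrow> real) \<Rightarrow> (real \<Rightarrow> real)) set" where
  "L2_a T \<mu> = {u \<in> L2 T \<mu>.
     (\<forall>t\<in>T. (\<lambda>\<omega>. u \<omega> t) \<in> borel_measurable (Filt T \<mu> t)) \<and>
     (\<forall>t\<in>right_scattered T. (\<lambda>\<omega>. delta_deriv T (u \<omega>) t) \<in> borel_measurable (Filt T \<mu> t))}"

definition Linf_a ::
  "real set \<Rightarrow> (real \<Rightarrow> real) measure \<Rightarrow> ((real \<Rightarrow> real) \<Rightarrow> (real \<Rightarrow> real)) set" where
  "Linf_a T \<mu> = {h \<in> L2_a T \<mu>. \<exists>c>0. AE \<omega> in \<mu>. HT_norm T (h \<omega>) < ennreal c}"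

definition kappa ::
  "((real \<Rightarrow> real) \<Rightarrow> (real \<Rightarrow> real)) \<Rightarrow> ((real \<Rightarrow> real) \<Rightarrow> (real \<Rightarrow> real)) \<Rightarrow>
   ((real \<Rightarrow> real) \<Rightarrow> (real \<Rightarrow> real))" where
  "kappa X h = id - (X \<circ> (id + h))"

definition path_scale ::
  "real \<Rightarrow> ((real \<Rightarrow> real) \<Rightarrow> (real \<Rightarrow> real)) \<Rightarrow> ((real \<Rightarrow> real) \<Rightarrow> (real \<Rightarrow> real))" where
  "path_scale c u = (\<lambda>\<omega> t. c * u \<omega> t)"

definition continuous_L2_a ::
  "real set \<Rightarrow> (real \<Rightarrow> real) measure \<Rightarrow>
   (((real \<Rightarrow> real) \<Rightarrow> (real \<Rightarrow> real)) \<Rightarrow> ((real \<Rightarrow> real) \<Rightarrow> (real \<Rightarrow> real))) \<Rightarrow> bool" where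
  "continuous_L2_a T \<mu> \<Phi> \<longleftrightarrow>
     (\<forall>h\<in>L2_a T \<mu>. \<forall>e::real>0. \<exists>d::real>0. \<forall>k\<in>L2_a T \<mu>.
        L2_sq T \<mu> (k - h) < ennreal (d\<^sup>2) \<longrightarrow> L2_sq T \<mu> (\<Phi> k - \<Phi> h) < ennreal (e\<^sup>2))"


section \<open>Generating sampled Brownian motion\<close>

text \<open>Here \<open>\<mu>\<close> is the sampled Wiener measure.\<close>

definition sampled_BM ::
  "real set \<Rightarrow> (real \<Rightarrow> real) measure \<Rightarrow> 'p measure \<Rightarrow> ('p \<Rightarrow> real \<Rightarrow> real) \<Rightarrow> bool" where
  "sampled_BM T \<mu> P X \<longleftrightarrow>
     prob_space P \<and> X \<in> P \<rightarrow>\<^sub>M borel_CT T \<and> distr P (borel_CT T) X = \<mu>"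

definition generating_sampled_BM ::
  "real set \<Rightarrow> (real \<Rightarrow> real) measure \<Rightarrow> (real \<Rightarrow> real) measure \<Rightarrow>
   ((real \<Rightarrow> real) \<Rightarrow> (real \<Rightarrow> real)) \<Rightarrow> bool" where
  "generating_sampled_BM T \<mu> \<nu> X \<longleftrightarrow>
     sampled_BM T \<mu> (completion \<nu>) X \<and>
     (\<forall>t\<in>T. sets (GFilt T \<nu> X t) = sets (Filt T \<nu> t))"

end

theory Submission
  imports Defs
begin

text \<open>
  The Cameron--Martin norm of a path is the supremum of its discrete energies along nested grids, so
  it is lower semicontinuous in the path. If \<open>\<parallel>\<theta>\<parallel> < c\<close>, then the adapted drifts \<open>h\<close> with
  \<open>\<parallel>h\<parallel> \<le> c\<close> almost surely form a closed convex set, which contains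
  \<open>h + \<epsilon> \<kappa>[h] = (1 - \<epsilon>) h - \<epsilon> \<theta> \<circ> \<tau>\<^sub>h\<close> together with \<open>h\<close>. Condition (ii) gives
  \<open>\<parallel>\<kappa>[h']\<parallel> \<le> (1 - (1 - \<surd>K) \<epsilon>) \<parallel>\<kappa>[h]\<parallel>\<close> for \<open>h' = h + \<epsilon> \<kappa>[h]\<close>, and Caristi's
  principle yields a drift with \<open>\<kappa>[h] = 0\<close>, that is, \<open>X \<circ> \<tau>\<^sub>h = id\<close> almost surely.
  The law \<open>\<nu>\<close> of \<open>\<tau>\<^sub>h\<close> is the measure sought: \<open>X\<close> has law \<open>\<mu>\<close> under it, and
  \<open>\<tau>\<^sub>h \<circ> X = id\<close> holds \<open>\<nu>\<close>-almost surely.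

  No stochastic integral is needed for the equivalence of \<open>\<nu>\<close> and \<open>\<mu>\<close>. Extend \<open>h\<close> linearly across the
  gaps of \<open>T\<close>, delay it by one step of a dyadic grid and apply the discrete Girsanov formula to
  Brownian motion on all of \<open>[0, 1]\<close>. The density \<open>Z\<close> and its inverse satisfy
  \<open>E Z\<^sup>2, E Z\<^sup>-\<^sup>1 \<le> exp c\<^sup>2\<close> uniformly in the grid, so by Cauchy--Schwarz
  \<open>(E f(\<tau>\<^sub>h))\<^sup>2 \<le> exp c\<^sup>2 E f\<^sup>2\<close> and \<open>(E f)\<^sup>2 \<le> exp c\<^sup>2 E f(\<tau>\<^sub>h)\<^sup>2\<close> for the discretised paths, and both
  estimates survive the limit.
\<close>

text \<open>Condition (ii) gives no lower bound for \<open>\<epsilon>\<close>: the steps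
  \<open>\<epsilon> \<kappa>[h]\<close> may shrink so fast that iterating them stalls at a drift
  with nonzero \<open>\<kappa>\<close>. Hence a maximality principle instead of a contraction
  argument; condition (i) lets \<open>\<kappa>\<close> pass to the limit of a chain. The search is
  confined to bounded drifts because composition with \<open>\<tau>\<^sub>h\<close> has to respect
  almost sure equality. The two estimates that secure this have a constant independent of the mesh
  only when the energy is bounded uniformly over the paths. \<open>bounded_drift c\<close> bounds
  the energy, that is the squared norm, so its \<open>c\<close> corresponds to the
  \<open>c\<^sup>2\<close> of the overview. The delay by one dyadic step is forced by adaptedness:
  the increment of a drift over a cell is known only at the end of that cell. Linear extension
  across a gap stays adapted because membership in \<open>L2_a\<close> makes the slope at a
  right-scattered point measurable at that very time. A right inverse suffices at the end: if
  \<open>X (\<tau>\<^sub>h \<omega>) = \<omega>\<close>, then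
  \<open>\<tau>\<^sub>h \<circ> X\<close> fixes the point \<open>\<tau>\<^sub>h \<omega>\<close>,
  and \<open>\<nu>\<close> is carried by such points.\<close>

section \<open>Analytic preliminaries: limits in L2, weighted squares, a variational
  principle\<close>

lemma L2_Cauchy_limit:
  fixes f :: "nat \<Rightarrow> 'a \<Rightarrow> real"
  assumes "prob_space M"
    and [measurable]: "\<And>n. f n \<in> borel_measurable M"
    and Cauchy: "\<And>n m. n \<le> m \<Longrightarrow> (\<integral>\<^sup>+x. ennreal ((f m x - f n x)\<^sup>2) \<partial>M) \<le> ennreal ((1/4) ^ n)"
  obtains g where "g \<in> borel_measurable M"
    "\<And>n. (\<integral>\<^sup>+x. ennreal ((g x - f n x)\<^sup>2) \<partial>M) \<le> ennreal ((1/4) ^ n)"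
proof -
  interpret prob_space M by fact
  define d where "d n x = \<bar>f (Suc n) x - f n x\<bar>" for n x
  have [measurable]: "d n \<in> borel_measurable M" for n
    unfolding d_def by measurable
  \<comment> \<open>Arithmetic-geometric mean with weight \<open>2 ^ n\<close>, chosen so that a
    second moment of order \<open>(1/4) ^ n\<close> yields a first moment of order
    \<open>(1/2) ^ n\<close>.\<close>
  have amgm: "d n x \<le> (1/2) * (1/2) ^ n + (1/2) * 2 ^ n * (f (Suc n) x - f n x)\<^sup>2" for n x
  proof -
    have "0 \<le> (1/2) * (1/2) ^ n * (1 - 2 ^ n * d n x)\<^sup>2" by simp
    also have "\<dots> = (1/2) * (1/2) ^ n - d n x * ((1/2) ^ n * 2 ^ n)
        + (1/2) * ((1/2)^n * 2 ^ n) * 2 ^ n * (d n x)\<^sup>2"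
      by (simp add: power2_eq_square algebra_simps)
    also have "(1/2::real) ^ n * 2 ^ n = 1" by (simp flip: power_mult_distrib)
    finally show ?thesis by (simp add: d_def)
  qed
  have dn: "(\<integral>\<^sup>+x. ennreal (d n x) \<partial>M) \<le> ennreal ((1/2) ^ n)" for n
  proof -
    have "(\<integral>\<^sup>+x. ennreal (d n x) \<partial>M)
        \<le> (\<integral>\<^sup>+x. ennreal ((1/2) * (1/2) ^ n) + ennreal ((1/2) * 2 ^ n) * ennreal ((f (Suc n) x - f n x)\<^sup>2) \<partial>M)"
      using amgm[of n] by (intro nn_integral_mono) (simp flip: ennreal_mult ennreal_plus)
    also have "\<dots> = ennreal ((1/2) * (1/2) ^ n) + ennreal ((1/2) * 2 ^ n) * (\<integral>\<^sup>+x. ennreal ((f (Suc n) x - f n x)\<^sup>2) \<partial>M)"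
      by (simp add: nn_integral_add nn_integral_cmult emeasure_space_1)
    also have "\<dots> \<le> ennreal ((1/2) * (1/2) ^ n) + ennreal ((1/2) * 2 ^ n) * ennreal ((1/4) ^ n)"
      by (intro add_left_mono mult_left_mono Cauchy) auto
    also have "\<dots> = ennreal ((1/2) * (1/2) ^ n + (1/2) * (2 ^ n * (1/4) ^ n))"
      by (simp flip: ennreal_mult ennreal_plus add: mult.assoc)
    also have "(2::real) ^ n * (1/4) ^ n = (1/2) ^ n"
      by (simp flip: power_mult_distrib)
    finally show ?thesis by simp
  qed
  have "(\<integral>\<^sup>+x. (\<Sum>n. ennreal (d n x)) \<partial>M) = (\<Sum>n. \<integral>\<^sup>+x. ennreal (d n x) \<partial>M)"
    by (rule nn_integral_suminf) measurable
  also have "\<dots> \<le> (\<Sum>n. ennreal ((1/2) ^ n))"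
    by (intro suminf_le dn) auto
  also have "\<dots> < \<infinity>"
    by (subst suminf_ennreal2) (auto simp: summable_geometric)
  finally have "(\<integral>\<^sup>+x. (\<Sum>n. ennreal (d n x)) \<partial>M) \<noteq> \<infinity>" by simp
  then have "AE x in M. (\<Sum>n. ennreal (d n x)) \<noteq> \<infinity>"
    by (intro nn_integral_noteq_infinite) measurable
  then have conv: "AE x in M. convergent (\<lambda>n. f n x)"
  proof eventually_elim
    case (elim x)
    have "summable (\<lambda>n. norm (f (Suc n) x - f n x))"
      using elim by (intro summable_suminf_not_top) (auto simp: d_def)
    then have "summable (\<lambda>n. f (Suc n) x - f n x)" by (rule summable_norm_cancel)
    then have "convergent (\<lambda>n. \<Sum>i<n. f (Suc i) x - f i x)" by (simp add: summable_iff_convergent)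
    then have "convergent (\<lambda>n. f n x - f 0 x)" by (subst (asm) sum_lessThan_telescope)
    then have "convergent (\<lambda>n. f 0 x + (f n x - f 0 x))" by (intro convergent_add convergent_const)
    then show ?case by simp
  qed
  define g where "g x = lim (\<lambda>n. f n x)" for x
  have g[measurable]: "g \<in> borel_measurable M" unfolding g_def by measurable
  have "(\<integral>\<^sup>+x. ennreal ((g x - f n x)\<^sup>2) \<partial>M) \<le> ennreal ((1/4) ^ n)" for n
  proof -
    have "(\<integral>\<^sup>+x. ennreal ((g x - f n x)\<^sup>2) \<partial>M)
        = (\<integral>\<^sup>+x. liminf (\<lambda>m. ennreal ((f m x - f n x)\<^sup>2)) \<partial>M)"
      using conv
    proof (intro nn_integral_cong_AE, eventually_elim)
      case (elim x)
      have "(\<lambda>m. f m x) \<longlonglongrightarrow> g x" using elim unfolding g_def by (simp add: convergent_LIMSEQ_iff)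
      then have "(\<lambda>m. ennreal ((f m x - f n x)\<^sup>2)) \<longlonglongrightarrow> ennreal ((g x - f n x)\<^sup>2)"
        by (intro tendsto_intros)
      then show ?case by (rule lim_imp_Liminf[symmetric, OF trivial_limit_sequentially])
    qed
    also have "\<dots> \<le> liminf (\<lambda>m. \<integral>\<^sup>+x. ennreal ((f m x - f n x)\<^sup>2) \<partial>M)"
      by (rule nn_integral_liminf) measurable
    also have "\<dots> \<le> ennreal ((1/4) ^ n)"
    proof -
      have "eventually (\<lambda>m. (\<integral>\<^sup>+x. ennreal ((f m x - f n x)\<^sup>2) \<partial>M) \<le> ennreal ((1/4) ^ n)) sequentially"
        using eventually_ge_at_top[of n] by eventually_elim (rule Cauchy)
      then show ?thesis
        by (intro order_trans[OF Liminf_le_Limsup Limsup_bounded]) auto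
    qed
    finally show ?thesis .
  qed
  with g show ?thesis by (rule that)
qed

text \<open>The defect is the square \<open>(s * x - y)\<^sup>2 / s\<close>. Being linear in the two
  squares, this bound can be summed over grid cells and integrated; the triangle inequality is
  recovered only afterwards, by optimising over \<open>s\<close>.\<close>

lemma square_add_le_weighted:
  fixes x y s :: real
  assumes "0 < s"
  shows "(x + y)\<^sup>2 \<le> (1 + s) * x\<^sup>2 + (1 + 1 / s) * y\<^sup>2"
proof -
  have "0 \<le> (s * x - y)\<^sup>2 / s" using assms by simp
  also have "\<dots> = (1 + s) * x\<^sup>2 + (1 + 1 / s) * y\<^sup>2 - (x + y)\<^sup>2"
    using assms by (simp add: field_simps power2_eq_square)
  finally show ?thesis by simp
qed

lemma dyadic_floor:
  fixes d :: real
  assumes "0 \<le> d" "d \<le> 1"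
  shows "real (nat \<lfloor>d * 2 ^ n\<rfloor>) / 2 ^ n \<le> d" "d - 1 / 2 ^ n \<le> real (nat \<lfloor>d * 2 ^ n\<rfloor>) / 2 ^ n"
    "nat \<lfloor>d * 2 ^ n\<rfloor> \<le> 2 ^ n"
proof -
  let ?k = "nat \<lfloor>d * 2 ^ n\<rfloor>"
  have "real ?k = of_int \<lfloor>d * 2 ^ n\<rfloor>" using assms(1) by simp
  then have "real ?k \<le> d * 2 ^ n" "d * 2 ^ n \<le> real ?k + 1" by linarith+
  then have "real ?k / 2 ^ n \<le> (d * 2 ^ n) / 2 ^ n" "(d * 2 ^ n - 1) / 2 ^ n \<le> real ?k / 2 ^ n"
    by (intro divide_right_mono; simp)+
  then show le: "real ?k / 2 ^ n \<le> d" "d - 1 / 2 ^ n \<le> real ?k / 2 ^ n"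
    by (simp_all add: diff_divide_distrib)
  have "real ?k / 2 ^ n \<le> 1" using le(1) assms(2) by linarith
  then have "real ?k \<le> real (2 ^ n)" by (simp add: divide_le_eq)
  then show "?k \<le> 2 ^ n" by (simp only: of_nat_le_iff)
qed

text \<open>The weight \<open>s = y / x\<close> turns the right-hand side into
  \<open>(x + y)\<^sup>2\<close>. If \<open>x\<close> or \<open>y\<close> vanishes the optimum may
  fail to be attained, and \<open>s\<close> is taken large or small instead.\<close>

lemma le_add_if_square_le_weighted:
  fixes x y z :: real
  assumes "0 \<le> x" "0 \<le> y" and le: "\<And>s. 0 < s \<Longrightarrow> z\<^sup>2 \<le> (1 + s) * x\<^sup>2 + (1 + 1 / s) * y\<^sup>2"
  shows "z \<le> x + y"
proof (cases "x = 0 \<or> y = 0")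
  case False
  then have xy: "0 < x" "0 < y" using assms(1,2) by auto
  have "z\<^sup>2 \<le> (1 + y / x) * x\<^sup>2 + (1 + 1 / (y / x)) * y\<^sup>2"
    using xy by (intro le) auto
  also have "\<dots> = (x + y)\<^sup>2"
    using xy by (simp add: field_simps power2_eq_square)
  finally show ?thesis using assms(1,2) by (rule power2_le_imp_le[OF _ add_nonneg_nonneg])
next
  case True
  have "z\<^sup>2 \<le> (x + y)\<^sup>2"
  proof (rule field_le_epsilon)
    fix e :: real assume e: "0 < e"
    show "z\<^sup>2 \<le> (x + y)\<^sup>2 + e"
    proof (cases "x = 0")
      case True
      define s where "s = (y\<^sup>2 + 1) / e"
      have s: "0 < s" using e by (auto simp: s_def intro!: divide_pos_pos add_nonneg_pos)
      have "(1 / s) * y\<^sup>2 = e * (y\<^sup>2 / (y\<^sup>2 + 1))" by (simp add: s_def)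
      also have "\<dots> \<le> e * 1" using e by (intro mult_left_mono) (auto simp: divide_le_eq_1 add_nonneg_pos)
      finally show ?thesis using le[OF s] True by (simp add: algebra_simps)
    next
      case False
      with \<open>x = 0 \<or> y = 0\<close> have y: "y = 0" by simp
      define s where "s = e / (x\<^sup>2 + 1)"
      have s: "0 < s" using e by (auto simp: s_def intro!: divide_pos_pos add_nonneg_pos)
      have "s * x\<^sup>2 = e * (x\<^sup>2 / (x\<^sup>2 + 1))" by (simp add: s_def)
      also have "\<dots> \<le> e * 1" using e by (intro mult_left_mono) (auto simp: divide_le_eq_1 add_nonneg_pos)
      finally show ?thesis using le[OF s] y by (simp add: algebra_simps)
    qed
  qed
  then show ?thesis using assms(1,2) by (rule power2_le_imp_le[OF _ add_nonneg_nonneg])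
qed

text \<open>The order \<open>x \<preceq> y \<longleftrightarrow> d x y \<le> C * (\<phi> x - \<phi> y)\<close> of Caristi and Ekeland: a chain along which
  \<open>\<phi>\<close> decreases almost optimally converges, and its limit is maximal.\<close>

lemma Caristi_zero:
  fixes d :: "'a \<Rightarrow> 'a \<Rightarrow> real" and \<phi> :: "'a \<Rightarrow> real"
  assumes "x0 \<in> S" and \<phi>: "\<And>x. x \<in> S \<Longrightarrow> 0 \<le> \<phi> x"
    and refl: "\<And>x. x \<in> S \<Longrightarrow> d x x = 0"
    and nonneg: "\<And>x y. x \<in> S \<Longrightarrow> y \<in> S \<Longrightarrow> 0 \<le> d x y"
    and tri: "\<And>x y z. x \<in> S \<Longrightarrow> y \<in> S \<Longrightarrow> z \<in> S \<Longrightarrow> d x z \<le> d x y + d y z"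
    and step: "\<And>x. x \<in> S \<Longrightarrow> 0 < \<phi> x \<Longrightarrow> \<exists>y\<in>S. \<phi> y < \<phi> x \<and> d x y \<le> C * (\<phi> x - \<phi> y)"
    and complete: "\<And>s. (\<And>n::nat. s n \<in> S) \<Longrightarrow> summable (\<lambda>n. d (s n) (s (Suc n))) \<Longrightarrow>
      \<exists>x\<in>S. (\<lambda>n. d (s n) x) \<longlonglongrightarrow> 0"
    and cont: "\<And>s x. (\<And>n::nat. s n \<in> S) \<Longrightarrow> x \<in> S \<Longrightarrow> (\<lambda>n. d (s n) x) \<longlonglongrightarrow> 0 \<Longrightarrow>
      (\<lambda>n. \<phi> (s n)) \<longlonglongrightarrow> \<phi> x"
    and "0 \<le> C"
  shows "\<exists>x\<in>S. \<phi> x = 0"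
proof -
  define le where "le x y \<longleftrightarrow> d x y \<le> C * (\<phi> x - \<phi> y)" for x y
  have le_refl: "le x x" if "x \<in> S" for x using refl[OF that] by (simp add: le_def)
  have le_trans: "le x z" if "x \<in> S" "y \<in> S" "z \<in> S" "le x y" "le y z" for x y z
    using tri[OF that(1-3)] that(4,5) by (simp add: le_def algebra_simps)
  have ex: "\<exists>y. y \<in> S \<and> le x y \<and> (\<forall>z\<in>S. le x z \<longrightarrow> \<phi> y \<le> \<phi> z + (1/2) ^ n)" if "x \<in> S" for x and n :: nat
  proof -
    let ?I = "\<phi> ` {z \<in> S. le x z}"
    have ne: "?I \<noteq> {}" using le_refl[OF that] that by auto
    have bdd: "bdd_below ?I" using \<phi> by (intro bdd_belowI[of _ 0]) auto
    have "Inf ?I < Inf ?I + (1/2) ^ n" by simp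
    then obtain y where y: "y \<in> S" "le x y" "\<phi> y < Inf ?I + (1/2) ^ n"
      using cInf_lessD[OF ne] by blast
    moreover have "Inf ?I \<le> \<phi> z" if "z \<in> S" "le x z" for z
      using that bdd by (intro cInf_lower) auto
    ultimately show ?thesis by (intro exI[of _ y]) force
  qed
  obtain s where s: "\<And>n. s n \<in> S" "\<And>n. le (s n) (s (Suc n))"
    "\<And>n z. z \<in> S \<Longrightarrow> le (s n) z \<Longrightarrow> \<phi> (s (Suc n)) \<le> \<phi> z + (1/2) ^ n"
  proof -
    have "\<exists>s. \<forall>n. s n \<in> S \<and> (le (s n) (s (Suc n)) \<and> (\<forall>z\<in>S. le (s n) z \<longrightarrow> \<phi> (s (Suc n)) \<le> \<phi> z + (1/2) ^ n))"
      by (rule dependent_nat_choice[where P="\<lambda>_ x. x \<in> S"]) (use assms(1) ex in auto)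
    then show ?thesis using that by auto
  qed
  have bound: "(\<Sum>i<n. d (s i) (s (Suc i))) \<le> C * \<phi> (s 0)" for n
  proof -
    have "(\<Sum>i<n. d (s i) (s (Suc i))) \<le> C * (\<phi> (s 0) - \<phi> (s n))"
    proof (induction n)
      case (Suc n)
      then show ?case using s(2)[of n] by (simp add: le_def algebra_simps)
    qed simp
    also have "\<dots> \<le> C * \<phi> (s 0)"
      using \<phi>[OF s(1)[of n]] \<open>0 \<le> C\<close> by (intro mult_left_mono) auto
    finally show ?thesis .
  qed
  have "summable (\<lambda>n. d (s n) (s (Suc n)))"
    by (rule bounded_imp_summable[where B="C * \<phi> (s 0)"])
       (use nonneg s bound[of "Suc _"] in \<open>auto simp: lessThan_Suc_atMost\<close>)
  then obtain x where x: "x \<in> S" "(\<lambda>n. d (s n) x) \<longlonglongrightarrow> 0"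
    using complete[of s] s(1) by auto
  have phix: "(\<lambda>n. \<phi> (s n)) \<longlonglongrightarrow> \<phi> x" by (rule cont) (use s x in auto)
  have chain: "le (s n) (s m)" if "n \<le> m" for n m
    using that by (induction rule: dec_induct) (auto intro: le_refl le_trans s)
  have snx: "le (s n) x" for n
  proof -
    have "d (s n) x \<le> C * (\<phi> (s n) - \<phi> (s m)) + d (s m) x" if "n \<le> m" for m
      using tri[of "s n" "s m" x] chain[OF that] s(1) x(1) by (auto simp: le_def intro: order_trans)
    moreover have "(\<lambda>m. C * (\<phi> (s n) - \<phi> (s m)) + d (s m) x) \<longlonglongrightarrow> C * (\<phi> (s n) - \<phi> x) + 0"
      by (intro tendsto_intros phix x)
    ultimately have "d (s n) x \<le> C * (\<phi> (s n) - \<phi> x) + 0"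
      by (intro Lim_bounded2[where N=n]) auto
    then show ?thesis by (simp add: le_def)
  qed
  \<comment> \<open>A point \<open>y\<close> strictly above the limit \<open>x\<close> lies above
    every \<open>s n\<close>. The almost optimal choice of \<open>s (Suc n)\<close> then gives
    \<open>\<phi> x \<le> \<phi> y\<close> in the limit, against
    \<open>\<phi> y < \<phi> x\<close>.\<close>
  have "\<phi> x = 0"
  proof (rule ccontr)
    assume "\<phi> x \<noteq> 0"
    with \<phi>[OF x(1)] have "0 < \<phi> x" by auto
    then obtain y where y: "y \<in> S" "\<phi> y < \<phi> x" "le x y"
      using step[OF x(1)] by (auto simp: le_def)
    have "\<phi> (s (Suc n)) \<le> \<phi> y + (1/2) ^ n" for n
      by (rule s(3)[OF y(1) le_trans[OF s(1) x(1) y(1) snx y(3)]])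
    moreover have "(\<lambda>n. \<phi> (s (Suc n))) \<longlonglongrightarrow> \<phi> x" using phix by (rule LIMSEQ_Suc)
    moreover have "(\<lambda>n. \<phi> y + (1/2) ^ n) \<longlonglongrightarrow> \<phi> y + 0"
      by (intro tendsto_intros LIMSEQ_power_zero) auto
    ultimately have "\<phi> x \<le> \<phi> y + 0" by (intro LIMSEQ_le[of _ "\<phi> x" _ "\<phi> y + 0"]) auto
    with y show False by simp
  qed
  with x show ?thesis by auto
qed

section \<open>The discrete Girsanov transformation\<close>

text \<open>Completing the square: \<open>(x + a * \<delta>)\<^sup>2 / (2 * \<delta>)\<close>
  exceeds \<open>x\<^sup>2 / (2 * \<delta>)\<close> by
  \<open>a * x + a\<^sup>2 * \<delta> / 2\<close>.\<close>

lemma normal_density_shift: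
  assumes "0 < \<delta>"
  shows "normal_density 0 (sqrt \<delta>) x * exp (- (a * x) - a\<^sup>2 * \<delta> / 2) = normal_density 0 (sqrt \<delta>) (x + a * \<delta>)"
proof -
  have "- (x + a * \<delta>)\<^sup>2 / (2 * \<delta>) = - x\<^sup>2 / (2 * \<delta>) + (- (a * x) - a\<^sup>2 * \<delta> / 2)"
    using assms by (simp add: field_simps power2_eq_square)
  then show ?thesis
    using assms by (simp add: normal_density_def exp_add[symmetric])
qed

text \<open>Girsanov's formula for one Gaussian variable and a constant drift; after completing the
  square it is the translation invariance of Lebesgue measure.\<close>

lemma nn_integral_normal_shift:
  assumes "0 < \<delta>" and [measurable]: "A \<in> sets borel"
  shows "(\<integral>\<^sup>+x. indicator A (x + a * \<delta>) * ennreal (exp (- (a * x) - a\<^sup>2 * \<delta> / 2))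
            \<partial>density lborel (normal_density 0 (sqrt \<delta>)))
       = emeasure (density lborel (normal_density 0 (sqrt \<delta>))) A"
proof -
  have "(\<integral>\<^sup>+x. indicator A (x + a * \<delta>) * ennreal (exp (- (a * x) - a\<^sup>2 * \<delta> / 2))
            \<partial>density lborel (normal_density 0 (sqrt \<delta>)))
     = (\<integral>\<^sup>+x. ennreal (normal_density 0 (sqrt \<delta>) (x + a * \<delta>)) * indicator A (x + a * \<delta>) \<partial>lborel)"
    unfolding normal_density_shift[OF assms(1), symmetric]
    by (subst nn_integral_density) (auto intro!: nn_integral_cong simp: ennreal_mult' mult_ac)
  also have "\<dots> = (\<integral>\<^sup>+x. ennreal (normal_density 0 (sqrt \<delta>) x) * indicator A x \<partial>lborel)"
    using nn_integral_real_affine[of "\<lambda>x. ennreal (normal_density 0 (sqrt \<delta>) x) * indicator A x" 1 "a * \<delta>"]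
    by (simp add: add.commute)
  also have "\<dots> = emeasure (density lborel (normal_density 0 (sqrt \<delta>))) A"
    by (simp add: emeasure_density)
  finally show ?thesis .
qed

lemma indicator_PiE_restrict:
  fixes x :: "nat \<Rightarrow> 'a"
  shows "indicator (Pi\<^sub>E {..<n} A) (\<lambda>j\<in>{..<n}. x j) = (\<Prod>j<n. indicator (A j) (x j) :: ennreal)"
proof (cases "\<forall>j<n. x j \<in> A j")
  case False
  then show ?thesis by (subst prod_zero) (auto simp: indicator_def PiE_iff)
qed (auto simp: indicator_def PiE_iff)

context prob_space
begin

text \<open>The library notion \<open>indep_var\<close> needs both random variables to have the same type.\<close>

definition independent_of :: "'a measure \<Rightarrow> 'b measure \<Rightarrow> ('a \<Rightarrow> 'b) \<Rightarrow> bool" where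
  "independent_of F N \<xi> \<longleftrightarrow> subalgebra M F \<and> \<xi> \<in> M \<rightarrow>\<^sub>M N \<and>
     (\<forall>A\<in>sets F. \<forall>C\<in>sets N. prob (A \<inter> (\<xi> -` C \<inter> space M)) = prob A * prob (\<xi> -` C \<inter> space M))"

text \<open>The freezing lemma: independence makes the joint law a product, and the iterated
  integral integrates \<open>\<xi>\<close> out while the argument known from \<open>F\<close> is
  held fixed.\<close>

lemma nn_integral_independent_of:
  assumes ind: "independent_of F N \<xi>"
    and f[measurable]: "case_prod f \<in> borel_measurable (F \<Otimes>\<^sub>M N)"
  shows "(\<integral>\<^sup>+p. f p (\<xi> p) \<partial>M) = (\<integral>\<^sup>+p. (\<integral>\<^sup>+x. f p x \<partial>distr M N \<xi>) \<partial>M)"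
proof -
  have F: "space F = space M" "sets F \<subseteq> sets M" and [measurable]: "\<xi> \<in> M \<rightarrow>\<^sub>M N"
    using ind by (auto simp: independent_of_def subalgebra_def)
  have [measurable]: "(\<lambda>p. p) \<in> M \<rightarrow>\<^sub>M F"
    using F by (auto simp: measurable_def sets.Int_space_eq1[of _ M, symmetric] Int_commute)
  \<comment> \<open>Viewing the identity as a map into the coarser space \<open>F\<close> turns the
    sub-sigma-field into a random element, so that independence can be stated as a product law and
    checked on rectangles.\<close>
  have eq: "distr M F (\<lambda>p. p) \<Otimes>\<^sub>M distr M N \<xi> = distr M (F \<Otimes>\<^sub>M N) (\<lambda>p. (p, \<xi> p))"
  proof (rule pair_measure_eqI)
    show "sigma_finite_measure (distr M F (\<lambda>p. p))" "sigma_finite_measure (distr M N \<xi>)"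
      by (intro prob_space_imp_sigma_finite prob_space_distr; measurable)+
    show "sets (distr M F (\<lambda>p. p) \<Otimes>\<^sub>M distr M N \<xi>) = sets (distr M (F \<Otimes>\<^sub>M N) (\<lambda>p. (p, \<xi> p)))"
      by (simp cong: sets_pair_measure_cong)
    fix A C assume "A \<in> sets (distr M F (\<lambda>p. p))" "C \<in> sets (distr M N \<xi>)"
    then have AC[measurable]: "A \<in> sets F" "C \<in> sets N" by auto
    then have [measurable]: "A \<in> sets M" using F(2) by auto
    have Asp: "A \<subseteq> space M" by (rule sets.sets_into_space) fact
    have "emeasure (distr M (F \<Otimes>\<^sub>M N) (\<lambda>p. (p, \<xi> p))) (A \<times> C) = emeasure M (A \<inter> (\<xi> -` C \<inter> space M))"
      by (subst emeasure_distr) (auto intro!: arg_cong[where f="emeasure M"])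
    also have "\<dots> = emeasure M A * emeasure M (\<xi> -` C \<inter> space M)"
      using ind AC by (simp add: independent_of_def emeasure_eq_measure ennreal_mult)
    also have "\<dots> = emeasure (distr M F (\<lambda>p. p)) A * emeasure (distr M N \<xi>) C"
      using Asp by (simp add: emeasure_distr Int_absorb2)
    finally show "emeasure (distr M F (\<lambda>p. p)) A * emeasure (distr M N \<xi>) C
      = emeasure (distr M (F \<Otimes>\<^sub>M N) (\<lambda>p. (p, \<xi> p))) (A \<times> C)" by simp
  qed
  interpret N: prob_space "distr M N \<xi>" by (rule prob_space_distr) measurable
  interpret F: prob_space "distr M F (\<lambda>p. p)" by (rule prob_space_distr) measurable
  have f': "case_prod f \<in> borel_measurable (F \<Otimes>\<^sub>M distr M N \<xi>)"
    using f by (simp cong: measurable_cong_sets sets_pair_measure_cong)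
  have f'': "case_prod f \<in> borel_measurable (distr M F (\<lambda>p. p) \<Otimes>\<^sub>M distr M N \<xi>)"
    using f by (simp cong: measurable_cong_sets sets_pair_measure_cong)
  have "(\<integral>\<^sup>+p. f p (\<xi> p) \<partial>M) = (\<integral>\<^sup>+z. case_prod f z \<partial>distr M (F \<Otimes>\<^sub>M N) (\<lambda>p. (p, \<xi> p)))"
    by (subst nn_integral_distr) auto
  also have "\<dots> = (\<integral>\<^sup>+z. case_prod f z \<partial>(distr M F (\<lambda>p. p) \<Otimes>\<^sub>M distr M N \<xi>))"
    by (simp add: eq)
  also have "\<dots> = (\<integral>\<^sup>+p. (\<integral>\<^sup>+x. f p x \<partial>distr M N \<xi>) \<partial>distr M F (\<lambda>p. p))"
    using N.nn_integral_fst[OF f''] by simp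
  also have "\<dots> = (\<integral>\<^sup>+p. (\<integral>\<^sup>+x. f p x \<partial>distr M N \<xi>) \<partial>M)"
    using N.borel_measurable_nn_integral_fst[OF f'] by (subst nn_integral_distr) auto
  finally show ?thesis .
qed

text \<open>Peeling off the last step: it is independent of the past, which determines the drift, so it can
  be integrated for a fixed drift by the translation formula for the Gaussian density.\<close>

lemma girsanov_rectangle:
  fixes \<xi> b :: "nat \<Rightarrow> 'a \<Rightarrow> real" and F :: "nat \<Rightarrow> 'a measure"
  assumes "0 < \<delta>"
    and ind: "\<And>j. j < n \<Longrightarrow> independent_of (F j) borel (\<xi> j)"
    and F: "\<And>i j. i \<le> j \<Longrightarrow> j < n \<Longrightarrow> subalgebra (F j) (F i)"
    and \<xi>: "\<And>i j. i < j \<Longrightarrow> j < n \<Longrightarrow> \<xi> i \<in> borel_measurable (F j)"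
    and b: "\<And>j. j < n \<Longrightarrow> b j \<in> borel_measurable (F j)"
    and dist: "\<And>j. j < n \<Longrightarrow> distributed M lborel (\<xi> j) (normal_density 0 (sqrt \<delta>))"
    and A: "\<And>j. j < n \<Longrightarrow> A j \<in> sets borel"
    and "m \<le> n"
  shows "(\<integral>\<^sup>+p. (\<Prod>j<m. indicator (A j) (\<xi> j p + b j p * \<delta>)
             * ennreal (exp (- (b j p * \<xi> j p) - (b j p)\<^sup>2 * \<delta> / 2))) \<partial>M)
       = (\<Prod>j<m. emeasure (density lborel (normal_density 0 (sqrt \<delta>))) (A j))"
  using \<open>m \<le> n\<close>
proof (induction m)
  case 0
  then show ?case by (simp add: emeasure_space_1)
next
  case (Suc m)
  let ?N = "density lborel (normal_density 0 (sqrt \<delta>))"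
  let ?t = "\<lambda>j p. indicator (A j) (\<xi> j p + b j p * \<delta>)
             * ennreal (exp (- (b j p * \<xi> j p) - (b j p)\<^sup>2 * \<delta> / 2))"
  have m: "m < n" using Suc.prems by simp
  have [measurable]: "A j \<in> sets borel" if "j \<le> m" for j using A that m by auto
  have [measurable]: "b j \<in> borel_measurable (F m)" if "j \<le> m" for j
    using measurable_from_subalg[OF F b] m that by auto
  have [measurable]: "\<xi> j \<in> borel_measurable (F m)" if "j < m" for j
    using \<xi>[of j m] m that by auto
  have Y[measurable]: "(\<lambda>p. \<Prod>j<m. ?t j p) \<in> borel_measurable (F m)"
    by (intro borel_measurable_prod_ennreal) measurable
  have N: "distr M borel (\<xi> m) = ?N"
    using distributed_distr_eq_density[OF dist[OF m]]
    by (metis distr_cong sets_lborel)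
  have meas: "(\<lambda>(p, x). (\<Prod>j<m. ?t j p) * (indicator (A m) (x + b m p * \<delta>)
              * ennreal (exp (- (b m p * x) - (b m p)\<^sup>2 * \<delta> / 2)))) \<in> borel_measurable (F m \<Otimes>\<^sub>M borel)"
    by measurable
  have "(\<integral>\<^sup>+p. (\<Prod>j<Suc m. ?t j p) \<partial>M) = (\<integral>\<^sup>+p. (\<Prod>j<m. ?t j p) * ?t m p \<partial>M)"
    by (simp add: mult.assoc)
  also have "\<dots> = (\<integral>\<^sup>+p. (\<integral>\<^sup>+x. (\<Prod>j<m. ?t j p) * (indicator (A m) (x + b m p * \<delta>)
              * ennreal (exp (- (b m p * x) - (b m p)\<^sup>2 * \<delta> / 2))) \<partial>distr M borel (\<xi> m)) \<partial>M)"
    by (rule nn_integral_independent_of[OF ind[OF m] meas])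
  \<comment> \<open>For a frozen past the inner integral has the same value whatever the drift
    \<open>b m p\<close> is, so it leaves the integral as a constant.\<close>
  also have "\<dots> = (\<integral>\<^sup>+p. (\<Prod>j<m. ?t j p) * emeasure ?N (A m) \<partial>M)"
    by (simp add: N nn_integral_cmult nn_integral_normal_shift[OF \<open>0 < \<delta>\<close>])
  also have "\<dots> = (\<integral>\<^sup>+p. (\<Prod>j<m. ?t j p) \<partial>M) * emeasure ?N (A m)"
  proof (rule nn_integral_multc)
    show "(\<lambda>p. \<Prod>j<m. ?t j p) \<in> borel_measurable M"
      using ind[OF m] Y by (auto simp: independent_of_def intro: measurable_from_subalg)
  qed
  finally show ?case using Suc by simp
qed

text \<open>Minus the logarithm of the Girsanov density. It is expressed through the original
  increments \<open>\<xi>\<close>, which is why the quadratic term enters with a plus sign.\<close>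

definition girsanov_exponent :: "nat \<Rightarrow> real \<Rightarrow> (nat \<Rightarrow> 'a \<Rightarrow> real) \<Rightarrow> (nat \<Rightarrow> 'a \<Rightarrow> real) \<Rightarrow> 'a \<Rightarrow> real" where
  "girsanov_exponent n \<delta> \<xi> b p = (\<Sum>j<n. b j p * \<xi> j p + (b j p)\<^sup>2 * \<delta> / 2)"

text \<open>The law of the drifted increments under the density and the law of the plain increments
  agree on rectangles, by the rectangle formula with drift \<open>b\<close> and with drift 0.
  Rectangles are intersection-stable and generate the product sigma-field.\<close>

lemma girsanov_discrete:
  fixes \<xi> b :: "nat \<Rightarrow> 'a \<Rightarrow> real" and F :: "nat \<Rightarrow> 'a measure"
  assumes "0 < \<delta>"
    and ind: "\<And>j. j < n \<Longrightarrow> independent_of (F j) borel (\<xi> j)"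
    and F: "\<And>i j. i \<le> j \<Longrightarrow> j < n \<Longrightarrow> subalgebra (F j) (F i)"
    and \<xi>: "\<And>i j. i < j \<Longrightarrow> j < n \<Longrightarrow> \<xi> i \<in> borel_measurable (F j)"
    and b: "\<And>j. j < n \<Longrightarrow> b j \<in> borel_measurable (F j)"
    and dist: "\<And>j. j < n \<Longrightarrow> distributed M lborel (\<xi> j) (normal_density 0 (sqrt \<delta>))"
    and f[measurable]: "f \<in> borel_measurable (PiM {..<n} (\<lambda>_. borel))"
  shows "(\<integral>\<^sup>+p. f (\<lambda>j\<in>{..<n}. \<xi> j p + b j p * \<delta>) * ennreal (exp (- girsanov_exponent n \<delta> \<xi> b p)) \<partial>M)
       = (\<integral>\<^sup>+p. f (\<lambda>j\<in>{..<n}. \<xi> j p) \<partial>M)"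
proof -
  let ?N = "density lborel (normal_density 0 (sqrt \<delta>))" and ?P = "PiM {..<n} (\<lambda>_. borel :: real measure)"
  define Z where "Z p = ennreal (exp (- girsanov_exponent n \<delta> \<xi> b p))" for p
  have [measurable]: "\<xi> j \<in> borel_measurable M" "b j \<in> borel_measurable M" if "j < n" for j
    using ind[OF that] b[OF that] by (auto simp: independent_of_def intro: measurable_from_subalg)
  have [measurable]: "girsanov_exponent n \<delta> \<xi> b \<in> borel_measurable M"
    unfolding girsanov_exponent_def by measurable
  have Z[measurable]: "Z \<in> borel_measurable M" unfolding Z_def by measurable
  have Zprod: "Z p = (\<Prod>j<n. ennreal (exp (- (b j p * \<xi> j p) - (b j p)\<^sup>2 * \<delta> / 2)))" for p
    by (simp add: Z_def girsanov_exponent_def prod_ennreal exp_sum[symmetric] sum_negf[symmetric])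
  have U[measurable]: "(\<lambda>p. \<lambda>j\<in>{..<n}. \<xi> j p + b j p * \<delta>) \<in> M \<rightarrow>\<^sub>M ?P"
    by (intro measurable_restrict) measurable
  have V[measurable]: "(\<lambda>p. \<lambda>j\<in>{..<n}. \<xi> j p) \<in> M \<rightarrow>\<^sub>M ?P"
    by (intro measurable_restrict) measurable
  have "distr (density M Z) ?P (\<lambda>p. \<lambda>j\<in>{..<n}. \<xi> j p + b j p * \<delta>) = distr M ?P (\<lambda>p. \<lambda>j\<in>{..<n}. \<xi> j p)"
    (is "?Q = ?R")
  proof (rule measure_eqI_PiM_finite)
    fix A :: "nat \<Rightarrow> real set" assume A: "\<And>i. i \<in> {..<n} \<Longrightarrow> A i \<in> sets borel"
    have [measurable]: "A j \<in> sets borel" if "j < n" for j using A that by auto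
    have AP[measurable]: "Pi\<^sub>E {..<n} A \<in> sets ?P" by (intro sets_PiM_I_finite) auto
    have "?Q (Pi\<^sub>E {..<n} A) = (\<integral>\<^sup>+p. Z p * indicator (Pi\<^sub>E {..<n} A) (\<lambda>j\<in>{..<n}. \<xi> j p + b j p * \<delta>) \<partial>M)"
      by (subst emeasure_distr) (auto simp: emeasure_density indicator_def intro!: nn_integral_cong)
    also have "\<dots> = (\<integral>\<^sup>+p. (\<Prod>j<n. indicator (A j) (\<xi> j p + b j p * \<delta>)
             * ennreal (exp (- (b j p * \<xi> j p) - (b j p)\<^sup>2 * \<delta> / 2))) \<partial>M)"
      by (intro nn_integral_cong)
         (simp add: indicator_PiE_restrict Zprod prod.distrib mult.commute)
    also have "\<dots> = (\<Prod>j<n. emeasure ?N (A j))"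
      by (rule girsanov_rectangle[where F=F and n=n]) (use assms A in auto)
    also have "\<dots> = (\<integral>\<^sup>+p. (\<Prod>j<n. indicator (A j) (\<xi> j p + (\<lambda>_ _. 0) j p * \<delta>)
             * ennreal (exp (- ((\<lambda>_ _. 0) j p * \<xi> j p) - ((\<lambda>_ _. 0) j p)\<^sup>2 * \<delta> / 2))) \<partial>M)"
      by (rule girsanov_rectangle[where F=F and n=n, symmetric]) (use assms A in auto)
    also have "\<dots> = (\<integral>\<^sup>+p. indicator (Pi\<^sub>E {..<n} A) (\<lambda>j\<in>{..<n}. \<xi> j p) \<partial>M)"
      by (intro nn_integral_cong) (simp add: indicator_PiE_restrict)
    also have "\<dots> = ?R (Pi\<^sub>E {..<n} A)"
      by (subst emeasure_distr) (auto simp: indicator_def simp flip: nn_integral_indicator intro!: nn_integral_cong)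
    finally show "?Q (Pi\<^sub>E {..<n} A) = ?R (Pi\<^sub>E {..<n} A)" .
  next
    have "Pi\<^sub>E {..<n} (\<lambda>_. UNIV) \<in> prod_algebra {..<n} (\<lambda>_. borel :: real measure)"
      by (intro prod_algebraI_finite) auto
    then show "range (\<lambda>_::nat. space ?P) \<subseteq> prod_algebra {..<n} (\<lambda>_. borel)"
      by (auto simp: space_PiM)
    \<comment> \<open>The whole space is the rectangle with all sides \<open>UNIV\<close>; its mass
      1 says that the density has expectation 1, which supplies the finiteness needed for uniqueness
      of measures.\<close>
    have "?Q (space ?P) = (\<integral>\<^sup>+p. (\<Prod>j<n. indicator UNIV (\<xi> j p + b j p * \<delta>)
             * ennreal (exp (- (b j p * \<xi> j p) - (b j p)\<^sup>2 * \<delta> / 2))) \<partial>M)"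
      by (subst emeasure_distr)
         (auto simp: emeasure_density space_PiM indicator_def Zprod intro!: nn_integral_cong)
    also have "\<dots> = (\<Prod>j<n. emeasure ?N UNIV)"
      by (rule girsanov_rectangle[where F=F and n=n]) (use assms in auto)
    also have "\<dots> = 1"
    proof (intro prod.neutral ballI)
      fix j assume "j \<in> {..<n}"
      interpret N: prob_space ?N using \<open>0 < \<delta>\<close> by (intro prob_space_normal_density) auto
      show "emeasure ?N UNIV = 1" using N.emeasure_space_1 by simp
    qed
    finally show "\<And>i::nat. ?Q (space ?P) \<noteq> \<infinity>" by simp
  qed auto
  then have "(\<integral>\<^sup>+x. f x \<partial>?Q) = (\<integral>\<^sup>+x. f x \<partial>?R)" by simp
  then show ?thesis
    by (simp add: nn_integral_distr nn_integral_density mult.commute Z_def[symmetric])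
qed

text \<open>Write \<open>S b\<close> for the exponent. Then \<open>S b = - S (- b) + q\<close> and
  \<open>- 2 * S b = - S (2 * b) + q\<close>, where \<open>q\<close> is the sum of the
  \<open>(b j p)\<^sup>2 * \<delta>\<close> and is at most \<open>e\<close>. Both densities
  \<open>exp (- S (a * b))\<close> have expectation 1, by \<open>girsanov_discrete\<close> applied
  to a constant function; hence the factors -1 and 2 below.\<close>

lemma girsanov_second_moments:
  fixes \<xi> b :: "nat \<Rightarrow> 'a \<Rightarrow> real" and F :: "nat \<Rightarrow> 'a measure"
  assumes "0 < \<delta>"
    and ind: "\<And>j. j < n \<Longrightarrow> independent_of (F j) borel (\<xi> j)"
    and F: "\<And>i j. i \<le> j \<Longrightarrow> j < n \<Longrightarrow> subalgebra (F j) (F i)"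
    and \<xi>: "\<And>i j. i < j \<Longrightarrow> j < n \<Longrightarrow> \<xi> i \<in> borel_measurable (F j)"
    and b: "\<And>j. j < n \<Longrightarrow> b j \<in> borel_measurable (F j)"
    and dist: "\<And>j. j < n \<Longrightarrow> distributed M lborel (\<xi> j) (normal_density 0 (sqrt \<delta>))"
    and bd: "AE p in M. (\<Sum>j<n. (b j p)\<^sup>2 * \<delta>) \<le> e"
  shows "(\<integral>\<^sup>+p. ennreal (exp (girsanov_exponent n \<delta> \<xi> b p)) \<partial>M) \<le> ennreal (exp e)"
    and "(\<integral>\<^sup>+p. ennreal (exp (- 2 * girsanov_exponent n \<delta> \<xi> b p)) \<partial>M) \<le> ennreal (exp e)"
proof -
  have bound: "(\<integral>\<^sup>+p. ennreal (exp g) * ennreal (exp (- girsanov_exponent n \<delta> \<xi> (\<lambda>j p. a * b j p) p)) \<partial>M)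
      = ennreal (exp g)" for a g
  proof -
    have "ennreal (exp g) = (\<integral>\<^sup>+p. ennreal (exp g) \<partial>M)" by (simp add: emeasure_space_1)
    also have "\<dots> = (\<integral>\<^sup>+p. ennreal (exp g) * ennreal (exp (- girsanov_exponent n \<delta> \<xi> (\<lambda>j p. a * b j p) p)) \<partial>M)"
      by (rule girsanov_discrete[where F=F and f="\<lambda>_. ennreal (exp g)" and b="\<lambda>j p. a * b j p", symmetric])
        (use assms in \<open>auto intro!: borel_measurable_times\<close>)
    finally show ?thesis by simp
  qed
  have le: "(\<integral>\<^sup>+p. ennreal (exp (h p)) \<partial>M) \<le> ennreal (exp e)"
    if "\<And>p. h p = - girsanov_exponent n \<delta> \<xi> (\<lambda>j p. a * b j p) p + (\<Sum>j<n. (b j p)\<^sup>2 * \<delta>)" for a h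
  proof -
    have "(\<integral>\<^sup>+p. ennreal (exp (h p)) \<partial>M)
      \<le> (\<integral>\<^sup>+p. ennreal (exp e) * ennreal (exp (- girsanov_exponent n \<delta> \<xi> (\<lambda>j p. a * b j p) p)) \<partial>M)"
      using bd
    proof (intro nn_integral_mono_AE, eventually_elim)
      case (elim p)
      then show ?case by (auto simp: that exp_add[symmetric] simp flip: ennreal_mult)
    qed
    then show ?thesis by (simp add: bound)
  qed
  show "(\<integral>\<^sup>+p. ennreal (exp (girsanov_exponent n \<delta> \<xi> b p)) \<partial>M) \<le> ennreal (exp e)"
    by (rule le[of _ "-1"]) (simp add: girsanov_exponent_def sum_negf[symmetric] sum.distrib[symmetric] algebra_simps)
  show "(\<integral>\<^sup>+p. ennreal (exp (- 2 * girsanov_exponent n \<delta> \<xi> b p)) \<partial>M) \<le> ennreal (exp e)"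
    by (rule le[of _ 2]) (simp add: girsanov_exponent_def sum_negf[symmetric] sum.distrib[symmetric]
      sum_distrib_left power_mult_distrib algebra_simps)
qed

text \<open>Both inequalities are Cauchy--Schwarz for the change of measure of \<open>girsanov_discrete\<close>.\<close>

lemma girsanov_compare:
  fixes \<xi> b :: "nat \<Rightarrow> 'a \<Rightarrow> real" and F :: "nat \<Rightarrow> 'a measure"
  assumes "0 < \<delta>"
    and ind: "\<And>j. j < n \<Longrightarrow> independent_of (F j) borel (\<xi> j)"
    and F: "\<And>i j. i \<le> j \<Longrightarrow> j < n \<Longrightarrow> subalgebra (F j) (F i)"
    and \<xi>: "\<And>i j. i < j \<Longrightarrow> j < n \<Longrightarrow> \<xi> i \<in> borel_measurable (F j)"
    and b: "\<And>j. j < n \<Longrightarrow> b j \<in> borel_measurable (F j)"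
    and dist: "\<And>j. j < n \<Longrightarrow> distributed M lborel (\<xi> j) (normal_density 0 (sqrt \<delta>))"
    and bd: "AE p in M. (\<Sum>j<n. (b j p)\<^sup>2 * \<delta>) \<le> e"
    and f[measurable]: "f \<in> borel_measurable (PiM {..<n} (\<lambda>_. borel))"
  shows "(\<integral>\<^sup>+p. f (\<lambda>j\<in>{..<n}. \<xi> j p + b j p * \<delta>) \<partial>M)\<^sup>2
           \<le> ennreal (exp e) * (\<integral>\<^sup>+p. (f (\<lambda>j\<in>{..<n}. \<xi> j p))\<^sup>2 \<partial>M)"
    and "(\<integral>\<^sup>+p. f (\<lambda>j\<in>{..<n}. \<xi> j p) \<partial>M)\<^sup>2
           \<le> ennreal (exp e) * (\<integral>\<^sup>+p. (f (\<lambda>j\<in>{..<n}. \<xi> j p + b j p * \<delta>))\<^sup>2 \<partial>M)"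
proof -
  let ?S = "girsanov_exponent n \<delta> \<xi> b"
  let ?U = "\<lambda>p. \<lambda>j\<in>{..<n}. \<xi> j p + b j p * \<delta>" and ?V = "\<lambda>p. \<lambda>j\<in>{..<n}. \<xi> j p"
  have [measurable]: "\<xi> j \<in> borel_measurable M" "b j \<in> borel_measurable M" if "j < n" for j
    using ind[OF that] b[OF that] by (auto simp: independent_of_def intro: measurable_from_subalg)
  have [measurable]: "?S \<in> borel_measurable M" unfolding girsanov_exponent_def by measurable
  have [measurable]: "?U \<in> M \<rightarrow>\<^sub>M PiM {..<n} (\<lambda>_. borel)" by (intro measurable_restrict) measurable
  have [measurable]: "?V \<in> M \<rightarrow>\<^sub>M PiM {..<n} (\<lambda>_. borel)" by (intro measurable_restrict) measurable
  \<comment> \<open>The factor 1 is split as \<open>exp (- ?S p / 2) * exp (?S p / 2)\<close>: the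
    first half becomes the density once squared, so that the drift can be removed, and the second
    becomes its inverse.\<close>
  have "(\<integral>\<^sup>+p. f (?U p) \<partial>M)\<^sup>2 = (\<integral>\<^sup>+p. (f (?U p) * ennreal (exp (- ?S p / 2))) * ennreal (exp (?S p / 2)) \<partial>M)\<^sup>2"
    by (simp add: mult.assoc flip: ennreal_mult exp_add)
  also have "\<dots> \<le> (\<integral>\<^sup>+p. (f (?U p) * ennreal (exp (- ?S p / 2)))\<^sup>2 \<partial>M) * (\<integral>\<^sup>+p. (ennreal (exp (?S p / 2)))\<^sup>2 \<partial>M)"
    by (rule Cauchy_Schwarz_nn_integral) measurable
  also have "\<dots> = (\<integral>\<^sup>+p. (f (?U p))\<^sup>2 * ennreal (exp (- ?S p)) \<partial>M) * (\<integral>\<^sup>+p. ennreal (exp (?S p)) \<partial>M)"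
    by (simp add: power_mult_distrib ennreal_power flip: exp_of_nat_mult)
  also have "(\<integral>\<^sup>+p. (f (?U p))\<^sup>2 * ennreal (exp (- ?S p)) \<partial>M) = (\<integral>\<^sup>+p. (f (?V p))\<^sup>2 \<partial>M)"
    by (rule girsanov_discrete[where F=F and f="\<lambda>x. (f x)\<^sup>2"]) (use assms in auto)
  also have "(\<integral>\<^sup>+p. (f (?V p))\<^sup>2 \<partial>M) * (\<integral>\<^sup>+p. ennreal (exp (?S p)) \<partial>M) \<le> (\<integral>\<^sup>+p. (f (?V p))\<^sup>2 \<partial>M) * ennreal (exp e)"
    by (intro mult_left_mono girsanov_second_moments(1)[where F=F]) (use assms in auto)
  finally show "(\<integral>\<^sup>+p. f (?U p) \<partial>M)\<^sup>2 \<le> ennreal (exp e) * (\<integral>\<^sup>+p. (f (?V p))\<^sup>2 \<partial>M)"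
    by (simp only: mult.commute[of "ennreal (exp e)"])
  have "(\<integral>\<^sup>+p. f (?V p) \<partial>M)\<^sup>2 = (\<integral>\<^sup>+p. f (?U p) * ennreal (exp (- ?S p)) \<partial>M)\<^sup>2"
    by (subst girsanov_discrete[where F=F and b=b, symmetric]) (use assms in auto)
  also have "\<dots> \<le> (\<integral>\<^sup>+p. (f (?U p))\<^sup>2 \<partial>M) * (\<integral>\<^sup>+p. (ennreal (exp (- ?S p)))\<^sup>2 \<partial>M)"
    by (rule Cauchy_Schwarz_nn_integral) measurable
  also have "\<dots> = (\<integral>\<^sup>+p. (f (?U p))\<^sup>2 \<partial>M) * (\<integral>\<^sup>+p. ennreal (exp (- 2 * ?S p)) \<partial>M)"
    by (simp add: ennreal_power flip: exp_of_nat_mult)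
  also have "\<dots> \<le> (\<integral>\<^sup>+p. (f (?U p))\<^sup>2 \<partial>M) * ennreal (exp e)"
    by (intro mult_left_mono girsanov_second_moments(2)[where F=F]) (use assms in auto)
  finally show "(\<integral>\<^sup>+p. f (?V p) \<partial>M)\<^sup>2 \<le> ennreal (exp e) * (\<integral>\<^sup>+p. (f (?U p))\<^sup>2 \<partial>M)"
    by (simp only: mult.commute[of "ennreal (exp e)"])
qed

text \<open>The estimate passes to the limit only for bounded continuous \<open>f\<close>, by
  dominated convergence. Closed sets are reached by continuous functions decreasing to their
  indicators, Borel sets by inner regularity on the Polish space of sequences. The roles of
  \<open>Y\<close> and \<open>B\<close> can be exchanged, so two applications give
  equivalence.\<close>

lemma absolutely_continuous_limit:
  fixes Y B :: "'a \<Rightarrow> (nat \<Rightarrow> real)" and Yn Bn :: "nat \<Rightarrow> 'a \<Rightarrow> (nat \<Rightarrow> real)"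
  assumes [measurable]: "Y \<in> borel_measurable M" "B \<in> borel_measurable M"
      "\<And>n. Yn n \<in> borel_measurable M" "\<And>n. Bn n \<in> borel_measurable M"
    and Y: "AE p in M. (\<lambda>n. Yn n p) \<longlonglongrightarrow> Y p" and B: "AE p in M. (\<lambda>n. Bn n p) \<longlonglongrightarrow> B p"
    and le: "\<And>f n. f \<in> borel_measurable borel \<Longrightarrow>
      (\<integral>\<^sup>+p. f (Yn n p) \<partial>M)\<^sup>2 \<le> ennreal C * (\<integral>\<^sup>+p. (f (Bn n p))\<^sup>2 \<partial>M)"
    and A: "A \<in> sets borel" "emeasure M (B -` A \<inter> space M) = 0"
  shows "emeasure M (Y -` A \<inter> space M) = 0"
proof -
  have cont: "(\<integral>\<^sup>+p. ennreal (f (Y p)) \<partial>M)\<^sup>2 \<le> ennreal C * (\<integral>\<^sup>+p. (ennreal (f (B p)))\<^sup>2 \<partial>M)"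
    if f: "continuous_on UNIV f" "\<And>x. 0 \<le> f x \<and> f x \<le> (1::real)" for f
  proof -
    have [measurable]: "f \<in> borel_measurable borel" using f(1) by (rule borel_measurable_continuous_onI)
    have 1: "(\<lambda>n. \<integral>\<^sup>+p. ennreal (f (Yn n p)) \<partial>M) \<longlonglongrightarrow> (\<integral>\<^sup>+p. ennreal (f (Y p)) \<partial>M)"
    proof (rule nn_integral_dominated_convergence[where w="\<lambda>_. 1"])
      show "AE p in M. (\<lambda>n. ennreal (f (Yn n p))) \<longlonglongrightarrow> ennreal (f (Y p))"
        using Y by eventually_elim (intro tendsto_ennrealI continuous_on_tendsto_compose[OF f(1)]; simp)
    qed (use f in \<open>auto simp: emeasure_space_1\<close>)
    have 2: "(\<lambda>n. \<integral>\<^sup>+p. (ennreal (f (Bn n p)))\<^sup>2 \<partial>M) \<longlonglongrightarrow> (\<integral>\<^sup>+p. (ennreal (f (B p)))\<^sup>2 \<partial>M)"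
    proof (rule nn_integral_dominated_convergence[where w="\<lambda>_. 1"])
      show "AE p in M. (\<lambda>n. (ennreal (f (Bn n p)))\<^sup>2) \<longlonglongrightarrow> (ennreal (f (B p)))\<^sup>2"
        using B f(2)
        by (auto elim!: eventually_mono simp: ennreal_power
           intro!: tendsto_ennrealI tendsto_power continuous_on_tendsto_compose[OF f(1)])
      show "AE x in M. (ennreal (f (Bn j x)))\<^sup>2 \<le> 1" for j
        using f(2) by (auto simp: ennreal_power power_le_one)
    qed (auto simp: emeasure_space_1)
    have "(\<lambda>n. (\<integral>\<^sup>+p. ennreal (f (Yn n p)) \<partial>M)\<^sup>2) \<longlonglongrightarrow> (\<integral>\<^sup>+p. ennreal (f (Y p)) \<partial>M)\<^sup>2"
      unfolding power2_eq_square
      using 1 f(2) by (intro tendsto_mult_ennreal)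
        (auto simp: not_le intro: order.strict_trans1[OF nn_integral_mono[of M _ "\<lambda>_. 1"]] simp: emeasure_space_1)
    moreover have "(\<lambda>n. ennreal C * (\<integral>\<^sup>+p. (ennreal (f (Bn n p)))\<^sup>2 \<partial>M)) \<longlonglongrightarrow> ennreal C * (\<integral>\<^sup>+p. (ennreal (f (B p)))\<^sup>2 \<partial>M)"
      by (intro ennreal_tendsto_cmult 2) auto
    ultimately show ?thesis
      by (rule LIMSEQ_le) (use le[of "\<lambda>x. ennreal (f x)"] in auto)
  qed
  have closed: "emeasure M (Y -` F \<inter> space M) = 0" if F: "closed F" "emeasure M (B -` F \<inter> space M) = 0" for F
  proof (cases "F = {}")
    case False
    have [measurable]: "F \<in> sets borel" using F(1) by (rule borel_closed)
    \<comment> \<open>Tents of height 1 over \<open>F\<close>: equal to 1 on \<open>F\<close> and,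
      since \<open>F\<close> is closed, eventually 0 at every point off \<open>F\<close>.\<close>
    define f where "f m x = max 0 (1 - real m * infdist x F)" for m x
    have f: "continuous_on UNIV (f m)" "0 \<le> f m x \<and> f m x \<le> 1" for m x
      unfolding f_def by (auto intro!: continuous_intros mult_nonneg_nonneg infdist_nonneg)
    have [measurable]: "f m \<in> borel_measurable borel" for m using f(1) by (rule borel_measurable_continuous_onI)
    have f1: "f m x = 1" if "x \<in> F" for m x using that by (simp add: f_def)
    have f0: "(\<lambda>m. f m x) \<longlonglongrightarrow> 0" if "x \<notin> F" for x
    proof (rule tendsto_eventually)
      have pos: "0 < infdist x F" using that F(1) False by (simp add: in_closed_iff_infdist_zero infdist_nonneg less_le)
      then obtain N where N: "1 < real N * infdist x F" using reals_Archimedean3 by blast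
      have "f m x = 0" if "N \<le> m" for m
      proof -
        have "real N * infdist x F \<le> real m * infdist x F" using that pos by (intro mult_right_mono) auto
        then show ?thesis using N by (simp add: f_def)
      qed
      then show "\<forall>\<^sub>F m in sequentially. f m x = 0" by (auto simp: eventually_sequentially)
    qed
    have "(\<lambda>m. \<integral>\<^sup>+p. (ennreal (f m (B p)))\<^sup>2 \<partial>M) \<longlonglongrightarrow> (\<integral>\<^sup>+p. 0 \<partial>M)"
    proof (rule nn_integral_dominated_convergence[where w="\<lambda>_. 1"])
      have "AE p in M. B p \<notin> F"
        using F(2) by (intro AE_I[where N="B -` F \<inter> space M"]) auto
      then show "AE p in M. (\<lambda>m. (ennreal (f m (B p)))\<^sup>2) \<longlonglongrightarrow> 0"
      proof eventually_elim
        case (elim p)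
        have "(\<lambda>m. ennreal ((f m (B p))\<^sup>2)) \<longlonglongrightarrow> ennreal (0\<^sup>2)"
          by (intro tendsto_ennrealI tendsto_power f0 elim)
        then show ?case using f(2) by (simp add: ennreal_power)
      qed
      show "AE x in M. (ennreal (f j (B x)))\<^sup>2 \<le> 1" for j
        using f(2) by (auto simp: ennreal_power power_le_one)
    qed (auto simp: emeasure_space_1)
    then have lim: "(\<lambda>m. ennreal C * (\<integral>\<^sup>+p. (ennreal (f m (B p)))\<^sup>2 \<partial>M)) \<longlonglongrightarrow> ennreal C * 0"
      by (intro ennreal_tendsto_cmult) auto
    have "(emeasure M (Y -` F \<inter> space M))\<^sup>2 \<le> ennreal C * (\<integral>\<^sup>+p. (ennreal (f m (B p)))\<^sup>2 \<partial>M)" for m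
    proof -
      have "emeasure M (Y -` F \<inter> space M) = (\<integral>\<^sup>+p. indicator (Y -` F \<inter> space M) p \<partial>M)" by simp
      also have "\<dots> \<le> (\<integral>\<^sup>+p. ennreal (f m (Y p)) \<partial>M)"
        by (intro nn_integral_mono) (auto simp: indicator_def f1)
      finally have "(emeasure M (Y -` F \<inter> space M))\<^sup>2 \<le> (\<integral>\<^sup>+p. ennreal (f m (Y p)) \<partial>M)\<^sup>2"
        by (intro power_mono) auto
      also have "\<dots> \<le> ennreal C * (\<integral>\<^sup>+p. (ennreal (f m (B p)))\<^sup>2 \<partial>M)" by (intro cont f)
      finally show ?thesis .
    qed
    then have "(emeasure M (Y -` F \<inter> space M))\<^sup>2 \<le> ennreal C * 0"
      by (intro LIMSEQ_le_const[OF lim]) auto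
    then show ?thesis by simp
  qed simp
  \<comment> \<open>A compact subset of \<open>A\<close> is closed and null under the law of
    \<open>B\<close>, hence null under the law of \<open>Y\<close>; the supremum over such subsets
    is the mass of \<open>A\<close>.\<close>
  let ?D = "distr M borel Y"
  interpret D: prob_space ?D by (rule prob_space_distr) measurable
  have "emeasure ?D A = (SUP K\<in>{K. K \<subseteq> A \<and> compact K}. emeasure ?D K)"
    by (rule inner_regular) (use A in auto)
  also have "\<dots> = 0"
  proof -
    have "emeasure ?D K = 0" if "K \<subseteq> A" "compact K" for K
    proof -
      have K: "closed K" "K \<in> sets borel" using that by (auto simp: compact_imp_closed borel_compact)
      have "emeasure M (B -` K \<inter> space M) \<le> emeasure M (B -` A \<inter> space M)"
        using that A by (intro emeasure_mono) auto
      then have "emeasure M (Y -` K \<inter> space M) = 0" using A by (intro closed K) auto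
      then show ?thesis using K by (simp add: emeasure_distr)
    qed
    then show ?thesis by (auto simp: SUP_eq_const intro!: SUP_eq_const)
  qed
  finally show ?thesis using A by (simp add: emeasure_distr)
qed

end

section \<open>The Cameron--Martin norm as an energy\<close>

text \<open>With \<open>a\<close> the mass of \<open>A\<close>, \<open>I\<close> and
  \<open>Q\<close> the integrals of \<open>g\<close> and of its square, the integral of
  \<open>(a * g - I)\<^sup>2\<close> over \<open>A\<close> is
  \<open>a * (a * Q - I\<^sup>2)\<close>. Dividing by \<open>a\<close> excludes null sets, where
  \<open>I\<close> vanishes anyway.\<close>

lemma (in finite_measure) set_integral_Cauchy_Schwarz:
  fixes g :: "'a \<Rightarrow> real"
  assumes [measurable]: "A \<in> sets M" "g \<in> borel_measurable M"
    and g: "integrable M (\<lambda>x. (g x)\<^sup>2)"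
  shows "(LINT x:A|M. g x)\<^sup>2 \<le> measure M A * (LINT x:A|M. (g x)\<^sup>2)"
proof -
  have [simp]: "integrable M g" by (rule square_integrable_imp_integrable) (use g in auto)
  have gA: "set_integrable M A g" "set_integrable M A (\<lambda>x. (g x)\<^sup>2)" "set_integrable M A (\<lambda>x. c)" for c :: real
    unfolding set_integrable_def using g by (auto intro!: integrable_mult_indicator simp del: real_scaleR_def)
  define a I Q where "a = measure M A" and "I = (LINT x:A|M. g x)" and "Q = (LINT x:A|M. (g x)\<^sup>2)"
  have "0 \<le> (LINT x:A|M. (a * g x - I)\<^sup>2)"
    unfolding set_lebesgue_integral_def by (intro integral_nonneg_AE) auto
  also have "\<dots> = (LINT x:A|M. a\<^sup>2 * (g x)\<^sup>2 - 2 * a * I * g x + I\<^sup>2)"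
    by (intro set_lebesgue_integral_cong) (auto simp: power2_eq_square algebra_simps)
  also have "\<dots> = a\<^sup>2 * Q - 2 * a * I * I + a * I\<^sup>2"
  proof -
    have "(LINT x:A|M. I\<^sup>2) = a * I\<^sup>2" by (simp add: set_lebesgue_integral_def a_def)
    with gA show ?thesis
      by (simp add: set_integral_add set_integral_diff set_integrable_mult_right Q_def) (simp add: I_def)
  qed
  also have "\<dots> = a * (a * Q - I\<^sup>2)" by (simp add: power2_eq_square algebra_simps)
  finally have *: "0 \<le> a * (a * Q - I\<^sup>2)" .
  show ?thesis
  proof (cases "a = 0")
    case True
    then have "A \<in> null_sets M" by (auto simp: a_def measure_eq_0_null_sets emeasure_eq_measure)
    then have "AE x in M. x \<notin> A" by (rule AE_not_in)
    then have "I = 0" unfolding I_def set_lebesgue_integral_def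
      by (intro integral_eq_zero_AE) (auto elim!: eventually_mono)
    with True show ?thesis by (simp add: a_def I_def)
  next
    case False
    then have "0 < a" by (simp add: a_def less_le)
    with * have "0 \<le> a * Q - I\<^sup>2" by (simp add: zero_le_mult_iff)
    then show ?thesis by (simp add: a_def I_def Q_def)
  qed
qed

abbreviation unit_lebesgue :: "real measure" where
  "unit_lebesgue \<equiv> restrict_space lborel {0..1}"

lemma prob_space_unit_lebesgue: "prob_space unit_lebesgue"
  by standard (simp add: emeasure_restrict_space space_restrict_space)

definition up_T :: "real set \<Rightarrow> real \<Rightarrow> real" where "up_T T x = Inf (T \<inter> {x..})"
definition down_T :: "real set \<Rightarrow> real \<Rightarrow> real" where "down_T T x = Sup (T \<inter> {..x})"

text \<open>Dyadic points rounded up into \<open>T\<close>. Rounding keeps the grids nested, but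
  every dyadic point in one gap is rounded to the same right end, so grid points may repeat.\<close>

definition grid :: "real set \<Rightarrow> nat \<Rightarrow> nat \<Rightarrow> real" where
  "grid T n k = up_T T (real k / 2 ^ n)"

text \<open>Repeated grid points contribute nothing: the increment vanishes, and a quotient with
  denominator 0 is 0.\<close>

definition grid_energy :: "real set \<Rightarrow> nat \<Rightarrow> (real \<Rightarrow> real) \<Rightarrow> real" where
  "grid_energy T n h = (\<Sum>k<2 ^ n. (h (grid T n (Suc k)) - h (grid T n k))\<^sup>2 / (grid T n (Suc k) - grid T n k))"

text \<open>Each grid energy depends on finitely many values of the path and is continuous in them.
  This makes measurability in the path accessible, whereas \<open>HT_norm\<close> goes through a
  chosen derivative.\<close>

definition energy :: "real set \<Rightarrow> (real \<Rightarrow> real) \<Rightarrow> ennreal" where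
  "energy T h = (SUP n. ennreal (grid_energy T n h))"

text \<open>The integral over the part of \<open>T\<close> below \<open>t\<close>, pulled back along
  \<open>rho_bar\<close> to Lebesgue measure. In this form it also makes sense for \<open>t\<close>
  in a gap of \<open>T\<close>, where it interpolates linearly.\<close>

definition rho_integral :: "real set \<Rightarrow> (real \<Rightarrow> real) \<Rightarrow> real \<Rightarrow> real" where
  "rho_integral T g t = (LINT u:{0<..t}|unit_lebesgue. g (rho_bar T u))"

locale time_scaled =
  fixes T :: "real set"
  assumes ts: "time_scale T"
begin

section \<open>Rounding to the time scale and the pullback of \<open>lambda_Delta\<close> to
  Lebesgue measure\<close>

lemma T_facts: "closed T" "compact T" "0 \<in> T" "1 \<in> T" "t \<in> T \<Longrightarrow> 0 \<le> t" "t \<in> T \<Longrightarrow> t \<le> 1"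
  using ts compact_Int_closed[of "{0..1::real}" T] by (auto simp: time_scale_def Int_absorb1)

lemma bdd_T: "bdd_below (T \<inter> A)" "bdd_above (T \<inter> A)"
  using T_facts by (auto intro!: bdd_belowI[of _ 0] bdd_aboveI[of _ 1])

lemma up_T:
  assumes "x \<le> 1"
  shows "up_T T x \<in> T" "x \<le> up_T T x" "\<And>t. t \<in> T \<Longrightarrow> x \<le> t \<Longrightarrow> up_T T x \<le> t"
proof -
  have "up_T T x \<in> T \<inter> {x..}"
    unfolding up_T_def using T_facts assms bdd_T by (intro closed_contains_Inf) auto
  then show "up_T T x \<in> T" "x \<le> up_T T x" by auto
  show "up_T T x \<le> t" if "t \<in> T" "x \<le> t" for t
    unfolding up_T_def using that bdd_T by (intro cInf_lower) auto
qed

lemma down_T: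
  assumes "0 \<le> x"
  shows "down_T T x \<in> T" "down_T T x \<le> x" "\<And>t. t \<in> T \<Longrightarrow> t \<le> x \<Longrightarrow> t \<le> down_T T x"
proof -
  have "down_T T x \<in> T \<inter> {..x}"
    unfolding down_T_def using T_facts assms bdd_T by (intro closed_contains_Sup) auto
  then show "down_T T x \<in> T" "down_T T x \<le> x" by auto
  show "t \<le> down_T T x" if "t \<in> T" "t \<le> x" for t
    unfolding down_T_def using that bdd_T by (intro cSup_upper) auto
qed

lemma down_T_eq: "t \<in> T \<Longrightarrow> down_T T t = t"
  using down_T[of t] T_facts by (intro antisym) auto

lemma rho_bar_props:
  assumes "0 \<le> u" "u \<le> 1"
  shows "rho_bar T u \<in> T" "rho_bar T u \<le> u" "\<And>t. t \<in> T \<Longrightarrow> t < u \<Longrightarrow> t \<le> rho_bar T u"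
proof -
  have eq: "{v \<in> T. v < u} = T \<inter> {..<u}" by auto
  have le: "rho_bar T u \<le> u" if "0 < u"
    using that T_facts unfolding rho_bar_def eq by (auto intro!: cSup_least)
  show 3: "t \<le> rho_bar T u" if "t \<in> T" "t < u" for t
  proof -
    have "0 < u" using that T_facts(5)[of t] by linarith
    then show ?thesis using that bdd_T unfolding rho_bar_def eq by (auto intro!: cSup_upper)
  qed
  show "rho_bar T u \<le> u" using le assms by (cases "u = 0") (auto simp: rho_bar_def)
  show "rho_bar T u \<in> T"
  proof (cases "0 < u")
    case True
    have "Sup (T \<inter> {..<u}) \<in> closure (T \<inter> {..<u})"
      using True T_facts bdd_T by (intro closure_contains_Sup) auto
    also have "\<dots> \<subseteq> T" using T_facts by (intro closure_minimal) auto
    finally show ?thesis using True by (simp add: rho_bar_def eq)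
  qed (use T_facts in \<open>simp add: rho_bar_def\<close>)
qed

text \<open>The exclusion of \<open>u = t\<close> is genuine: if \<open>t\<close> has a gap to its
  left, then \<open>rho_bar T t < t\<close>. A single point is Lebesgue null, so integrals do not
  notice it.\<close>

lemma rho_bar_less_iff: "0 \<le> u \<Longrightarrow> u \<le> 1 \<Longrightarrow> t \<in> T \<Longrightarrow> u \<noteq> t \<Longrightarrow> rho_bar T u < t \<longleftrightarrow> u < t"
  using rho_bar_props[of u] by (meson leD le_less_trans not_less order_le_imp_less_or_eq)

lemma rho_bar_mono: "0 \<le> u \<Longrightarrow> u \<le> v \<Longrightarrow> v \<le> 1 \<Longrightarrow> rho_bar T u \<le> rho_bar T v"
proof -
  assume uv: "0 \<le> u" "u \<le> v" "v \<le> 1"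
  show ?thesis
  proof (cases "rho_bar T u < v")
    case True
    then show ?thesis using uv rho_bar_props[of u] rho_bar_props[of v] by auto
  next
    case False
    then have "u = v" using uv rho_bar_props[of u] by auto
    then show ?thesis by simp
  qed
qed

lemma rho_bar_measurable[measurable]: "rho_bar T \<in> unit_lebesgue \<rightarrow>\<^sub>M restrict_space borel T"
proof (rule measurable_restrict_space2)
  show "rho_bar T \<in> space unit_lebesgue \<rightarrow> T" using rho_bar_props by (auto simp: space_restrict_space)
  have "rho_bar T \<in> borel_measurable (restrict_space borel {0..1})"
    using rho_bar_mono by (intro borel_measurable_mono_on_fnc) (auto intro!: mono_onI)
  then show "rho_bar T \<in> borel_measurable unit_lebesgue"
    by (simp cong: measurable_cong_sets sets_restrict_space_cong)
qed

lemma lambda_Delta_simps[simp]: "space (lambda_Delta T) = T" 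
  and sets_lambda_Delta[simp, measurable_cong]: "sets (lambda_Delta T) = sets (restrict_space borel T)"
  by (simp_all add: lambda_Delta_def space_restrict_space)

lemma prob_space_lambda_Delta: "prob_space (lambda_Delta T)"
  unfolding lambda_Delta_def
  using prob_space.prob_space_distr[OF prob_space_unit_lebesgue rho_bar_measurable] .

lemma borel_inter_T[measurable]: "A \<in> sets borel \<Longrightarrow> A \<inter> T \<in> sets (restrict_space borel T)"
  by (auto simp: sets_restrict_space)

lemma measurable_rho_bar_comp[measurable]:
  "g \<in> borel_measurable (restrict_space borel T) \<Longrightarrow> (\<lambda>u. g (rho_bar T u)) \<in> borel_measurable unit_lebesgue"
  by (rule measurable_compose[OF rho_bar_measurable])

lemma lambda_Delta_integral:
  fixes g :: "real \<Rightarrow> real"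
  assumes "g \<in> borel_measurable (restrict_space borel T)"
  shows "(LINT s|lambda_Delta T. g s) = (LINT u|unit_lebesgue. g (rho_bar T u))"
    and "integrable (lambda_Delta T) g \<longleftrightarrow> integrable unit_lebesgue (\<lambda>u. g (rho_bar T u))"
  unfolding lambda_Delta_def using assms
  by (auto intro!: integral_distr integrable_distr_eq)

lemma AE_unit_lebesgue_neq: "AE u in unit_lebesgue. u \<noteq> t"
  using AE_lborel_singleton[of t] by (subst AE_restrict_space_iff) auto

lemma sets_unit_lebesgue_Ioc: "0 \<le> s \<Longrightarrow> t \<le> 1 \<Longrightarrow> {s<..t} \<in> sets unit_lebesgue"
  by (auto simp: sets_restrict_space_iff)

lemma lambda_Delta_set_integral:
  fixes g :: "real \<Rightarrow> real"
  assumes [measurable]: "g \<in> borel_measurable (restrict_space borel T)" and t: "t \<in> T"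
  shows "(LINT s:({0..<t} \<inter> T)|lambda_Delta T. g s) = rho_integral T g t"
proof -
  have [measurable]: "{0<..t} \<in> sets unit_lebesgue"
    using T_facts(6)[OF t] by (intro sets_unit_lebesgue_Ioc) auto
  have 1: "(\<lambda>s. indicator ({0..<t} \<inter> T) s *\<^sub>R g s) \<in> borel_measurable (restrict_space borel T)"
    by measurable
  have "(LINT s:({0..<t} \<inter> T)|lambda_Delta T. g s)
      = (LINT u|unit_lebesgue. indicator ({0..<t} \<inter> T) (rho_bar T u) *\<^sub>R g (rho_bar T u))"
    unfolding set_lebesgue_integral_def by (rule lambda_Delta_integral) (rule 1)
  also have "\<dots> = (LINT u|unit_lebesgue. indicator {0<..t} u *\<^sub>R g (rho_bar T u))"
  proof (rule integral_cong_AE)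
    show "AE u in unit_lebesgue. indicator ({0..<t} \<inter> T) (rho_bar T u) *\<^sub>R g (rho_bar T u) =
         indicator {0<..t} u *\<^sub>R g (rho_bar T u)"
      using AE_unit_lebesgue_neq[of t] AE_unit_lebesgue_neq[of 0] AE_space[of unit_lebesgue]
    proof eventually_elim
      case (elim u)
      then have u: "0 < u" "u \<le> 1" by (auto simp: space_restrict_space)
      then have "rho_bar T u \<in> T" "rho_bar T u < t \<longleftrightarrow> u < t"
        using rho_bar_less_iff[of u t] rho_bar_props[of u] t elim by auto
      then show ?case using u T_facts elim by (auto simp: indicator_def)
    qed
  qed (use measurable_rho_bar_comp[OF 1] in simp, measurable)
  finally show ?thesis by (simp add: rho_integral_def set_lebesgue_integral_def)
qed

lemma rho_integral_diff:
  assumes [measurable]: "g \<in> borel_measurable (restrict_space borel T)"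
    and g: "integrable (lambda_Delta T) (\<lambda>s. (g s)\<^sup>2)" and st: "0 \<le> s" "s \<le> t" "t \<le> 1"
  shows "rho_integral T g t - rho_integral T g s = (LINT u:{s<..t}|unit_lebesgue. g (rho_bar T u))"
    and "set_integrable unit_lebesgue {s<..t} (\<lambda>u. g (rho_bar T u))"
    and "set_integrable unit_lebesgue {s<..t} (\<lambda>u. (g (rho_bar T u))\<^sup>2)"
proof -
  interpret L: prob_space unit_lebesgue by (rule prob_space_unit_lebesgue)
  have sq: "integrable unit_lebesgue (\<lambda>u. (g (rho_bar T u))\<^sup>2)"
    using g by (subst (asm) lambda_Delta_integral) auto
  then have int: "integrable unit_lebesgue (\<lambda>u. g (rho_bar T u))"
    by (rule L.square_integrable_imp_integrable[rotated]) measurable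
  have si: "set_integrable unit_lebesgue {a<..b} (\<lambda>u. g (rho_bar T u))" if "0 \<le> a" "b \<le> 1" for a b
    unfolding set_integrable_def using that int by (intro integrable_mult_indicator sets_unit_lebesgue_Ioc)
  then show "set_integrable unit_lebesgue {s<..t} (\<lambda>u. g (rho_bar T u))" using st by auto
  show "set_integrable unit_lebesgue {s<..t} (\<lambda>u. (g (rho_bar T u))\<^sup>2)"
    unfolding set_integrable_def using st sq by (intro integrable_mult_indicator sets_unit_lebesgue_Ioc) auto
  have "{0<..t} = {0<..s} \<union> {s<..t}" using st by auto
  then show "rho_integral T g t - rho_integral T g s = (LINT u:{s<..t}|unit_lebesgue. g (rho_bar T u))"
    unfolding rho_integral_def using st by (simp add: set_integral_Un si)
qed

lemma rho_integral_diff_square: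
  assumes [measurable]: "g \<in> borel_measurable (restrict_space borel T)"
    and g: "integrable (lambda_Delta T) (\<lambda>s. (g s)\<^sup>2)" and st: "0 \<le> s" "s \<le> t" "t \<le> 1"
  shows "(rho_integral T g t - rho_integral T g s)\<^sup>2 \<le> (t - s) * (LINT u:{s<..t}|unit_lebesgue. (g (rho_bar T u))\<^sup>2)"
proof -
  interpret L: prob_space unit_lebesgue by (rule prob_space_unit_lebesgue)
  have sq: "integrable unit_lebesgue (\<lambda>u. (g (rho_bar T u))\<^sup>2)"
    using g by (subst (asm) lambda_Delta_integral) auto
  have "measure unit_lebesgue {s<..t} = t - s"
    using st by (subst measure_restrict_space) auto
  then show ?thesis
    using L.set_integral_Cauchy_Schwarz[OF sets_unit_lebesgue_Ioc, OF _ _ _ sq, of s t] st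
    by (simp add: rho_integral_diff(1)[OF assms])
qed

lemma rho_integral_diff_square_le:
  assumes [measurable]: "g \<in> borel_measurable (restrict_space borel T)"
    and g: "integrable (lambda_Delta T) (\<lambda>s. (g s)\<^sup>2)" and st: "0 \<le> s" "s \<le> t" "t \<le> 1"
  shows "(rho_integral T g t - rho_integral T g s)\<^sup>2 \<le> (t - s) * (LINT s|lambda_Delta T. (g s)\<^sup>2)"
proof -
  let ?G = "\<lambda>u. (g (rho_bar T u))\<^sup>2"
  have sq: "integrable unit_lebesgue ?G" using g by (subst (asm) lambda_Delta_integral) auto
  have "(LINT u:{s<..t}|unit_lebesgue. ?G u) \<le> (LINT u|unit_lebesgue. ?G u)"
    unfolding set_lebesgue_integral_def using sq st
    by (intro integral_mono integrable_mult_indicator sets_unit_lebesgue_Ioc) (auto simp: indicator_def)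
  also have "\<dots> = (LINT s|lambda_Delta T. (g s)\<^sup>2)" by (rule lambda_Delta_integral(1)[symmetric]) measurable
  finally have "(t - s) * (LINT u:{s<..t}|unit_lebesgue. ?G u) \<le> (t - s) * (LINT s|lambda_Delta T. (g s)\<^sup>2)"
    using st by (intro mult_left_mono) auto
  then show ?thesis using rho_integral_diff_square[OF assms] by linarith
qed

text \<open>Cauchy--Schwarz on every interval of the partition, then additivity of the integral of
  the square. The partition points may lie off \<open>T\<close>: the formula is applied both to
  grids in \<open>T\<close> and to plain dyadic points.\<close>

lemma rho_integral_energy_le:
  assumes [measurable]: "g \<in> borel_measurable (restrict_space borel T)"
    and g: "integrable (lambda_Delta T) (\<lambda>s. (g s)\<^sup>2)"
    and x: "mono x" "0 \<le> x 0" "x (n::nat) \<le> 1"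
  shows "(\<Sum>k<n. (rho_integral T g (x (Suc k)) - rho_integral T g (x k))\<^sup>2 / (x (Suc k) - x k))
      \<le> (LINT s|lambda_Delta T. (g s)\<^sup>2)"
proof -
  interpret L: prob_space unit_lebesgue by (rule prob_space_unit_lebesgue)
  let ?G = "\<lambda>u. (g (rho_bar T u))\<^sup>2"
  have sq: "integrable unit_lebesgue ?G" using g by (subst (asm) lambda_Delta_integral) auto
  have x01: "0 \<le> x k" "x k \<le> x (Suc k)" for k using x monoD[OF x(1), of 0 k] monoD[OF x(1), of k "Suc k"] by auto
  have x1: "x k \<le> 1" if "k \<le> n" for k using x monoD[OF x(1), of k n] that by auto
  have "(\<Sum>k<m. (rho_integral T g (x (Suc k)) - rho_integral T g (x k))\<^sup>2 / (x (Suc k) - x k))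
      \<le> (LINT u:{x 0<..x m}|unit_lebesgue. ?G u)" if "m \<le> n" for m
    using that
  proof (induction m)
    case (Suc m)
    have "{x 0<..x (Suc m)} = {x 0<..x m} \<union> {x m<..x (Suc m)}"
      using x01[of m] monoD[OF x(1), of 0 m] by auto
    then have eq: "(LINT u:{x 0<..x (Suc m)}|unit_lebesgue. ?G u)
        = (LINT u:{x 0<..x m}|unit_lebesgue. ?G u) + (LINT u:{x m<..x (Suc m)}|unit_lebesgue. ?G u)"
      using Suc.prems x01 x1[of m] x1[of "Suc m"] monoD[OF x(1), of 0 m]
      by (simp add: set_integral_Un rho_integral_diff(3)[OF assms(1,2)])
    have "(rho_integral T g (x (Suc m)) - rho_integral T g (x m))\<^sup>2
        \<le> (x (Suc m) - x m) * (LINT u:{x m<..x (Suc m)}|unit_lebesgue. ?G u)"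
      by (rule rho_integral_diff_square[OF assms(1,2)]) (use x01 x1 Suc.prems in auto)
    then have "(rho_integral T g (x (Suc m)) - rho_integral T g (x m))\<^sup>2 / (x (Suc m) - x m)
        \<le> (LINT u:{x m<..x (Suc m)}|unit_lebesgue. ?G u)"
      using x01(2)[of m]
      by (cases "x (Suc m) = x m") (auto simp: divide_le_eq mult.commute set_lebesgue_integral_def)
    with Suc eq show ?case by simp
  qed (simp add: set_lebesgue_integral_def)
  then have "(\<Sum>k<n. (rho_integral T g (x (Suc k)) - rho_integral T g (x k))\<^sup>2 / (x (Suc k) - x k))
      \<le> (LINT u:{x 0<..x n}|unit_lebesgue. ?G u)" by simp
  also have "\<dots> \<le> (LINT u|unit_lebesgue. ?G u)"
  proof -
    have "integrable unit_lebesgue (\<lambda>u. indicator {x 0<..x n} u *\<^sub>R ?G u)"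
      using sq x by (intro integrable_mult_indicator sets_unit_lebesgue_Ioc)
    then show ?thesis unfolding set_lebesgue_integral_def
      using sq by (intro integral_mono) (auto simp: indicator_def)
  qed
  also have "\<dots> = (LINT s|lambda_Delta T. (g s)\<^sup>2)" by (rule lambda_Delta_integral(1)[symmetric]) measurable
  finally show ?thesis .
qed

section \<open>Nested grids and the monotonicity of the discrete energy\<close>

lemma grid_props:
  assumes "k \<le> 2 ^ n"
  shows "grid T n k \<in> T" "real k / 2 ^ n \<le> grid T n k" "\<And>t. t \<in> T \<Longrightarrow> real k / 2 ^ n \<le> t \<Longrightarrow> grid T n k \<le> t"
proof -
  have "real k / 2 ^ n \<le> 1"
    using of_nat_mono[OF assms, where 'a=real] by (simp add: divide_le_eq)
  from up_T[OF this] show "grid T n k \<in> T" "real k / 2 ^ n \<le> grid T n k"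
    "\<And>t. t \<in> T \<Longrightarrow> real k / 2 ^ n \<le> t \<Longrightarrow> grid T n k \<le> t"
    by (auto simp: grid_def)
qed

lemma grid_mono: "i \<le> j \<Longrightarrow> j \<le> 2 ^ n \<Longrightarrow> grid T n i \<le> grid T n j"
proof -
  assume ij: "i \<le> j" "j \<le> 2 ^ n"
  have "real i / 2 ^ n \<le> real j / 2 ^ n" using ij by (intro divide_right_mono) auto
  also have "\<dots> \<le> grid T n j" using ij by (intro grid_props)
  finally show ?thesis using ij by (intro grid_props) auto
qed

lemma grid_0: "grid T n 0 = 0"
  using grid_props(1,3)[of 0 n] T_facts by (intro antisym) auto

lemma grid_top: "grid T n (2 ^ n) = 1"
  using grid_props(1,2)[of "2 ^ n" n] T_facts by (intro antisym) auto

lemma grid_refine: "grid T (n + m) (k * 2 ^ m) = grid T n k"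
  by (simp add: grid_def power_add field_simps)

text \<open>The function \<open>(a, x) \<mapsto> a\<^sup>2 / x\<close> is subadditive, and every
  coarse cell is the union of two neighbouring fine cells.\<close>

lemma grid_energy_Suc: "grid_energy T n h \<le> grid_energy T (Suc n) h"
proof -
  let ?q = "grid T (Suc n)"
  let ?d = "\<lambda>i. (h (?q (Suc i)) - h (?q i))\<^sup>2 / (?q (Suc i) - ?q i)"
  have step: "(h (?q (Suc (Suc (2 * k)))) - h (?q (2 * k)))\<^sup>2 / (?q (Suc (Suc (2 * k))) - ?q (2 * k)) \<le> ?d (2 * k) + ?d (Suc (2 * k))"
    if "k < 2 ^ n" for k
  proof -
    have le: "?q (2 * k) \<le> ?q (Suc (2 * k))" "?q (Suc (2 * k)) \<le> ?q (Suc (Suc (2 * k)))"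
      using that by (auto intro!: grid_mono)
    define x y a b where "x = ?q (Suc (2 * k)) - ?q (2 * k)" and "y = ?q (Suc (Suc (2 * k))) - ?q (Suc (2 * k))"
      and "a = h (?q (Suc (2 * k))) - h (?q (2 * k))" and "b = h (?q (Suc (Suc (2 * k)))) - h (?q (Suc (2 * k)))"
    have nn: "0 \<le> x" "0 \<le> y" using le by (auto simp: x_def y_def)
    have z: "x = 0 \<Longrightarrow> a = 0" "y = 0 \<Longrightarrow> b = 0" by (auto simp: x_def y_def a_def b_def)
    \<comment> \<open>For positive lengths the defect is
      \<open>(a * y - b * x)\<^sup>2 / (x * y * (x + y))\<close>. A cell of length 0 has increment 0
      by \<open>z\<close>, and then the two sides agree.\<close>
    have "(a + b)\<^sup>2 / (x + y) \<le> a\<^sup>2 / x + b\<^sup>2 / y"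
    proof (cases "x = 0 \<or> y = 0")
      case False
      with nn have xy: "0 < x" "0 < y" by auto
      have "0 \<le> (a * y - b * x)\<^sup>2 / (x * y * (x + y))" using xy by auto
      also have "\<dots> = a\<^sup>2 / x + b\<^sup>2 / y - (a + b)\<^sup>2 / (x + y)"
        using xy by (simp add: divide_simps) (simp add: power2_eq_square algebra_simps)
      finally show ?thesis by simp
    qed (use z in auto)
    then show ?thesis by (simp add: x_def y_def a_def b_def)
  qed
  have "grid_energy T n h = (\<Sum>k<2 ^ n. (h (?q (Suc (Suc (2 * k)))) - h (?q (2 * k)))\<^sup>2 / (?q (Suc (Suc (2 * k))) - ?q (2 * k)))"
    unfolding grid_energy_def using grid_refine[of n 1 "Suc _"] grid_refine[of n 1]
    by (intro sum.cong) (simp_all add: mult.commute)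
  also have "\<dots> \<le> (\<Sum>k<2 ^ n. ?d (2 * k) + ?d (Suc (2 * k)))"
    using step by (intro sum_mono) auto
  also have "\<dots> = (\<Sum>i<2 * 2 ^ n. ?d i)"
  proof -
    have "(\<Sum>k<m. f (2 * k) + f (Suc (2 * k))) = (\<Sum>i<2 * m. f i)" for f :: "nat \<Rightarrow> real" and m
      by (induction m) (auto simp: algebra_simps)
    then show ?thesis .
  qed
  finally show ?thesis by (simp add: grid_energy_def)
qed

lemma grid_energy_mono: "n \<le> m \<Longrightarrow> grid_energy T n h \<le> grid_energy T m h"
  by (rule lift_Suc_mono_le[of "\<lambda>n. grid_energy T n h"]) (rule grid_energy_Suc)

lemma grid_energy_nonneg: "0 \<le> grid_energy T n h"
  unfolding grid_energy_def by (intro sum_nonneg divide_nonneg_nonneg) (auto intro!: grid_mono)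

lemma is_delta_derivD:
  assumes "is_delta_deriv T h g"
  shows "g \<in> borel_measurable (restrict_space borel T)" "integrable (lambda_Delta T) (\<lambda>s. (g s)\<^sup>2)"
    "\<And>t. t \<in> T \<Longrightarrow> h t = rho_integral T g t"
  using assms by (auto simp: is_delta_deriv_def lambda_Delta_set_integral cong: measurable_cong_sets)

lemma is_delta_derivI:
  assumes "g \<in> borel_measurable (restrict_space borel T)" "integrable (lambda_Delta T) (\<lambda>s. (g s)\<^sup>2)"
    "\<And>t. t \<in> T \<Longrightarrow> h t = rho_integral T g t"
  shows "is_delta_deriv T h g"
  using assms by (auto simp: is_delta_deriv_def lambda_Delta_set_integral cong: measurable_cong_sets)

lemma grid_energy_le:
  assumes "is_delta_deriv T h g"
  shows "grid_energy T n h \<le> (LINT s|lambda_Delta T. (g s)\<^sup>2)"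
proof -
  \<comment> \<open>The index is capped because the partition has to be monotone on all natural
    numbers, while grid points are under control only up to \<open>2 ^ n\<close>.\<close>
  define x where "x k = grid T n (min k (2 ^ n))" for k
  have "grid_energy T n h = (\<Sum>k<2 ^ n. (rho_integral T g (x (Suc k)) - rho_integral T g (x k))\<^sup>2 / (x (Suc k) - x k))"
    unfolding grid_energy_def
    by (intro sum.cong refl) (simp add: x_def Suc_le_eq min_absorb1 is_delta_derivD(3)[OF assms] grid_props(1))
  also have "\<dots> \<le> (LINT s|lambda_Delta T. (g s)\<^sup>2)"
    by (rule rho_integral_energy_le[OF is_delta_derivD(1,2)[OF assms]])
       (auto simp: x_def grid_0 grid_top intro!: monoI grid_mono)
  finally show ?thesis .
qed

lemma set_integral_Ico:
  fixes g :: "real \<Rightarrow> real"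
  assumes [measurable]: "g \<in> borel_measurable (restrict_space borel T)"
    and g: "integrable (lambda_Delta T) (\<lambda>s. (g s)\<^sup>2)"
    and ab: "a \<in> T" "b \<in> T" "a \<le> b"
  shows "(LINT s:({a..<b} \<inter> T)|lambda_Delta T. g s) = rho_integral T g b - rho_integral T g a"
    and "set_integrable (lambda_Delta T) ({a..<b} \<inter> T) g"
proof -
  interpret L: prob_space "lambda_Delta T" by (rule prob_space_lambda_Delta)
  have int: "integrable (lambda_Delta T) g"
    using g by (rule L.square_integrable_imp_integrable[rotated]) measurable
  have si: "set_integrable (lambda_Delta T) ({c..<d} \<inter> T) g" for c d
    unfolding set_integrable_def using int by (intro integrable_mult_indicator) auto
  then show "set_integrable (lambda_Delta T) ({a..<b} \<inter> T) g" .
  have "{0..<b} \<inter> T = ({0..<a} \<inter> T) \<union> ({a..<b} \<inter> T)" using ab T_facts(5)[of a] by auto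
  then have "(LINT s:({0..<b} \<inter> T)|lambda_Delta T. g s)
      = (LINT s:({0..<a} \<inter> T)|lambda_Delta T. g s) + (LINT s:({a..<b} \<inter> T)|lambda_Delta T. g s)"
    by (simp only:) (rule set_integral_Un, auto intro: si)
  then show "(LINT s:({a..<b} \<inter> T)|lambda_Delta T. g s) = rho_integral T g b - rho_integral T g a"
    using ab by (simp add: lambda_Delta_set_integral)
qed

lemma measure_Ico:
  assumes ab: "a \<in> T" "b \<in> T" "a \<le> b"
  shows "measure (lambda_Delta T) ({a..<b} \<inter> T) = b - a"
proof -
  interpret L: prob_space "lambda_Delta T" by (rule prob_space_lambda_Delta)
  have "rho_integral T (\<lambda>_. 1) t = t" if "t \<in> T" for t
  proof -
    have "measure unit_lebesgue {0<..t} = t"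
      using T_facts(5,6)[OF that] by (subst measure_restrict_space) auto
    moreover have "{0<..t} \<inter> space unit_lebesgue = {0<..t}"
      using T_facts(6)[OF that] by (auto simp: space_restrict_space)
    ultimately show ?thesis by (simp add: rho_integral_def set_lebesgue_integral_def)
  qed
  then show ?thesis
    using set_integral_Ico(1)[of "\<lambda>_. 1", OF _ _ ab] ab by (simp add: set_lebesgue_integral_def)
qed

section \<open>Difference quotients along the grids and the reconstruction of the delta
  derivative\<close>

definition grid_slope :: "nat \<Rightarrow> (real \<Rightarrow> real) \<Rightarrow> nat \<Rightarrow> real" where
  "grid_slope n h k = (h (grid T n (Suc k)) - h (grid T n k)) / (grid T n (Suc k) - grid T n k)"

text \<open>For a path with a delta derivative this is the conditional expectation of that
  derivative given the cells of level \<open>n\<close>.\<close>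

definition grid_deriv :: "nat \<Rightarrow> (real \<Rightarrow> real) \<Rightarrow> real \<Rightarrow> real" where
  "grid_deriv n h s = (\<Sum>k<2 ^ n. grid_slope n h k * indicator ({grid T n k..<grid T n (Suc k)} \<inter> T) s)"

lemma grid_deriv_measurable[measurable]: "grid_deriv n h \<in> borel_measurable (restrict_space borel T)"
  unfolding grid_deriv_def by measurable

lemma grid_deriv_bounded: "\<bar>grid_deriv n h s\<bar> \<le> (\<Sum>k<2 ^ n. \<bar>grid_slope n h k\<bar>)"
  unfolding grid_deriv_def by (rule order_trans[OF sum_abs]) (auto intro!: sum_mono simp: indicator_def)

lemma integrable_grid_deriv_mult: "integrable (lambda_Delta T) (\<lambda>s. grid_deriv n h s * grid_deriv m k s)"
proof -
  interpret L: prob_space "lambda_Delta T" by (rule prob_space_lambda_Delta)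
  show ?thesis
  proof (rule L.integrable_const_bound)
    show "AE s in lambda_Delta T. norm (grid_deriv n h s * grid_deriv m k s)
        \<le> (\<Sum>i<2 ^ n. \<bar>grid_slope n h i\<bar>) * (\<Sum>i<2 ^ m. \<bar>grid_slope m k i\<bar>)"
      by (auto simp: abs_mult intro!: mult_mono grid_deriv_bounded sum_nonneg)
  qed measurable
qed

lemma integrable_grid_deriv_square: "integrable (lambda_Delta T) (\<lambda>s. (grid_deriv n h s)\<^sup>2)"
  using integrable_grid_deriv_mult[of n h n h] by (simp add: power2_eq_square)

text \<open>The mass of a cell is its length, so slope times mass is the increment of
  \<open>h\<close>, also for degenerate cells, and the increments telescope.\<close>

lemma rho_integral_grid_deriv:
  assumes j: "j \<le> 2 ^ n"
  shows "rho_integral T (grid_deriv n h) (grid T n j) = h (grid T n j) - h 0"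
proof -
  interpret L: prob_space "lambda_Delta T" by (rule prob_space_lambda_Delta)
  let ?p = "grid T n"
  have pT: "?p i \<in> T" if "i \<le> 2 ^ n" for i using that by (rule grid_props)
  have "rho_integral T (grid_deriv n h) (?p j) = (LINT s:({0..<?p j} \<inter> T)|lambda_Delta T. grid_deriv n h s)"
    using j pT by (intro lambda_Delta_set_integral[symmetric]) auto
  also have "\<dots> = (LINT s|lambda_Delta T. (\<Sum>k<j. grid_slope n h k * indicator ({?p k..<?p (Suc k)} \<inter> T) s))"
    unfolding set_lebesgue_integral_def
  proof (rule Bochner_Integration.integral_cong[OF refl])
    fix s assume "s \<in> space (lambda_Delta T)"
    then have s: "s \<in> T" by simp
    show "indicator ({0..<?p j} \<inter> T) s *\<^sub>R grid_deriv n h s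
        = (\<Sum>k<j. grid_slope n h k * indicator ({?p k..<?p (Suc k)} \<inter> T) s)"
    proof (cases "s < ?p j")
      case True
      have "grid_deriv n h s = (\<Sum>k<j. grid_slope n h k * indicator ({?p k..<?p (Suc k)} \<inter> T) s)"
        unfolding grid_deriv_def
      proof (rule sum.mono_neutral_right)
        show "\<forall>i\<in>{..<2 ^ n} - {..<j}. grid_slope n h i * indicator ({?p i..<?p (Suc i)} \<inter> T) s = 0"
        proof
          fix i assume "i \<in> {..<2 ^ n} - {..<j}"
          then have "?p j \<le> ?p i" by (intro grid_mono) auto
          with True show "grid_slope n h i * indicator ({?p i..<?p (Suc i)} \<inter> T) s = 0" by simp
        qed
      qed (use j in auto)
      with True s T_facts show ?thesis by simp
    next
      case False
      have *: "s \<notin> {?p i..<?p (Suc i)}" if "i < j" for i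
        using False grid_mono[of "Suc i" j n] that j by auto
      then have "indicator ({?p i..<?p (Suc i)} \<inter> T) s = (0::real)" if "i < j" for i
        using *[OF that] by (auto simp: indicator_def)
      then show ?thesis using False by (subst sum.neutral) simp_all
    qed
  qed
  also have "\<dots> = (\<Sum>k<j. grid_slope n h k * (?p (Suc k) - ?p k))"
  proof -
    have "integrable (lambda_Delta T) (indicator ({?p i..<?p (Suc i)} \<inter> T) :: real \<Rightarrow> real)" for i
      by (intro integrable_real_indicator) (auto simp: L.emeasure_eq_measure)
    then show ?thesis
      using j by (subst Bochner_Integration.integral_sum) (auto intro!: sum.cong simp: measure_Ico pT grid_mono)
  qed
  also have "\<dots> = (\<Sum>k<j. h (?p (Suc k)) - h (?p k))"
    by (intro sum.cong) (auto simp: grid_slope_def)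
  also have "\<dots> = h (?p j) - h 0"
    using sum_lessThan_telescope[of "\<lambda>k. h (?p k)" j] by (simp add: grid_0)
  finally show ?thesis .
qed

lemma rho_integral_grid_deriv':
  assumes "j \<le> 2 ^ n" "n \<le> m"
  shows "rho_integral T (grid_deriv m h) (grid T n j) = h (grid T n j) - h 0"
proof -
  obtain d where m: "m = n + d" using assms le_Suc_ex by blast
  have "j * 2 ^ d \<le> 2 ^ m" using assms by (simp add: m power_add)
  from rho_integral_grid_deriv[OF this] show ?thesis unfolding m grid_refine .
qed

text \<open>The coarse quotient is constant on coarse cells, over which the fine quotient integrates
  to the increment of \<open>h\<close>. This is the orthogonality of martingale increments: only the
  coarse energy survives.\<close>

lemma integral_grid_deriv_mult:
  assumes "n \<le> m"
  shows "(LINT s|lambda_Delta T. grid_deriv n h s * grid_deriv m h s) = grid_energy T n h"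
proof -
  let ?p = "grid T n"
  have pT: "?p i \<in> T" if "i \<le> 2 ^ n" for i using that by (rule grid_props)
  note Ico = set_integral_Ico[OF grid_deriv_measurable integrable_grid_deriv_square]
  have "(LINT s|lambda_Delta T. grid_deriv n h s * grid_deriv m h s)
      = (LINT s|lambda_Delta T. (\<Sum>k<2 ^ n. grid_slope n h k *
           (indicator ({?p k..<?p (Suc k)} \<inter> T) s *\<^sub>R grid_deriv m h s)))"
    by (simp only: grid_deriv_def[of n] sum_distrib_right mult.assoc real_scaleR_def)
  also have "\<dots> = (\<Sum>k<2 ^ n. grid_slope n h k * (LINT s:({?p k..<?p (Suc k)} \<inter> T)|lambda_Delta T. grid_deriv m h s))"
    unfolding set_lebesgue_integral_def
  proof (subst Bochner_Integration.integral_sum)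
    fix i assume "i \<in> {..<(2::nat) ^ n}"
    then show "integrable (lambda_Delta T) (\<lambda>s. grid_slope n h i *
           (indicator ({?p i..<?p (Suc i)} \<inter> T) s *\<^sub>R grid_deriv m h s))"
      using Ico(2) pT by (intro integrable_mult_right) (auto simp: set_integrable_def grid_mono simp del: real_scaleR_def)
  qed (simp only: integral_mult_right_zero)
  also have "\<dots> = (\<Sum>k<2 ^ n. grid_slope n h k * (h (?p (Suc k)) - h (?p k)))"
    using assms by (intro sum.cong) (auto simp: Ico pT grid_mono rho_integral_grid_deriv')
  also have "\<dots> = grid_energy T n h"
    unfolding grid_energy_def grid_slope_def by (simp add: power2_eq_square)
  finally show ?thesis .
qed

lemma integral_grid_deriv_diff:
  assumes "n \<le> m"
  shows "(\<integral>\<^sup>+s. ennreal ((grid_deriv m h s - grid_deriv n h s)\<^sup>2) \<partial>lambda_Delta T) = ennreal (grid_energy T m h - grid_energy T n h)"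
proof -
  have eq: "(grid_deriv m h s - grid_deriv n h s)\<^sup>2
      = grid_deriv m h s * grid_deriv m h s - 2 * (grid_deriv n h s * grid_deriv m h s) + grid_deriv n h s * grid_deriv n h s" for s
    by (simp add: power2_eq_square algebra_simps)
  have "(LINT s|lambda_Delta T. (grid_deriv m h s - grid_deriv n h s)\<^sup>2)
      = grid_energy T m h - 2 * grid_energy T n h + grid_energy T n h"
    unfolding eq using assms by (simp add: integrable_grid_deriv_mult integral_grid_deriv_mult)
  moreover have "integrable (lambda_Delta T) (\<lambda>s. (grid_deriv m h s - grid_deriv n h s)\<^sup>2)"
    unfolding eq by (intro Bochner_Integration.integrable_add Bochner_Integration.integrable_diff
        integrable_mult_right integrable_grid_deriv_mult)
  ultimately show ?thesis by (subst nn_integral_eq_integral) auto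
qed

text \<open>The difference quotients along the nested grids form a martingale; bounded energy makes it
  converge in \<open>L\<^sup>2\<close>.\<close>

lemma ex_delta_deriv:
  assumes h: "h \<in> CT T" and e: "\<And>n. grid_energy T n h \<le> e"
  obtains g where "is_delta_deriv T h g" "(LINT s|lambda_Delta T. (g s)\<^sup>2) \<le> e"
proof -
  interpret L: prob_space "lambda_Delta T" by (rule prob_space_lambda_Delta)
  define E where "E n = grid_energy T n h" for n
  have h0: "h 0 = 0" and hc: "continuous_on T h" using h by (auto simp: CT_def)
  have "incseq E" using grid_energy_mono by (auto simp: incseq_def E_def)
  moreover have bdd: "bdd_above (range E)" using e by (auto simp: E_def intro!: bdd_aboveI)
  ultimately have lim: "E \<longlonglongrightarrow> (SUP n. E n)" by (rule LIMSEQ_incseq_SUP[rotated])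
  \<comment> \<open>The energies increase to a finite supremum; the levels \<open>r j\<close> are
    chosen so late that the remaining increase is below \<open>(1/4) ^ j\<close>, the rate required
    by \<open>L2_Cauchy_limit\<close>.\<close>
  have "\<exists>r. \<forall>j. (j \<le> r j \<and> (SUP n. E n) - (1/4) ^ j < E (r j)) \<and> r j < r (Suc j)"
  proof (rule dependent_nat_choice)
    have *: "\<exists>y. (j \<le> y \<and> (SUP n. E n) - (1/4) ^ j < E y) \<and> x < y" for j x
    proof -
      have "eventually (\<lambda>n. (SUP n. E n) - (1/4) ^ j < E n) sequentially"
        by (rule order_tendstoD(1)[OF lim]) simp
      then have "eventually (\<lambda>n. (j \<le> n \<and> (SUP n. E n) - (1/4) ^ j < E n) \<and> x < n) sequentially"
        using eventually_ge_at_top[of j] eventually_gt_at_top[of x] by eventually_elim auto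
      then show ?thesis by (rule eventually_happens'[OF trivial_limit_sequentially])
    qed
    show "\<exists>x. 0 \<le> x \<and> (SUP n. E n) - (1/4) ^ 0 < E x" using *[of 0] by auto
    show "\<exists>y. (Suc n \<le> y \<and> (SUP n. E n) - (1/4) ^ Suc n < E y) \<and> x < y" for x n using * by blast
  qed
  then obtain r where r: "\<And>j. j \<le> r j" "\<And>j. (SUP n. E n) - (1/4) ^ j < E (r j)" "\<And>j. r j < r (Suc j)" by auto
  then have "strict_mono r" by (simp add: strict_mono_Suc_iff)
  define f where "f j = grid_deriv (r j) h" for j
  have [measurable]: "f j \<in> borel_measurable (restrict_space borel T)" for j unfolding f_def by measurable
  obtain g where [measurable]: "g \<in> borel_measurable (lambda_Delta T)"
    and g: "\<And>n. (\<integral>\<^sup>+s. ennreal ((g s - f n s)\<^sup>2) \<partial>lambda_Delta T) \<le> ennreal ((1/4) ^ n)"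
  proof (rule L2_Cauchy_limit[OF prob_space_lambda_Delta, of f])
    fix n m :: nat assume "n \<le> m"
    then have "r n \<le> r m" using \<open>strict_mono r\<close> by (simp add: strict_mono_less_eq)
    then have "(\<integral>\<^sup>+s. ennreal ((f m s - f n s)\<^sup>2) \<partial>lambda_Delta T) = ennreal (E (r m) - E (r n))"
      unfolding f_def E_def by (rule integral_grid_deriv_diff)
    also have "\<dots> \<le> ennreal ((1/4) ^ n)"
      using r(2)[of n] cSUP_upper[OF UNIV_I bdd, of "r m"] by (intro ennreal_leI) auto
    finally show "(\<integral>\<^sup>+s. ennreal ((f m s - f n s)\<^sup>2) \<partial>lambda_Delta T) \<le> ennreal ((1/4) ^ n)" .
  qed auto
  have [measurable]: "g \<in> borel_measurable (restrict_space borel T)" by measurable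
  have fsq: "(\<integral>\<^sup>+s. ennreal ((f n s)\<^sup>2) \<partial>lambda_Delta T) \<le> ennreal e" for n
  proof -
    have "(\<integral>\<^sup>+s. ennreal ((f n s)\<^sup>2) \<partial>lambda_Delta T) = ennreal (grid_energy T (r n) h)"
      using integrable_grid_deriv_square[of "r n" h] integral_grid_deriv_mult[of "r n" "r n" h]
      by (subst nn_integral_eq_integral) (auto simp: f_def power2_eq_square)
    then show ?thesis using e by (simp add: ennreal_leI)
  qed
  have e0: "0 \<le> e" using e[of 0] grid_energy_nonneg[of 0 h] by linarith
  \<comment> \<open>The weight \<open>s\<close> is sent to 0 afterwards, so that the limit satisfies
    the energy bound with the constant \<open>e\<close> itself; \<open>energy_HT\<close> relies on
    this sharp form.\<close>
  have gs: "(\<integral>\<^sup>+s. ennreal ((g s)\<^sup>2) \<partial>lambda_Delta T) \<le> ennreal ((1 + s) * e)" if s: "0 < s" for s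
  proof -
    have bound: "(\<integral>\<^sup>+s. ennreal ((g s)\<^sup>2) \<partial>lambda_Delta T) \<le> ennreal ((1 + s) * e + (1 + 1 / s) * (1/4) ^ n)" for n
    proof -
      have sq': "(g x)\<^sup>2 \<le> (1 + s) * (f n x)\<^sup>2 + (1 + 1 / s) * (g x - f n x)\<^sup>2" for x
        using square_add_le_weighted[OF s, of "f n x" "g x - f n x"] by simp
      have "(\<integral>\<^sup>+s. ennreal ((g s)\<^sup>2) \<partial>lambda_Delta T)
        \<le> (\<integral>\<^sup>+x. ennreal (1 + s) * ennreal ((f n x)\<^sup>2) + ennreal (1 + 1 / s) * ennreal ((g x - f n x)\<^sup>2) \<partial>lambda_Delta T)"
        using sq' s
        by (intro nn_integral_mono) (simp flip: ennreal_mult ennreal_plus)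
      also have "\<dots> = ennreal (1 + s) * (\<integral>\<^sup>+x. ennreal ((f n x)\<^sup>2) \<partial>lambda_Delta T)
         + ennreal (1 + 1 / s) * (\<integral>\<^sup>+x. ennreal ((g x - f n x)\<^sup>2) \<partial>lambda_Delta T)"
        by (simp add: nn_integral_add nn_integral_cmult)
      also have "\<dots> \<le> ennreal (1 + s) * ennreal e + ennreal (1 + 1 / s) * ennreal ((1/4) ^ n)"
        by (intro add_mono mult_left_mono fsq g) auto
      also have "\<dots> = ennreal ((1 + s) * e + (1 + 1 / s) * (1/4) ^ n)"
        using s e0 by (simp flip: ennreal_mult ennreal_plus)
      finally show ?thesis .
    qed
    have "(\<lambda>n. ennreal ((1 + s) * e + (1 + 1 / s) * (1/4) ^ n)) \<longlonglongrightarrow> ennreal ((1 + s) * e + (1 + 1 / s) * 0)"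
      by (intro tendsto_intros LIMSEQ_power_zero) auto
    from LIMSEQ_le_const[OF this] bound show ?thesis by auto
  qed
  have gle: "(\<integral>\<^sup>+s. ennreal ((g s)\<^sup>2) \<partial>lambda_Delta T) \<le> ennreal e"
  proof -
    have "(\<lambda>n. ennreal ((1 + 1 / real (Suc n)) * e)) \<longlonglongrightarrow> ennreal ((1 + 0) * e)"
      by (intro tendsto_intros LIMSEQ_Suc[OF lim_1_over_n])
    from LIMSEQ_le_const[OF this] gs[of "1 / real (Suc _)"] show ?thesis by auto
  qed
  have gint: "integrable (lambda_Delta T) (\<lambda>s. (g s)\<^sup>2)"
    using gle by (intro integrableI_bounded) (auto simp: less_top[symmetric] top_unique)
  have gie: "(LINT s|lambda_Delta T. (g s)\<^sup>2) \<le> e"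
    using gle gint e0 by (subst (asm) nn_integral_eq_integral) auto
  \<comment> \<open>From level \<open>k\<close> on, every quotient integrates to the exact value of
    \<open>h\<close> at this grid point, so convergence in L2 forces the same for
    \<open>g\<close>.\<close>
  have grid: "rho_integral T g (grid T k j) = h (grid T k j)" if kj: "j \<le> 2 ^ k" for k j
  proof -
    let ?t = "grid T k j"
    have t: "?t \<in> T" using kj by (rule grid_props)
    have "(rho_integral T g ?t - h ?t)\<^sup>2 \<le> (1/4) ^ n" if n: "k \<le> n" for n
    proof -
      have kr: "k \<le> r n" using n r(1)[of n] by simp
      have dint: "integrable (lambda_Delta T) (\<lambda>s. (g s - f n s)\<^sup>2)"
        using g[of n] by (intro integrableI_bounded) (auto simp: less_top[symmetric] top_unique)
      have gi: "integrable (lambda_Delta T) g" by (rule L.square_integrable_imp_integrable[OF _ gint]) measurable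
      have fi: "integrable (lambda_Delta T) (f n)"
        by (rule L.square_integrable_imp_integrable) (auto simp: f_def integrable_grid_deriv_square)
      have "h ?t = rho_integral T (f n) ?t"
        unfolding f_def using rho_integral_grid_deriv'[OF kj kr] h0 by simp
      then have "rho_integral T g ?t - h ?t = (LINT s:({0..<?t} \<inter> T)|lambda_Delta T. g s - f n s)"
        using gi fi t by (simp add: lambda_Delta_set_integral[symmetric] set_integral_diff set_integrable_def
            integrable_mult_indicator del: real_scaleR_def)
      then have "(rho_integral T g ?t - h ?t)\<^sup>2
          \<le> measure (lambda_Delta T) ({0..<?t} \<inter> T) * (LINT s:({0..<?t} \<inter> T)|lambda_Delta T. (g s - f n s)\<^sup>2)"
        using L.set_integral_Cauchy_Schwarz[of "{0..<?t} \<inter> T" "\<lambda>s. g s - f n s"] dint by simp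
      also have "\<dots> \<le> 1 * (LINT s|lambda_Delta T. (g s - f n s)\<^sup>2)"
        unfolding set_lebesgue_integral_def
        using dint by (intro mult_mono integral_mono integrable_mult_indicator)
          (auto simp: indicator_def intro!: integral_nonneg_AE)
      also have "\<dots> \<le> (1/4) ^ n"
        using g[of n] dint by (subst (asm) nn_integral_eq_integral) auto
      finally show ?thesis .
    qed
    moreover have lim0: "(\<lambda>n. (1/4::real) ^ n) \<longlonglongrightarrow> 0" by (intro LIMSEQ_power_zero) auto
    ultimately have "(rho_integral T g ?t - h ?t)\<^sup>2 \<le> 0" by (intro LIMSEQ_le_const[OF lim0]) auto
    then show ?thesis by simp
  qed
  have "h t = rho_integral T g t" if t: "t \<in> T" for t
  proof -
    define k where "k n = nat \<lfloor>t * 2 ^ n\<rfloor>" for n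
    have t01: "0 \<le> t" "t \<le> 1" using T_facts t by auto
    note k = dyadic_floor(1,2)[OF t01, folded k_def] and kle = dyadic_floor(3)[OF t01, folded k_def]
    \<comment> \<open>Rounding the dyadic approximation up into \<open>T\<close> cannot overshoot,
      because \<open>t\<close> is itself a point of \<open>T\<close> above
      \<open>k n / 2 ^ n\<close>.\<close>
    define u where "u n = grid T n (k n)" for n
    have uT: "u n \<in> T" and ut: "u n \<le> t" "t - 1 / 2 ^ n \<le> u n" for n
      using grid_props[OF kle[of n]] k[of n] t by (auto simp: u_def intro: order_trans)
    have "(\<lambda>n. t - (1/2::real) ^ n) \<longlonglongrightarrow> t - 0" by (intro tendsto_intros LIMSEQ_power_zero) auto
    then have ulim: "u \<longlonglongrightarrow> t"
      using ut by (intro tendsto_sandwich[of "\<lambda>n. t - (1/2) ^ n" u _ "\<lambda>_. t"]) (auto simp: power_one_over)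
    have "(\<lambda>n. h (u n)) \<longlonglongrightarrow> h t"
      using continuous_on_tendsto_compose[OF hc ulim t] uT by auto
    moreover have "(\<lambda>n. h (u n)) \<longlonglongrightarrow> rho_integral T g t"
    proof -
      have "(rho_integral T g t - h (u n))\<^sup>2 \<le> e * (1/2) ^ n" for n
      proof -
        have "(rho_integral T g t - h (u n))\<^sup>2 \<le> (t - u n) * (LINT s|lambda_Delta T. (g s)\<^sup>2)"
          using rho_integral_diff_square_le[OF _ gint, of "u n" t] ut t01 T_facts(5)[OF uT] grid[OF kle]
          by (simp add: u_def)
        also have "\<dots> \<le> (1/2) ^ n * e"
          using ut[of n] by (intro mult_mono gie) (auto simp: power_one_over)
        finally show ?thesis by (simp add: mult.commute)
      qed
      then have ev: "eventually (\<lambda>n. norm ((rho_integral T g t - h (u n))\<^sup>2) \<le> e * (1/2) ^ n) sequentially"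
        by (intro always_eventually) auto
      have "(\<lambda>n. e * (1/2) ^ n) \<longlonglongrightarrow> e * 0" by (intro tendsto_mult tendsto_const LIMSEQ_power_zero) auto
      then have "(\<lambda>n. (rho_integral T g t - h (u n))\<^sup>2) \<longlonglongrightarrow> 0"
        using Lim_null_comparison[OF ev] by simp
      then have "(\<lambda>n. sqrt ((rho_integral T g t - h (u n))\<^sup>2)) \<longlonglongrightarrow> sqrt 0" by (rule tendsto_real_sqrt)
      then have "(\<lambda>n. rho_integral T g t - h (u n)) \<longlonglongrightarrow> 0" by (simp add: tendsto_rabs_zero_iff)
      then have "(\<lambda>n. rho_integral T g t - (rho_integral T g t - h (u n))) \<longlonglongrightarrow> rho_integral T g t - 0"
        by (rule tendsto_diff[OF tendsto_const])
      then show ?thesis by simp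
    qed
    ultimately show ?thesis by (rule LIMSEQ_unique)
  qed
  then show ?thesis using gint gie by (intro that[of g] is_delta_derivI) auto
qed


section \<open>Uniqueness of the delta derivative and its energy\<close>

text \<open>On \<open>T\<close> the half-line below \<open>a \<le> 1\<close> coincides with the
  half-open interval from 0 to \<open>up_T T a\<close>, and half-lines generate the Borel
  sets.\<close>

lemma AE_lambda_Delta_zero:
  assumes d: "integrable (lambda_Delta T) d" and zero: "\<And>t. t \<in> T \<Longrightarrow> (LINT s:({0..<t} \<inter> T)|lambda_Delta T. d s) = (0::real)"
  shows "AE s in lambda_Delta T. d s = 0"
proof (rule sigma_finite_measure.density_zero[OF prob_space_imp_sigma_finite[OF prob_space_lambda_Delta] d])
  interpret L: prob_space "lambda_Delta T" by (rule prob_space_lambda_Delta)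
  have si: "set_integrable (lambda_Delta T) (A \<inter> T) d" if "A \<in> sets borel" for A
    unfolding set_integrable_def using d that by (intro integrable_mult_indicator) auto
  \<comment> \<open>The point 1 lies in none of the intervals on which the integral is known to
    vanish, so its mass has to be computed separately; it is 0.\<close>
  have top: "AE s in lambda_Delta T. s \<noteq> 1"
  proof (rule AE_I')
    have "measure (lambda_Delta T) ({0..<1} \<inter> T) = 1" using measure_Ico[of 0 1] T_facts by simp
    then have "measure (lambda_Delta T) (space (lambda_Delta T) - {0..<1} \<inter> T) = 0"
      by (subst L.prob_compl) auto
    moreover have "space (lambda_Delta T) - {0..<1} \<inter> T = {1} \<inter> T"
    proof -
      have "x = 1" if "x \<in> T" "\<not> x < 1" for x using T_facts(6)[OF that(1)] that(2) by linarith
      then show ?thesis using T_facts(5) by auto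
    qed
    ultimately show "{1} \<inter> T \<in> null_sets (lambda_Delta T)"
      by (auto simp: L.emeasure_eq_measure null_sets_def)
  qed (use T_facts in auto)
  have all: "(LINT s:T|lambda_Delta T. d s) = 0"
  proof -
    have "(LINT s:T|lambda_Delta T. d s) = (LINT s:({0..<1} \<inter> T)|lambda_Delta T. d s)"
      unfolding set_lebesgue_integral_def
    proof (rule integral_cong_AE)
      show "AE s in lambda_Delta T. indicator T s *\<^sub>R d s = indicator ({0..<1} \<inter> T) s *\<^sub>R d s"
        using top T_facts(5,6) by (auto elim!: eventually_mono simp: indicator_def order_le_less)
    qed (use d si[of UNIV] si[of "{0..<1}"] in \<open>auto simp: set_integrable_def simp del: real_scaleR_def\<close>)
    then show ?thesis using zero[of 1] T_facts by simp
  qed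
  have main: "(LINT s:(A \<inter> T)|lambda_Delta T. d s) = 0" if "A \<in> sets borel" for A
  proof -
    have "Int_stable (range (lessThan :: real \<Rightarrow> real set))"
    proof (rule Int_stableI, clarify)
      fix a b :: real
      have "{..<a} \<inter> {..<b} = {..<min a b}" by auto
      then show "{..<a} \<inter> {..<b} \<in> range lessThan" by simp
    qed
    moreover have "range (lessThan :: real \<Rightarrow> real set) \<subseteq> Pow UNIV" by simp
    moreover have "A \<in> sigma_sets UNIV (range lessThan)"
      using that by (simp add: borel_Iio)
    ultimately show ?thesis
    proof (induction rule: sigma_sets_induct_disjoint)
      case (basic A)
      then obtain a :: real where A: "A = {..<a}" by auto
      consider "a \<le> 1" | "1 < a" by linarith
      then show ?case
      proof cases
        case 1
        have "A \<inter> T = {0..<up_T T a} \<inter> T"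
          using up_T[OF 1] T_facts(5) by (force simp: A not_le[symmetric])
        then show ?thesis using zero up_T(1)[OF 1] by simp
      next
        case 2
        then have "A \<inter> T = T" using T_facts(6) by (force simp: A)
        then show ?thesis using all by simp
      qed
    next
      case empty
      then show ?case by (simp add: set_lebesgue_integral_def)
    next
      case (compl A)
      have A: "A \<in> sets borel" using compl by (simp add: borel_Iio)
      have "(LINT s:((A \<inter> T) \<union> ((UNIV - A) \<inter> T))|lambda_Delta T. d s)
         = (LINT s:(A \<inter> T)|lambda_Delta T. d s) + (LINT s:((UNIV - A) \<inter> T)|lambda_Delta T. d s)"
        using A by (intro set_integral_Un si) auto
      moreover have "(A \<inter> T) \<union> ((UNIV - A) \<inter> T) = T" by auto
      ultimately show ?case using all compl by simp
    next
      case (union A)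
      have A: "A i \<in> sets borel" for i using union by (auto simp: borel_Iio)
      have "(LINT s:(\<Union>i. A i \<inter> T)|lambda_Delta T. d s) = (\<Sum>i. LINT s:(A i \<inter> T)|lambda_Delta T. d s)"
      proof (rule lebesgue_integral_countable_add)
        show "A i \<inter> T \<in> sets (lambda_Delta T)" for i using A by auto
        show "A i \<inter> T \<inter> (A j \<inter> T) = {}" if "i \<noteq> j" for i j
          using union(1) that by (auto simp: disjoint_family_on_def)
        have "(\<Union>i. A i \<inter> T) = (\<Union>i. A i) \<inter> T" by auto
        then show "set_integrable (lambda_Delta T) (\<Union>i. A i \<inter> T) d"
          using A by (simp add: si sets.countable_UN)
      qed
      moreover have "(\<Union>i. A i \<inter> T) = (\<Union>i. A i) \<inter> T" by auto
      ultimately show ?case using union by simp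
    qed
  qed
  show "set_lebesgue_integral (lambda_Delta T) A d = 0" if "A \<in> sets (lambda_Delta T)" for A
    using that main by (auto simp: sets_restrict_space Int_commute)
qed

lemma is_delta_deriv_unique:
  assumes g: "is_delta_deriv T h g" and g': "is_delta_deriv T h g'"
  shows "AE s in lambda_Delta T. g s = g' s"
proof -
  interpret L: prob_space "lambda_Delta T" by (rule prob_space_lambda_Delta)
  have int: "integrable (lambda_Delta T) g" "integrable (lambda_Delta T) g'"
    using is_delta_derivD(1,2)[OF g] is_delta_derivD(1,2)[OF g']
    by (auto intro: L.square_integrable_imp_integrable cong: measurable_cong_sets)
  have "AE s in lambda_Delta T. g s - g' s = 0"
  proof (rule AE_lambda_Delta_zero)
    show "integrable (lambda_Delta T) (\<lambda>s. g s - g' s)" using int by auto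
    show "(LINT s:({0..<t} \<inter> T)|lambda_Delta T. g s - g' s) = 0" if t: "t \<in> T" for t
    proof -
      have "(LINT s:({0..<t} \<inter> T)|lambda_Delta T. g s - g' s)
          = (LINT s:({0..<t} \<inter> T)|lambda_Delta T. g s) - (LINT s:({0..<t} \<inter> T)|lambda_Delta T. g' s)"
        using int by (intro set_integral_diff)
          (auto simp: set_integrable_def intro!: integrable_mult_indicator simp del: real_scaleR_def)
      then show ?thesis using g g' t by (simp add: is_delta_deriv_def)
    qed
  qed
  then show ?thesis by simp
qed

lemma delta_deriv: "h \<in> HT T \<Longrightarrow> is_delta_deriv T h (delta_deriv T h)"
  unfolding HT_def delta_deriv_def using someI_ex[of "is_delta_deriv T h"] by auto

text \<open>One inequality is Cauchy--Schwarz on grids. For the other, \<open>ex_delta_deriv\<close>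
  with the supremum of the grid energies as its bound yields some derivative of no larger norm, and
  uniqueness identifies it with the chosen one.\<close>

lemma energy_HT:
  assumes h: "h \<in> HT T"
  shows "energy T h = ennreal (LINT s|lambda_Delta T. (delta_deriv T h s)\<^sup>2)"
proof -
  let ?e = "LINT s|lambda_Delta T. (delta_deriv T h s)\<^sup>2"
  have hC: "h \<in> CT T" using h by (simp add: HT_def)
  have le: "grid_energy T n h \<le> ?e" for n by (rule grid_energy_le[OF delta_deriv[OF h]])
  have bdd: "bdd_above (range (\<lambda>n. grid_energy T n h))" using le by (auto intro!: bdd_aboveI)
  obtain g where g: "is_delta_deriv T h g" "(LINT s|lambda_Delta T. (g s)\<^sup>2) \<le> (SUP n. grid_energy T n h)"
    using ex_delta_deriv[OF hC cSUP_upper[OF UNIV_I bdd]] by auto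
  have "?e = (LINT s|lambda_Delta T. (g s)\<^sup>2)"
    using is_delta_deriv_unique[OF delta_deriv[OF h] g(1)] is_delta_derivD(1)[OF delta_deriv[OF h]] is_delta_derivD(1)[OF g(1)]
    by (intro integral_cong_AE) (auto elim!: eventually_mono cong: measurable_cong_sets)
  with g have "?e \<le> (SUP n. grid_energy T n h)" by simp
  moreover have "(SUP n. grid_energy T n h) \<le> ?e" using le by (intro cSUP_least) auto
  ultimately have eq: "?e = (SUP n. grid_energy T n h)" by simp
  have "incseq (\<lambda>n. grid_energy T n h)" using grid_energy_mono by (auto simp: incseq_def)
  then have "(\<lambda>n. grid_energy T n h) \<longlonglongrightarrow> ?e" unfolding eq by (intro LIMSEQ_incseq_SUP bdd)
  then have "(\<lambda>n. ennreal (grid_energy T n h)) \<longlonglongrightarrow> ennreal ?e" by (rule tendsto_ennrealI)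
  moreover have "(\<lambda>n. ennreal (grid_energy T n h)) \<longlonglongrightarrow> energy T h"
    unfolding energy_def using grid_energy_mono by (intro LIMSEQ_SUP) (auto simp: incseq_def ennreal_leI)
  ultimately show ?thesis by (rule LIMSEQ_unique[rotated])
qed

lemma HT_iff_energy: "h \<in> HT T \<longleftrightarrow> h \<in> CT T \<and> energy T h < \<infinity>"
proof
  assume h: "h \<in> HT T"
  then show "h \<in> CT T \<and> energy T h < \<infinity>" using energy_HT[OF h] by (simp add: HT_def)
next
  assume h: "h \<in> CT T \<and> energy T h < \<infinity>"
  then obtain e where e: "energy T h = ennreal e" "0 \<le> e" by (cases "energy T h") auto
  have "grid_energy T n h \<le> e" for n
  proof -
    have "ennreal (grid_energy T n h) \<le> ennreal e" unfolding e(1)[symmetric] energy_def by (rule SUP_upper) simp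
    then show ?thesis using e by simp
  qed
  then obtain g where "is_delta_deriv T h g" using ex_delta_deriv[of h e] h by auto
  then show "h \<in> HT T" using h by (auto simp: HT_def)
qed

lemma HT_norm_square: "h \<in> CT T \<Longrightarrow> (HT_norm T h)\<^sup>2 = energy T h"
proof (cases "h \<in> HT T")
  case True
  have "0 \<le> (LINT s|lambda_Delta T. (delta_deriv T h s)\<^sup>2)" by (intro integral_nonneg_AE) simp
  then show ?thesis unfolding energy_HT[OF True] using True by (simp add: HT_norm_def ennreal_power)
next
  case False
  assume "h \<in> CT T"
  with False have "energy T h = \<infinity>" by (simp add: HT_iff_energy not_less top_unique)
  with False show ?thesis by (simp add: HT_norm_def)
qed

section \<open>Right-scattered points and interpolation across gaps\<close>

lemma right_scattered_next:
  assumes t: "t \<in> right_scattered T"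
  defines "\<sigma> \<equiv> Inf {u \<in> T. t < u}"
  shows "t \<in> T" "\<sigma> \<in> T" "t < \<sigma>" "\<And>u. u \<in> T \<Longrightarrow> t < u \<Longrightarrow> \<sigma> \<le> u"
proof -
  show tT: "t \<in> T" and ts: "t < \<sigma>" using t by (auto simp: right_scattered_def \<sigma>_def)
  have eq: "{u \<in> T. t < u} = T \<inter> {t<..}" by auto
  show le: "\<sigma> \<le> u" if "u \<in> T" "t < u" for u
    unfolding \<sigma>_def eq using that bdd_T by (intro cInf_lower) auto
  have "t < 1" using t T_facts(6)[OF tT] by (auto simp: right_scattered_def)
  then have "1 \<in> T \<inter> {t<..}" using T_facts by auto
  then have "\<sigma> \<in> closure (T \<inter> {t<..})"
    unfolding \<sigma>_def eq using bdd_T by (intro closure_contains_Inf) auto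
  also have "\<dots> \<subseteq> T" using T_facts by (intro closure_minimal) auto
  finally show "\<sigma> \<in> T" .
qed

text \<open>A right-scattered point is an atom whose mass is the length of the gap, so the
  derivative there is a difference quotient. Its linearity and its stability under pointwise
  convergence carry the second adaptedness condition of \<open>L2_a\<close> through sums and
  limits.\<close>

lemma delta_deriv_right_scattered:
  assumes h: "h \<in> HT T" and t: "t \<in> right_scattered T"
  shows "delta_deriv T h t = (h (Inf {u \<in> T. t < u}) - h t) / (Inf {u \<in> T. t < u} - t)"
proof -
  define \<sigma> where "\<sigma> = Inf {u \<in> T. t < u}"
  note \<sigma> = right_scattered_next[OF t, folded \<sigma>_def]
  note g = is_delta_derivD[OF delta_deriv[OF h]]
  have Ico: "{t..<\<sigma>} \<inter> T = {t}" using \<sigma> by (force simp: not_le[symmetric])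
  have "h \<sigma> - h t = (LINT s:{t}|lambda_Delta T. delta_deriv T h s)"
    using set_integral_Ico(1)[OF g(1,2) \<sigma>(1,2)] \<sigma> by (simp add: g(3) Ico)
  also have "\<dots> = (LINT s|lambda_Delta T. indicator {t} s *\<^sub>R delta_deriv T h t)"
    unfolding set_lebesgue_integral_def by (intro Bochner_Integration.integral_cong) (auto simp: indicator_def)
  also have "\<dots> = measure (lambda_Delta T) ({t..<\<sigma>} \<inter> T) * delta_deriv T h t"
    using \<sigma>(1) by (simp add: Ico)
  also have "measure (lambda_Delta T) ({t..<\<sigma>} \<inter> T) = \<sigma> - t" using \<sigma> by (intro measure_Ico) auto
  finally show ?thesis using \<sigma>(3) by (simp add: \<sigma>_def[symmetric])
qed

text \<open>Linear across a gap, but written with the slope at the left end instead of the value at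
  the right end: only data available at time \<open>down_T T x\<close> occur. On \<open>T\<close>
  the second summand vanishes.\<close>

definition interpolate :: "(real \<Rightarrow> real) \<Rightarrow> real \<Rightarrow> real" where
  "interpolate h x = h (down_T T x) + (x - down_T T x) * delta_deriv T h (down_T T x)"

lemma down_T_right_scattered:
  assumes "0 \<le> x" "x \<le> 1" "x \<notin> T"
  shows "down_T T x \<in> right_scattered T"
proof -
  note d = down_T[OF assms(1)]
  have "down_T T x \<noteq> x" using d(1) assms(3) by auto
  then have lt: "down_T T x < x" using d(2) by linarith
  have "x \<le> u" if "u \<in> T" "down_T T x < u" for u
    using d(3)[of u] that by (cases "u \<le> x") auto
  moreover have "1 \<in> {u \<in> T. down_T T x < u}" using T_facts lt assms by auto
  ultimately have "x \<le> Inf {u \<in> T. down_T T x < u}" by (intro cInf_greatest) auto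
  with lt d(1) assms show ?thesis by (auto simp: right_scattered_def)
qed

text \<open>Between \<open>down_T T x\<close> and \<open>x\<close> the function
  \<open>rho_bar\<close> is constant, so the pulled-back integral grows linearly there.\<close>

lemma interpolate_eq:
  assumes h: "h \<in> HT T" and x: "0 \<le> x" "x \<le> 1"
  shows "interpolate h x = rho_integral T (delta_deriv T h) x"
proof -
  note g = is_delta_derivD[OF delta_deriv[OF h]]
  note d = down_T[OF x(1)]
  let ?l = "down_T T x"
  have l0: "0 \<le> ?l" using d T_facts by auto
  have rho: "rho_bar T u = ?l" if "u \<in> {?l<..x}" for u
  proof (rule antisym)
    have u: "0 \<le> u" "u \<le> 1" using that l0 x by auto
    show "?l \<le> rho_bar T u" using that u d by (intro rho_bar_props) auto
    show "rho_bar T u \<le> ?l" using rho_bar_props[OF u] that by (intro d) auto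
  qed
  have "rho_integral T (delta_deriv T h) x - rho_integral T (delta_deriv T h) ?l
      = (LINT u:{?l<..x}|unit_lebesgue. delta_deriv T h (rho_bar T u))"
    by (rule rho_integral_diff(1)[OF g(1,2)]) (use l0 d x in auto)
  also have "\<dots> = (LINT u|unit_lebesgue. indicator {?l<..x} u *\<^sub>R delta_deriv T h ?l)"
    unfolding set_lebesgue_integral_def
    by (intro Bochner_Integration.integral_cong) (auto simp: indicator_def rho simp del: greaterThanAtMost_iff)
  also have "\<dots> = (x - ?l) * delta_deriv T h ?l"
  proof -
    have "measure unit_lebesgue {?l<..x} = x - ?l"
      using l0 d x by (subst measure_restrict_space) auto
    moreover have "{?l<..x} \<inter> space unit_lebesgue = {?l<..x}"
      using l0 x by (auto simp: space_restrict_space)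
    ultimately show ?thesis by simp
  qed
  finally show ?thesis using g(3)[OF d(1)] by (simp add: interpolate_def)
qed

lemma interpolate_T: "t \<in> T \<Longrightarrow> interpolate h t = h t"
  by (simp add: interpolate_def down_T_eq)

lemma interpolate_diff_square_le:
  assumes h: "h \<in> HT T" and "0 \<le> s" "s \<le> t" "t \<le> 1"
  shows "(interpolate h t - interpolate h s)\<^sup>2 \<le> (t - s) * enn2real (energy T h)"
  using rho_integral_diff_square_le[OF is_delta_derivD(1,2)[OF delta_deriv[OF h]] assms(2-4)] assms
  by (simp add: interpolate_eq energy_HT)

lemma interpolate_energy_le:
  assumes h: "h \<in> HT T" and "mono x" "0 \<le> x 0" "x n \<le> 1"
  shows "(\<Sum>k<n. (interpolate h (x (Suc k)) - interpolate h (x k))\<^sup>2 / (x (Suc k) - x k)) \<le> enn2real (energy T h)"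
proof -
  have x01: "0 \<le> x k" for k using assms monoD[OF assms(2), of 0 k] by auto
  have x1: "x k \<le> 1" if "k \<le> n" for k using assms monoD[OF assms(2), of k n] that by auto
  show ?thesis
    using rho_integral_energy_le[OF is_delta_derivD(1,2)[OF delta_deriv[OF h]] assms(2-4)] h x01 x1
    by (simp add: interpolate_eq energy_HT)
qed

text \<open>Cauchy--Schwarz from 0, where the path vanishes, over a length of at most 1. Convergence
  in energy is therefore uniform convergence of paths.\<close>

lemma eval_square_le_energy:
  assumes h: "h \<in> CT T" and t: "t \<in> T"
  shows "ennreal ((h t)\<^sup>2) \<le> energy T h"
proof (cases "h \<in> HT T")
  case True
  have "(h t)\<^sup>2 \<le> t * enn2real (energy T h)"
    using interpolate_diff_square_le[OF True, of 0 t] T_facts(3,5,6) t h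
    by (simp add: interpolate_T CT_def)
  also have "\<dots> \<le> 1 * enn2real (energy T h)" using T_facts(6)[OF t] by (intro mult_right_mono) auto
  finally have "ennreal ((h t)\<^sup>2) \<le> ennreal (enn2real (energy T h))" by (simp add: ennreal_leI)
  also have "\<dots> = energy T h" using True by (simp add: HT_iff_energy)
  finally show ?thesis .
next
  case False
  then have "energy T h = \<infinity>" using h by (simp add: HT_iff_energy not_less top_unique)
  then show ?thesis by simp
qed

end

section \<open>Augmented filtrations\<close>

lemma space_aug[simp]:
  assumes "space F = space \<nu>"
  shows "space (aug \<nu> F) = space \<nu>"
  unfolding aug_def using assms sets.sets_into_space[of _ F] sets.sets_into_space[of _ "completion \<nu>"]
  by (intro space_measure_of) (auto simp: null_sets_def)

lemma sets_aug:
  assumes "space F = space \<nu>"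
  shows "sets (aug \<nu> F) = sigma_sets (space \<nu>) (sets F \<union> null_sets (completion \<nu>))"
  unfolding aug_def using assms sets.sets_into_space[of _ F] sets.sets_into_space[of _ "completion \<nu>"]
  by (intro sets_measure_of) (auto simp: null_sets_def)

lemma sets_aug_superset:
  assumes "space F = space \<nu>"
  shows "sets F \<subseteq> sets (aug \<nu> F)" "null_sets (completion \<nu>) \<subseteq> sets (aug \<nu> F)"
  by (auto simp: sets_aug[OF assms])

lemma measurable_aug:
  "space F = space \<nu> \<Longrightarrow> f \<in> F \<rightarrow>\<^sub>M N \<Longrightarrow> f \<in> aug \<nu> F \<rightarrow>\<^sub>M N"
  using sets_aug_superset(1)[of F \<nu>] by (auto simp: measurable_def)

text \<open>Being almost surely equal to a set of \<open>F\<close> holds for the generators and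
  survives complements and countable unions. This leads back from augmented sigma-fields to raw
  ones, for which independence of increments is shown.\<close>

lemma aug_set_version:
  assumes F: "space F = space \<nu>" and A: "A \<in> sets (aug \<nu> F)"
  shows "\<exists>A'\<in>sets F. AE x in \<nu>. x \<in> A \<longleftrightarrow> x \<in> A'"
  using A unfolding sets_aug[OF F]
proof (induction rule: sigma_sets.induct)
  case (Basic A)
  then consider "A \<in> sets F" | "A \<in> null_sets (completion \<nu>)" by auto
  then show ?case
  proof cases
    case 2
    then have "AE x in completion \<nu>. x \<notin> A" by (rule AE_not_in)
    then have "AE x in \<nu>. x \<notin> A" by (simp add: AE_completion_iff)
    then show ?thesis by (intro bexI[of _ "{}"]) (auto elim!: eventually_mono)
  qed auto
next
  case Empty
  then show ?case by (intro bexI[of _ "{}"]) auto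
next
  case (Compl A)
  then obtain A' where A': "A' \<in> sets F" "AE x in \<nu>. x \<in> A \<longleftrightarrow> x \<in> A'" by auto
  have "AE x in \<nu>. x \<in> space \<nu> - A \<longleftrightarrow> x \<in> space \<nu> - A'"
    using A'(2) by eventually_elim auto
  then show ?case using sets.compl_sets[OF A'(1)] F by (intro bexI[of _ "space \<nu> - A'"]) auto
next
  case (Union A)
  then obtain A' where A': "\<And>i. A' i \<in> sets F" "\<And>i. AE x in \<nu>. x \<in> A i \<longleftrightarrow> x \<in> A' i" by metis
  have "AE x in \<nu>. x \<in> (\<Union>i. A i) \<longleftrightarrow> x \<in> (\<Union>i. A' i)"
    using A'(2)[THEN AE_all_countable[THEN iffD2, OF allI]] by eventually_elim auto
  then show ?case using A'(1) by (intro bexI[of _ "\<Union>i. A' i"]) auto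
qed

text \<open>\<open>B\<close> differs from \<open>A\<close> only inside a null set, all of whose
  subsets are negligible for the completion and hence belong to the augmented sigma-field.\<close>

lemma aug_AE_cong_set:
  assumes F: "space F = space \<nu>" and A: "A \<in> sets (aug \<nu> F)"
    and B: "B \<subseteq> space \<nu>" and eq: "AE x in \<nu>. x \<in> B \<longleftrightarrow> x \<in> A"
  shows "B \<in> sets (aug \<nu> F)"
proof -
  obtain N where N: "N \<in> null_sets \<nu>" "{x \<in> space \<nu>. \<not> (x \<in> B \<longleftrightarrow> x \<in> A)} \<subseteq> N"
    using eq by (auto simp: eventually_ae_filter)
  have null: "C \<in> sets (aug \<nu> F)" if "C \<subseteq> N" for C
    using null_sets_completion_subset[OF that] null_sets_completionI[OF N(1)] sets_aug_superset(2)[OF F] by auto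
  have "A \<subseteq> space (aug \<nu> F)" using A by (rule sets.sets_into_space)
  then have "A \<subseteq> space \<nu>" using F by simp
  then have "B = (A - N) \<union> (B \<inter> N)" using N(2) B by blast
  moreover have "(A - N) \<union> (B \<inter> N) \<in> sets (aug \<nu> F)"
    by (rule sets.Un[OF sets.Diff[OF A null[OF order_refl]] null]) auto
  ultimately show ?thesis by simp
qed

lemma aug_AE_cong:
  assumes F: "space F = space \<nu>" and f: "f \<in> aug \<nu> F \<rightarrow>\<^sub>M N" and eq: "AE x in \<nu>. g x = f x"
    and g: "g \<in> space \<nu> \<rightarrow> space N"
  shows "g \<in> aug \<nu> F \<rightarrow>\<^sub>M N"
proof (rule measurableI)
  show "g x \<in> space N" if "x \<in> space (aug \<nu> F)" for x using g that F by auto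
  fix A assume A: "A \<in> sets N"
  have "f -` A \<inter> space \<nu> \<in> sets (aug \<nu> F)"
    using measurable_sets[OF f A] F by simp
  then have "g -` A \<inter> space \<nu> \<in> sets (aug \<nu> F)"
    by (rule aug_AE_cong_set[OF F]) (use eq in \<open>auto elim!: eventually_mono\<close>)
  then show "g -` A \<inter> space (aug \<nu> F) \<in> sets (aug \<nu> F)" using F by simp
qed

lemma aug_AE_limit:
  fixes f :: "nat \<Rightarrow> 'a \<Rightarrow> real"
  assumes F: "space F = space \<nu>" and f: "\<And>n. f n \<in> borel_measurable (aug \<nu> F)"
    and lim: "AE x in \<nu>. (\<lambda>n. f n x) \<longlonglongrightarrow> g x"
  shows "g \<in> borel_measurable (aug \<nu> F)"
proof (rule aug_AE_cong[OF F])
  show "(\<lambda>x. lim (\<lambda>n. f n x)) \<in> borel_measurable (aug \<nu> F)"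
    using f by (rule borel_measurable_lim_metric)
  show "AE x in \<nu>. g x = lim (\<lambda>n. f n x)"
    using lim by eventually_elim (simp add: limI)
qed simp

text \<open>A version of \<open>f\<close> is rebuilt from versions of its countably many sublevel sets at rational levels.\<close>

lemma aug_version:
  fixes f :: "'a \<Rightarrow> real"
  assumes F: "space F = space \<nu>" and f: "f \<in> borel_measurable (aug \<nu> F)"
  obtains f' where "f' \<in> borel_measurable F" "AE x in \<nu>. f x = f' x"
proof -
  have "\<exists>A'\<in>sets F. AE x in \<nu>. x \<in> {x \<in> space \<nu>. f x < of_rat q} \<longleftrightarrow> x \<in> A'" for q :: rat
  proof (rule aug_set_version[OF F])
    have "{x \<in> space (aug \<nu> F). f x < of_rat q} \<in> sets (aug \<nu> F)" using f by measurable
    then show "{x \<in> space \<nu>. f x < of_rat q} \<in> sets (aug \<nu> F)" using F by simp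
  qed
  then obtain A where A: "\<And>q. A q \<in> sets F" "\<And>q. AE x in \<nu>. x \<in> {x \<in> space \<nu>. f x < of_rat q} \<longleftrightarrow> x \<in> A q"
    by metis
  \<comment> \<open>Almost surely \<open>A q\<close> consists of the points with
    \<open>f x < q\<close>, so the infimum runs over the rationals above \<open>f x\<close>; the
    value infinity removes the other rationals.\<close>
  define g where "g x = (INF q. if x \<in> A q then ereal (of_rat q) else \<infinity>)" for x
  have [measurable]: "A q \<in> sets F" for q by (rule A)
  have g[measurable]: "g \<in> borel_measurable F"
    unfolding g_def by (intro borel_measurable_INF) (auto intro!: measurable_If)
  have "AE x in \<nu>. \<forall>q. x \<in> {x \<in> space \<nu>. f x < of_rat q} \<longleftrightarrow> x \<in> A q"
    using A(2) by (simp add: AE_all_countable)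
  then have eq: "AE x in \<nu>. g x = ereal (f x)"
    using AE_space
  proof eventually_elim
    case (elim x)
    then have iff: "x \<in> A q \<longleftrightarrow> f x < of_rat q" for q by auto
    show ?case
    proof (rule antisym)
      show "ereal (f x) \<le> g x" unfolding g_def by (intro INF_greatest) (auto simp: iff)
      show "g x \<le> ereal (f x)"
      proof (rule ereal_le_epsilon2)
        fix e :: real assume "0 < e"
        then obtain q where q: "f x < of_rat q" "of_rat q < f x + e" using of_rat_dense[of "f x" "f x + e"] by auto
        have "g x \<le> (if x \<in> A q then ereal (of_rat q) else \<infinity>)" unfolding g_def by (rule INF_lower) simp
        also have "\<dots> \<le> ereal (f x) + ereal e" using q by (simp add: iff)
        finally show "g x \<le> ereal (f x) + ereal e" .
      qed
    qed
  qed
  show thesis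
  proof (rule that)
    show "(\<lambda>x. real_of_ereal (g x)) \<in> borel_measurable F" by measurable
    show "AE x in \<nu>. f x = real_of_ereal (g x)" using eq by eventually_elim simp
  qed
qed

section \<open>The Borel sets of the path space\<close>

context time_scaled
begin

lemma CT_algebra:
  assumes "u \<in> CT T" "v \<in> CT T"
  shows "(\<lambda>t. u t + v t) \<in> CT T" "(\<lambda>t. u t - v t) \<in> CT T" "(\<lambda>t. c * u t) \<in> CT T"
  using assms by (auto simp: CT_def intro!: continuous_intros)

lemma zero_CT: "(\<lambda>_. 0) \<in> CT T"
  by (simp add: CT_def)

lemma CT_eqI: "u \<in> CT T \<Longrightarrow> v \<in> CT T \<Longrightarrow> (\<And>t. t \<in> T \<Longrightarrow> u t = v t) \<Longrightarrow> u = v"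
  unfolding CT_def fun_eq_iff mem_Collect_eq by metis

lemma CT_dist_le:
  assumes "u \<in> CT T" "v \<in> CT T" "\<And>t. t \<in> T \<Longrightarrow> \<bar>u t - v t\<bar> \<le> r"
  shows "CT_dist T u v \<le> r"
  using assms T_facts by (auto simp: CT_dist_def intro!: cSUP_least)

lemma le_CT_dist:
  assumes "u \<in> CT T" "v \<in> CT T" "t \<in> T"
  shows "\<bar>u t - v t\<bar> \<le> CT_dist T u v"
proof -
  have "bdd_above ((\<lambda>t. \<bar>u t - v t\<bar>) ` T)"
    using assms unfolding CT_def
    by (intro bounded_imp_bdd_above compact_imp_bounded compact_continuous_image T_facts continuous_intros) auto
  then show ?thesis using assms by (auto simp: CT_dist_def intro!: cSUP_upper)
qed

lemma space_borel_CT[simp]: "space (borel_CT T) = CT T"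
  and sets_borel_CT: "sets (borel_CT T) = sigma_sets (CT T) {U. openin (Metric_space.mtopology (CT T) (CT_dist T)) U}"
proof -
  interpret MS: Metric_space "CT T" "CT_dist T" by (rule CT_Metric_space[OF ts])
  have "{U. openin MS.mtopology U} \<subseteq> Pow (CT T)" using openin_subset by fastforce
  then show "space (borel_CT T) = CT T"
    "sets (borel_CT T) = sigma_sets (CT T) {U. openin (Metric_space.mtopology (CT T) (CT_dist T)) U}"
    by (simp_all add: borel_CT_def)
qed

lemma eval_measurable[measurable]: "(\<lambda>\<omega>. \<omega> t) \<in> borel_measurable (borel_CT T)"
proof (cases "t \<in> T")
  case t: True
  interpret MS: Metric_space "CT T" "CT_dist T" by (rule CT_Metric_space[OF ts])
  show ?thesis
  proof (rule borel_measurableI)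
    fix S :: "real set" assume S: "open S"
    have "openin MS.mtopology ((\<lambda>\<omega>. \<omega> t) -` S \<inter> CT T)"
      unfolding MS.openin_mtopology
    proof (intro conjI allI impI)
      fix u assume u: "u \<in> (\<lambda>\<omega>. \<omega> t) -` S \<inter> CT T"
      then obtain r where r: "0 < r" "ball (u t) r \<subseteq> S" using S openE by blast
      have "MS.mball u r \<subseteq> (\<lambda>\<omega>. \<omega> t) -` S \<inter> CT T"
      proof
        fix v assume "v \<in> MS.mball u r"
        then have "v \<in> CT T" "CT_dist T u v < r" by auto
        then show "v \<in> (\<lambda>\<omega>. \<omega> t) -` S \<inter> CT T" using r le_CT_dist[of u v t] u t by (auto simp: dist_real_def)
      qed
      then show "\<exists>r>0. MS.mball u r \<subseteq> (\<lambda>\<omega>. \<omega> t) -` S \<inter> CT T" using r by auto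
    qed auto
    then show "(\<lambda>\<omega>. \<omega> t) -` S \<inter> space (borel_CT T) \<in> sets (borel_CT T)"
      unfolding sets_borel_CT space_borel_CT by (intro sigma_sets.Basic) simp
  qed
next
  case False
  then have "(\<lambda>\<omega>. \<omega> t) \<in> borel_measurable (borel_CT T) \<longleftrightarrow> (\<lambda>\<omega>::real\<Rightarrow>real. 0::real) \<in> borel_measurable (borel_CT T)"
    by (intro measurable_cong) (auto simp: CT_def)
  then show ?thesis by simp
qed

text \<open>Restriction to these times embeds the path space into the Polish space of real
  sequences, where inner regularity is available.\<close>

definition dense_seq :: "nat \<Rightarrow> real" where
  "dense_seq = (SOME d. range d \<subseteq> T \<and> T \<subseteq> closure (range d))"

lemma dense_seq: "dense_seq i \<in> T" "T \<subseteq> closure (range dense_seq)"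
proof -
  obtain D where D: "countable D" "D \<subseteq> T" "T \<subseteq> closure D" by (rule separable)
  then have "D \<noteq> {}" using T_facts by auto
  then have "range (from_nat_into D) = D" using D by (simp add: range_from_nat_into)
  then have "\<exists>d::nat \<Rightarrow> real. range d \<subseteq> T \<and> T \<subseteq> closure (range d)" using D by metis
  from someI_ex[OF this] show "dense_seq i \<in> T" "T \<subseteq> closure (range dense_seq)"
    unfolding dense_seq_def by blast+
qed

lemma CT_le_dense:
  assumes u: "u \<in> CT T" and le: "\<And>i. \<bar>u (dense_seq i)\<bar> \<le> r" and t: "t \<in> T"
  shows "\<bar>u t\<bar> \<le> r"
proof -
  have "t \<in> closure (range dense_seq)" using dense_seq t by auto
  then obtain x where x: "\<And>n. x n \<in> range dense_seq" "x \<longlonglongrightarrow> t" by (auto simp: closure_sequential)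
  have "(\<lambda>n. u (x n)) \<longlonglongrightarrow> u t"
  proof (rule continuous_on_tendsto_compose[OF _ x(2) t])
    show "continuous_on T u" using u by (simp add: CT_def)
    show "\<forall>\<^sub>F n in sequentially. x n \<in> T" using x(1) dense_seq(1) by (intro always_eventually allI) (metis rangeE)
  qed
  then have "(\<lambda>n. \<bar>u (x n)\<bar>) \<longlonglongrightarrow> \<bar>u t\<bar>" by (rule tendsto_rabs)
  moreover have "\<bar>u (x n)\<bar> \<le> r" for n using x(1)[of n] le by auto
  ultimately show ?thesis by (intro LIMSEQ_le_const2) auto
qed

text \<open>Exponents start at 1 because paths vanish at 0. Lists of rationals are countable, so
  these paths witness separability.\<close>

definition rat_poly :: "rat list \<Rightarrow> real \<Rightarrow> real" where
  "rat_poly qs t = (if t \<in> T then \<Sum>i<length qs. of_rat (qs ! i) * t ^ Suc i else 0)"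

lemma rat_poly_CT: "rat_poly qs \<in> CT T"
proof -
  have "continuous_on T (\<lambda>t. \<Sum>i<length qs. of_rat (qs ! i) * t ^ Suc i)" by (intro continuous_intros)
  then have "continuous_on T (rat_poly qs)" by (rule continuous_on_eq) (simp add: rat_poly_def)
  then show ?thesis by (simp add: CT_def rat_poly_def)
qed

text \<open>Three errors of size \<open>e / 3\<close>: Weierstrass approximation, dropping the
  constant term (which is small because \<open>u 0 = 0\<close>), and rounding the other
  coefficients. Since powers of \<open>t\<close> are at most 1 on \<open>T\<close>, \<open>d\<close>
  allots each of the \<open>n\<close> coefficients its share of the third error.\<close>

lemma rat_poly_dense:
  assumes u: "u \<in> CT T" and e: "0 < e"
  obtains qs where "\<And>t. t \<in> T \<Longrightarrow> \<bar>u t - rat_poly qs t\<bar> < e"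
proof -
  have "continuous_on T u" "u 0 = 0" using u by (auto simp: CT_def)
  then obtain g where g: "real_polynomial_function g" "\<And>x. x \<in> T \<Longrightarrow> \<bar>u x - g x\<bar> < e / 3"
    using Stone_Weierstrass_real_polynomial_function[OF T_facts(2), of u "e / 3"] e by auto
  then obtain a n where a: "g = (\<lambda>x. \<Sum>i\<le>n. a i * x ^ i)"
    using real_polynomial_function_iff_sum by auto
  have a0: "\<bar>a 0\<bar> < e / 3"
    using g(2)[OF T_facts(3)] \<open>u 0 = 0\<close> by (simp add: a sum.atMost_shift)
  define d where "d = e / (3 * (real n + 1))"
  have d: "0 < d" using e by (simp add: d_def)
  have "\<exists>q. \<bar>a (Suc i) - of_rat q\<bar> < d" for i
  proof -
    obtain q where "a (Suc i) - d < of_rat q" "of_rat q < a (Suc i) + d"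
      using of_rat_dense[of "a (Suc i) - d" "a (Suc i) + d"] d by auto
    then show ?thesis by (intro exI[of _ q]) (simp add: abs_less_iff)
  qed
  then obtain q where q: "\<And>i. \<bar>a (Suc i) - of_rat (q i)\<bar> < d" by metis
  define qs where "qs = map q [0..<n]"
  have "\<bar>u t - rat_poly qs t\<bar> < e" if t: "t \<in> T" for t
  proof -
    have t01: "0 \<le> t" "t \<le> 1" using T_facts t by auto
    have eq: "g t - rat_poly qs t = a 0 + (\<Sum>i<n. (a (Suc i) - of_rat (q i)) * t ^ Suc i)"
      using t by (simp add: a rat_poly_def qs_def sum.atMost_shift left_diff_distrib sum_subtractf)
    have "\<bar>\<Sum>i<n. (a (Suc i) - of_rat (q i)) * t ^ Suc i\<bar> \<le> (\<Sum>i<n. d * 1)"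
    proof (rule order_trans[OF sum_abs], rule sum_mono)
      fix i
      show "\<bar>(a (Suc i) - of_rat (q i)) * t ^ Suc i\<bar> \<le> d * 1"
        unfolding abs_mult using q[of i] t01 power_le_one[OF t01, of "Suc i"] by (intro mult_mono) auto
    qed
    also have "\<dots> \<le> e / 3" using e by (simp add: d_def field_simps)
    finally have "\<bar>g t - rat_poly qs t\<bar> < 2 * e / 3" using a0 unfolding eq by linarith
    with g(2)[OF t] show ?thesis by linarith
  qed
  then show ?thesis by (rule that)
qed

text \<open>An open set is a countable union of closed balls with rational polynomial centres and
  rational radii. By density each ball is cut out by countably many conditions on values along
  \<open>dense_seq\<close>.\<close>

lemma measurable_CT:
  assumes CT: "\<And>x. x \<in> space N \<Longrightarrow> f x \<in> CT T"
    and meas: "\<And>i. (\<lambda>x. f x (dense_seq i)) \<in> borel_measurable N"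
  shows "f \<in> N \<rightarrow>\<^sub>M borel_CT T"
proof -
  interpret MS: Metric_space "CT T" "CT_dist T" by (rule CT_Metric_space[OF ts])
  have preimage: "f -` U \<inter> space N \<in> sets N" if U: "openin MS.mtopology U" for U
  proof -
    define I where "I = {(qs, r). \<forall>v\<in>CT T. (\<forall>i. \<bar>rat_poly qs (dense_seq i) - v (dense_seq i)\<bar> \<le> of_rat r) \<longrightarrow> v \<in> U}"
    have "f -` U \<inter> space N = (\<Union>(qs, r)\<in>I. \<Inter>i. {x \<in> space N. \<bar>rat_poly qs (dense_seq i) - f x (dense_seq i)\<bar> \<le> of_rat r})"
    proof (intro equalityI subsetI)
      fix x assume x: "x \<in> f -` U \<inter> space N"
      then have fx: "f x \<in> CT T" "f x \<in> U" using CT by auto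
      then obtain e where e: "0 < e" "MS.mball (f x) e \<subseteq> U" using U unfolding MS.openin_mtopology by blast
      obtain qs where qs: "\<And>t. t \<in> T \<Longrightarrow> \<bar>f x t - rat_poly qs t\<bar> < e / 4" using rat_poly_dense[OF fx(1), of "e / 4"] e by auto
      \<comment> \<open>The centre is within \<open>e / 4\<close> of \<open>f x\<close>, hence
        \<open>f x\<close> lies in the ball of radius \<open>r > e / 4\<close>; with
        \<open>r < e / 2\<close> the whole ball stays within \<open>3 / 4 * e\<close> of
        \<open>f x\<close>.\<close>
      obtain r where r: "e / 4 < of_rat r" "of_rat r < e / 2" using of_rat_dense[of "e / 4" "e / 2"] e by auto
      have "(qs, r) \<in> I" unfolding I_def
      proof (clarify)
        fix v assume v: "v \<in> CT T" and le: "\<forall>i. \<bar>rat_poly qs (dense_seq i) - v (dense_seq i)\<bar> \<le> of_rat r"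
        have near: "\<bar>rat_poly qs t - v t\<bar> \<le> of_rat r" if "t \<in> T" for t
          using CT_le_dense[OF CT_algebra(2)[OF rat_poly_CT[of qs] v] _ that] le by auto
        have "\<bar>f x t - v t\<bar> \<le> 3 / 4 * e" if "t \<in> T" for t
          using qs[OF that] r(2) near[OF that] by linarith
        then have "CT_dist T (f x) v \<le> 3 / 4 * e" by (intro CT_dist_le fx v)
        also have "\<dots> < e" using e by simp
        finally show "v \<in> U" using e(2) fx v by auto
      qed
      moreover have "\<bar>rat_poly qs (dense_seq i) - f x (dense_seq i)\<bar> \<le> of_rat r" for i
        using qs[OF dense_seq(1)[of i]] r by (simp add: abs_minus_commute)
      ultimately show "x \<in> (\<Union>(qs, r)\<in>I. \<Inter>i. {x \<in> space N. \<bar>rat_poly qs (dense_seq i) - f x (dense_seq i)\<bar> \<le> of_rat r})"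
        using x by auto
    qed (use CT in \<open>auto simp: I_def\<close>)
    also have "\<dots> \<in> sets N"
    proof (rule sets.countable_UN')
      show "countable I" by (rule countable_subset[OF subset_UNIV]) auto
      have "(\<Inter>i. {x \<in> space N. \<bar>rat_poly qs (dense_seq i) - f x (dense_seq i)\<bar> \<le> of_rat r}) \<in> sets N" for qs r
        using meas by measurable
      then show "(\<lambda>(qs, r). \<Inter>i. {x \<in> space N. \<bar>rat_poly qs (dense_seq i) - f x (dense_seq i)\<bar> \<le> of_rat r}) ` I \<subseteq> sets N"
        by (intro image_subsetI) (simp only: split_beta)
    qed
    finally show ?thesis .
  qed
  show ?thesis
    unfolding borel_CT_def
  proof (rule measurable_measure_of)
    show "{U. openin MS.mtopology U} \<subseteq> Pow (CT T)" using openin_subset by fastforce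
    show "f \<in> space N \<rightarrow> CT T" using CT by blast
    show "f -` U \<inter> space N \<in> sets N" if "U \<in> {U. openin MS.mtopology U}" for U
      using that by (intro preimage) simp
  qed
qed

text \<open>By \<open>measurable_CT\<close> the identity is measurable from the sigma-field pulled
  back from sequence space, so every Borel set of paths is such a preimage.\<close>

lemma sets_borel_CT_vimage:
  assumes "A \<in> sets (borel_CT T)"
  obtains A' :: "(nat \<Rightarrow> real) set" where "A' \<in> sets borel" "A = (\<lambda>\<omega> i. \<omega> (dense_seq i)) -` A' \<inter> CT T"
proof -
  let ?\<Phi> = "\<lambda>(\<omega>::real \<Rightarrow> real) i. \<omega> (dense_seq i)"
  let ?V = "vimage_algebra (CT T) ?\<Phi> (borel :: (nat \<Rightarrow> real) measure)"
  have "?\<Phi> \<in> ?V \<rightarrow>\<^sub>M borel" by (rule measurable_vimage_algebra1) simp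
  then have "?\<Phi> \<in> ?V \<rightarrow>\<^sub>M PiM UNIV (\<lambda>_. borel)"
    by (subst measurable_cong_sets[OF refl sets_PiM_equal_borel])
  then have "(\<lambda>\<omega>. \<omega> (dense_seq i)) \<in> borel_measurable ?V" for i
    by (rule measurable_compose) (rule measurable_component_singleton, simp)
  then have "(\<lambda>\<omega>. \<omega>) \<in> ?V \<rightarrow>\<^sub>M borel_CT T" by (intro measurable_CT) auto
  from measurable_sets[OF this assms] have "A \<inter> CT T \<in> sets ?V" by simp
  moreover have "A \<subseteq> CT T" using sets.sets_into_space[OF assms] by simp
  ultimately have "A \<in> sets ?V" by (simp add: Int_absorb2)
  then obtain A' where "A' \<in> sets borel" "A = ?\<Phi> -` A' \<inter> CT T"
    by (subst (asm) sets_vimage_algebra2) auto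
  then show ?thesis by (rule that)
qed

section \<open>Random elements with finite energy\<close>

lemma grid_energy_measurable[measurable]: "grid_energy T n \<in> borel_measurable (borel_CT T)"
  unfolding grid_energy_def by measurable

lemma energy_measurable[measurable]: "energy T \<in> borel_measurable (borel_CT T)"
  unfolding energy_def[abs_def] by measurable

lemma grid_energy_le_energy: "ennreal (grid_energy T n u) \<le> energy T u"
  unfolding energy_def by (rule SUP_upper) simp

text \<open>Every term is the square of an increment over a nonnegative length, so a quadratic
  inequality for real numbers lifts termwise. Both the weighted triangle inequality and convexity of
  the energy are instances.\<close>

lemma grid_energy_combine:
  assumes "0 \<le> a" "0 \<le> b" and le: "\<And>x y. (p * x + q * y)\<^sup>2 \<le> a * x\<^sup>2 + b * (y::real)\<^sup>2"
  shows "grid_energy T n (\<lambda>t. p * u t + q * v t) \<le> a * grid_energy T n u + b * grid_energy T n v"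
  unfolding grid_energy_def sum_distrib_left sum.distrib[symmetric]
proof (rule sum_mono)
  fix k assume "k \<in> {..<(2::nat) ^ n}"
  let ?s = "grid T n (Suc k)" and ?t = "grid T n k"
  have "?t \<le> ?s" using \<open>k \<in> {..<2 ^ n}\<close> by (intro grid_mono) auto
  then have "(p * (u ?s - u ?t) + q * (v ?s - v ?t))\<^sup>2 / (?s - ?t)
     \<le> (a * (u ?s - u ?t)\<^sup>2 + b * (v ?s - v ?t)\<^sup>2) / (?s - ?t)"
    by (intro divide_right_mono le) auto
  moreover have "p * u ?s + q * v ?s - (p * u ?t + q * v ?t) = p * (u ?s - u ?t) + q * (v ?s - v ?t)"
    by (simp add: right_diff_distrib)
  ultimately show "(p * u ?s + q * v ?s - (p * u ?t + q * v ?t))\<^sup>2 / (?s - ?t)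
     \<le> a * ((u ?s - u ?t)\<^sup>2 / (?s - ?t)) + b * ((v ?s - v ?t)\<^sup>2 / (?s - ?t))"
    by (simp only: add_divide_distrib times_divide_eq_right)
qed

lemma energy_combine:
  assumes "0 \<le> a" "0 \<le> b" and le: "\<And>x y. (p * x + q * y)\<^sup>2 \<le> a * x\<^sup>2 + b * (y::real)\<^sup>2"
  shows "energy T (\<lambda>t. p * u t + q * v t) \<le> ennreal a * energy T u + ennreal b * energy T v"
  unfolding energy_def[of T "\<lambda>t. p * u t + q * v t"]
proof (rule SUP_least)
  fix n
  have "ennreal (grid_energy T n (\<lambda>t. p * u t + q * v t)) \<le> ennreal (a * grid_energy T n u + b * grid_energy T n v)"
    by (intro ennreal_leI grid_energy_combine assms)
  also have "\<dots> = ennreal a * ennreal (grid_energy T n u) + ennreal b * ennreal (grid_energy T n v)"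
    using assms(1,2) by (simp add: ennreal_mult ennreal_plus grid_energy_nonneg)
  also have "\<dots> \<le> ennreal a * energy T u + ennreal b * energy T v"
    by (intro add_mono mult_left_mono grid_energy_le_energy) auto
  finally show "ennreal (grid_energy T n (\<lambda>t. p * u t + q * v t)) \<le> ennreal a * energy T u + ennreal b * energy T v" .
qed

lemma energy_add_le:
  assumes s: "0 < s"
  shows "energy T (\<lambda>t. u t + v t) \<le> ennreal (1 + s) * energy T u + ennreal (1 + 1 / s) * energy T v"
  using energy_combine[of "1 + s" "1 + 1 / s" 1 1 u v] square_add_le_weighted[OF s] s by (simp only: mult_1 add_nonneg_nonneg zero_le_one less_imp_le zero_le_divide_1_iff)

lemma energy_convex:
  assumes "0 \<le> a" "a \<le> 1"
  shows "energy T (\<lambda>t. (1 - a) * u t + a * v t) \<le> ennreal (1 - a) * energy T u + ennreal a * energy T v"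
proof (rule energy_combine)
  fix x y
  have "0 \<le> (1 - a) * a * (x - y)\<^sup>2" using assms by simp
  then show "((1 - a) * x + a * y)\<^sup>2 \<le> (1 - a) * x\<^sup>2 + a * y\<^sup>2"
    by (simp add: power2_eq_square algebra_simps)
qed (use assms in auto)

lemma energy_scale: "energy T (\<lambda>t. c * u t) = ennreal (c\<^sup>2) * energy T u"
proof -
  have "grid_energy T n (\<lambda>t. c * u t) = c\<^sup>2 * grid_energy T n u" for n
    unfolding grid_energy_def sum_distrib_left
    by (intro sum.cong refl) (simp only: right_diff_distrib[symmetric] power_mult_distrib times_divide_eq_right)
  then show ?thesis
    by (simp add: energy_def ennreal_mult grid_energy_nonneg SUP_mult_left_ennreal)
qed

lemma energy_zero: "energy T (\<lambda>_. 0) = 0"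
  by (simp add: energy_def grid_energy_def)

lemma energy_uminus: "energy T (\<lambda>t. - u t) = energy T u"
  using energy_scale[of "-1" u] by simp

lemma energy_diff_commute: "energy T (\<lambda>t. u t - v t) = energy T (\<lambda>t. v t - u t)"
  using energy_uminus[of "\<lambda>t. u t - v t"] by simp

lemma energy_lsc:
  assumes lim: "\<And>t. t \<in> T \<Longrightarrow> (\<lambda>n. u n t) \<longlonglongrightarrow> v t"
  shows "energy T v \<le> liminf (\<lambda>n. energy T (u n))"
  unfolding energy_def[of T v]
proof (rule SUP_least)
  fix m
  have "(\<lambda>n. grid_energy T m (u n)) \<longlonglongrightarrow> grid_energy T m v"
    unfolding grid_energy_def divide_inverse
    by (intro tendsto_sum tendsto_mult[OF tendsto_power[OF tendsto_diff] tendsto_const] lim) (auto intro!: grid_props(1))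
  then have "(\<lambda>n. ennreal (grid_energy T m (u n))) \<longlonglongrightarrow> ennreal (grid_energy T m v)" by (rule tendsto_ennrealI)
  then have "ennreal (grid_energy T m v) = liminf (\<lambda>n. ennreal (grid_energy T m (u n)))"
    by (rule lim_imp_Liminf[symmetric, OF trivial_limit_sequentially])
  also have "\<dots> \<le> liminf (\<lambda>n. energy T (u n))"
    by (intro Liminf_mono always_eventually allI grid_energy_le_energy)
  finally show "ennreal (grid_energy T m v) \<le> liminf (\<lambda>n. energy T (u n))" .
qed

lemma L2_sq_eq:
  assumes "sets \<mu> = sets (borel_CT T)" "\<And>\<omega>. \<omega> \<in> CT T \<Longrightarrow> u \<omega> \<in> CT T"
  shows "L2_sq T \<mu> u = (\<integral>\<^sup>+\<omega>. energy T (u \<omega>) \<partial>\<mu>)"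
proof -
  have "space \<mu> = CT T" using sets_eq_imp_space_eq[OF assms(1)] by simp
  then show ?thesis unfolding L2_sq_def using assms by (intro nn_integral_cong) (simp add: HT_norm_square)
qed

lemma delta_deriv_combine:
  assumes "u \<in> HT T" "v \<in> HT T" and t: "t \<in> right_scattered T"
  shows "(\<lambda>t. a * u t + b * v t) \<in> HT T"
    "delta_deriv T (\<lambda>t. a * u t + b * v t) t = a * delta_deriv T u t + b * delta_deriv T v t"
proof -
  have "energy T (\<lambda>t. a * u t + b * v t) \<le> ennreal (1 + 1) * energy T (\<lambda>t. a * u t) + ennreal (1 + 1 / 1) * energy T (\<lambda>t. b * v t)"
    by (rule energy_add_le) simp
  also have "\<dots> < \<infinity>" using assms by (simp add: energy_scale HT_iff_energy ennreal_mult_less_top)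
  finally show h: "(\<lambda>t. a * u t + b * v t) \<in> HT T"
    using assms CT_algebra(1)[OF CT_algebra(3) CT_algebra(3), of u u v v a b] by (simp add: HT_iff_energy)
  show "delta_deriv T (\<lambda>t. a * u t + b * v t) t = a * delta_deriv T u t + b * delta_deriv T v t"
    unfolding delta_deriv_right_scattered[OF h t] delta_deriv_right_scattered[OF assms(1) t]
      delta_deriv_right_scattered[OF assms(2) t]
    by (simp add: add_divide_distrib[symmetric] right_diff_distrib)
qed

end

lemma ennreal_le_if_square_le: "(x::ennreal)\<^sup>2 \<le> ennreal (a\<^sup>2) \<Longrightarrow> 0 \<le> a \<Longrightarrow> x \<le> ennreal a"
  by (cases x) (auto simp: ennreal_power top_unique intro: power2_le_imp_le ennreal_leI)

section \<open>Random paths with square-integrable Cameron--Martin norm\<close>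

locale path_measure = time_scaled T + prob_space \<mu>
  for T :: "real set" and \<mu> :: "(real \<Rightarrow> real) measure" +
  assumes sets_mu[measurable_cong]: "sets \<mu> = sets (borel_CT T)"
begin

lemma space_mu[simp]: "space \<mu> = CT T"
  using sets_eq_imp_space_eq[OF sets_mu] by simp

abbreviation paths :: "((real \<Rightarrow> real) \<Rightarrow> (real \<Rightarrow> real)) set" where
  "paths \<equiv> borel_CT T \<rightarrow>\<^sub>M borel_CT T"

lemma paths_CT: "u \<in> paths \<Longrightarrow> \<omega> \<in> CT T \<Longrightarrow> u \<omega> \<in> CT T"
  using measurable_space[of u "borel_CT T" "borel_CT T"] by simp

lemma paths_eval: "u \<in> paths \<Longrightarrow> (\<lambda>\<omega>. u \<omega> t) \<in> borel_measurable (borel_CT T)"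
  by (rule measurable_compose[OF _ eval_measurable])

lemma id_paths: "id \<in> paths" and zero_paths: "0 \<in> paths"
  by (auto intro!: measurable_CT simp: zero_fun_def zero_CT)

lemma paths_algebra:
  assumes u: "u \<in> paths" and v: "v \<in> paths"
  shows "u + v \<in> paths" "u - v \<in> paths"
proof -
  have [measurable]: "(\<lambda>\<omega>. u \<omega> t) \<in> borel_measurable (borel_CT T)" "(\<lambda>\<omega>. v \<omega> t) \<in> borel_measurable (borel_CT T)" for t
    using paths_eval u v by auto
  show "u + v \<in> paths" "u - v \<in> paths"
    by (auto intro!: measurable_CT simp: plus_fun_def fun_diff_def paths_CT[OF u] paths_CT[OF v] CT_algebra)
qed

lemma path_scale_paths: "u \<in> paths \<Longrightarrow> path_scale c u \<in> paths"
proof -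
  assume u: "u \<in> paths"
  have [measurable]: "(\<lambda>\<omega>. u \<omega> t) \<in> borel_measurable (borel_CT T)" for t by (rule paths_eval[OF u])
  show ?thesis unfolding path_scale_def
    by (rule measurable_CT) (simp_all add: CT_algebra(3)[OF paths_CT[OF u] paths_CT[OF u]])
qed

lemma emeasure_mu: "emeasure \<mu> (CT T) = 1"
  using emeasure_space_1 by simp

lemma energy_paths_measurable[measurable]: "u \<in> paths \<Longrightarrow> (\<lambda>\<omega>. energy T (u \<omega>)) \<in> borel_measurable \<mu>"
  using measurable_compose[of u "borel_CT T" "borel_CT T" "energy T" borel, OF _ energy_measurable]
  by (simp cong: measurable_cong_sets add: sets_mu)

lemma L2_sq_paths: "u \<in> paths \<Longrightarrow> L2_sq T \<mu> u = (\<integral>\<^sup>+\<omega>. energy T (u \<omega>) \<partial>\<mu>)"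
proof (rule L2_sq_eq[OF sets_mu])
  fix \<omega> assume "u \<in> paths" "\<omega> \<in> CT T"
  then show "u \<omega> \<in> CT T" by (rule paths_CT)
qed

text \<open>\<open>enn2real\<close> sends infinity to 0, so a value of \<open>L2_norm\<close> is
  informative only together with finiteness of \<open>L2_sq\<close>.\<close>

definition L2_norm :: "((real \<Rightarrow> real) \<Rightarrow> (real \<Rightarrow> real)) \<Rightarrow> real" where
  "L2_norm u = sqrt (enn2real (L2_sq T \<mu> u))"

lemma L2_norm_nonneg: "0 \<le> L2_norm u"
  by (simp add: L2_norm_def)

lemma L2_sq_L2_norm: "L2_sq T \<mu> u < \<infinity> \<Longrightarrow> L2_sq T \<mu> u = ennreal ((L2_norm u)\<^sup>2)"
  by (simp add: L2_norm_def)

lemma L2_norm_le: "L2_sq T \<mu> u \<le> ennreal (a\<^sup>2) \<Longrightarrow> 0 \<le> a \<Longrightarrow> L2_norm u \<le> a"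
  unfolding L2_norm_def by (intro real_le_lsqrt) (auto intro!: enn2real_leI)

lemma L2_sq_add_le:
  assumes u: "u \<in> paths" and v: "v \<in> paths" and s: "0 < s"
  shows "L2_sq T \<mu> (u + v) \<le> ennreal (1 + s) * L2_sq T \<mu> u + ennreal (1 + 1 / s) * L2_sq T \<mu> v"
proof -
  note [measurable] = energy_paths_measurable[OF u] energy_paths_measurable[OF v]
  have "L2_sq T \<mu> (u + v) = (\<integral>\<^sup>+\<omega>. energy T (\<lambda>t. u \<omega> t + v \<omega> t) \<partial>\<mu>)"
    by (simp add: L2_sq_paths paths_algebra u v) (simp add: plus_fun_def fun_diff_def)
  also have "\<dots> \<le> (\<integral>\<^sup>+\<omega>. ennreal (1 + s) * energy T (u \<omega>) + ennreal (1 + 1 / s) * energy T (v \<omega>) \<partial>\<mu>)"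
    by (intro nn_integral_mono energy_add_le s)
  also have "\<dots> = ennreal (1 + s) * L2_sq T \<mu> u + ennreal (1 + 1 / s) * L2_sq T \<mu> v"
    by (simp add: nn_integral_add nn_integral_cmult L2_sq_paths u v)
  finally show ?thesis .
qed

lemma L2_add:
  assumes u: "u \<in> paths" and v: "v \<in> paths" and fin: "L2_sq T \<mu> u < \<infinity>" "L2_sq T \<mu> v < \<infinity>"
  shows "L2_sq T \<mu> (u + v) < \<infinity>" "L2_norm (u + v) \<le> L2_norm u + L2_norm v"
proof -
  have le: "L2_sq T \<mu> (u + v) \<le> ennreal ((1 + s) * (L2_norm u)\<^sup>2 + (1 + 1 / s) * (L2_norm v)\<^sup>2)" if "0 < s" for s
    using L2_sq_add_le[OF u v that] that unfolding L2_sq_L2_norm[OF fin(1)] L2_sq_L2_norm[OF fin(2)]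
    by (simp add: ennreal_mult ennreal_plus)
  show fin': "L2_sq T \<mu> (u + v) < \<infinity>"
    using le[of 1] by (simp add: le_less_trans)
  show "L2_norm (u + v) \<le> L2_norm u + L2_norm v"
  proof (rule le_add_if_square_le_weighted[OF L2_norm_nonneg L2_norm_nonneg])
    fix s :: real assume s: "0 < s"
    then show "(L2_norm (u + v))\<^sup>2 \<le> (1 + s) * (L2_norm u)\<^sup>2 + (1 + 1 / s) * (L2_norm v)\<^sup>2"
      using le[OF s] unfolding L2_sq_L2_norm[OF fin'] by (subst (asm) ennreal_le_iff) auto
  qed
qed

lemma L2_sq_scale:
  assumes u: "u \<in> paths"
  shows "L2_sq T \<mu> (path_scale c u) = ennreal (c\<^sup>2) * L2_sq T \<mu> u"
proof -
  note [measurable] = energy_paths_measurable[OF u]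
  show ?thesis
    by (simp add: L2_sq_paths path_scale_paths[OF u] u) (simp add: path_scale_def energy_scale nn_integral_cmult)
qed

lemma L2_norm_scale: "u \<in> paths \<Longrightarrow> L2_norm (path_scale c u) = \<bar>c\<bar> * L2_norm u"
  by (simp add: L2_norm_def L2_sq_scale enn2real_mult real_sqrt_mult)

lemma L2_sq_zero: "L2_sq T \<mu> 0 = 0"
  using L2_sq_paths[of 0] zero_paths
  by (simp add: zero_fun_def energy_zero measurable_CT zero_CT)

lemma L2_sq_diff_commute:
  assumes u: "u \<in> paths" and v: "v \<in> paths"
  shows "L2_sq T \<mu> (u - v) = L2_sq T \<mu> (v - u)"
  by (simp add: L2_sq_paths paths_algebra u v) (unfold fun_diff_def, intro nn_integral_cong energy_diff_commute)

lemma L2_diff: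
  assumes u: "u \<in> paths" and v: "v \<in> paths" and fin: "L2_sq T \<mu> u < \<infinity>" "L2_sq T \<mu> v < \<infinity>"
  shows "L2_sq T \<mu> (u - v) < \<infinity>"
proof -
  have eq: "u - v = u + path_scale (- 1) v" by (auto simp: path_scale_def fun_eq_iff)
  show ?thesis unfolding eq
    using L2_add(1)[OF u path_scale_paths[OF v, of "-1"]] fin by (simp add: L2_sq_scale v)
qed

lemma L2_dist_triangle:
  assumes "u \<in> paths" "v \<in> paths" "w \<in> paths" "L2_sq T \<mu> (u - v) < \<infinity>" "L2_sq T \<mu> (v - w) < \<infinity>"
  shows "L2_norm (u - w) \<le> L2_norm (u - v) + L2_norm (v - w)" "L2_sq T \<mu> (u - w) < \<infinity>"
proof -
  have "u - w = (u - v) + (v - w)" by (simp add: fun_eq_iff)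
  then show "L2_norm (u - w) \<le> L2_norm (u - v) + L2_norm (v - w)" "L2_sq T \<mu> (u - w) < \<infinity>"
    using L2_add[OF paths_algebra(2) paths_algebra(2), of u v v w] assms by simp_all
qed

text \<open>Riesz--Fischer with a pathwise limit: summable norms make the energies of the increments
  summable after taking roots, almost surely. Roots of energies dominate suprema, so the M-test
  yields a continuous limit path.\<close>

lemma L2_complete:
  assumes u: "\<And>n. u n \<in> paths" and fin: "\<And>n. L2_sq T \<mu> (u (Suc n) - u n) < \<infinity>"
    and sum: "summable (\<lambda>n. L2_norm (u (Suc n) - u n))"
  obtains v where "v \<in> paths" "AE \<omega> in \<mu>. \<forall>t. (\<lambda>n. u n \<omega> t) \<longlonglongrightarrow> v \<omega> t"
    "\<And>n. L2_sq T \<mu> (u n - v) < \<infinity>" "(\<lambda>n. L2_norm (u n - v)) \<longlonglongrightarrow> 0"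
proof -
  define a where "a n = L2_norm (u (Suc n) - u n)" for n
  define e where "e n \<omega> = energy T (\<lambda>t. u (Suc n) \<omega> t - u n \<omega> t)" for n \<omega>
  define r where "r n \<omega> = sqrt (enn2real (e n \<omega>))" for n \<omega>
  have d: "u (Suc n) - u n \<in> paths" for n by (intro paths_algebra u)
  have e_eq: "e n \<omega> = energy T ((u (Suc n) - u n) \<omega>)" for n \<omega> by (simp add: e_def fun_diff_def)
  have e[measurable]: "e n \<in> borel_measurable \<mu>" for n
    unfolding e_eq[abs_def] by (rule energy_paths_measurable[OF d])
  have e_int: "(\<integral>\<^sup>+\<omega>. e n \<omega> \<partial>\<mu>) = ennreal ((a n)\<^sup>2)" for n
    using L2_sq_paths[OF d[of n]] L2_sq_L2_norm[OF fin[of n]] by (simp add: e_eq a_def)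
  have e_fin: "AE \<omega> in \<mu>. \<forall>n. e n \<omega> \<noteq> \<infinity>"
    unfolding AE_all_countable by (intro allI nn_integral_noteq_infinite) (auto simp: e_int)
  have r_int: "(\<integral>\<^sup>+\<omega>. ennreal (r n \<omega>) \<partial>\<mu>) \<le> ennreal (a n)" for n
  proof (rule ennreal_le_if_square_le)
    have "(\<integral>\<^sup>+\<omega>. ennreal (r n \<omega>) * 1 \<partial>\<mu>)\<^sup>2 \<le> (\<integral>\<^sup>+\<omega>. (ennreal (r n \<omega>))\<^sup>2 \<partial>\<mu>) * (\<integral>\<^sup>+\<omega>. 1\<^sup>2 \<partial>\<mu>)"
      unfolding r_def by (rule Cauchy_Schwarz_nn_integral) measurable
    also have "(\<integral>\<^sup>+\<omega>. (ennreal (r n \<omega>))\<^sup>2 \<partial>\<mu>) = (\<integral>\<^sup>+\<omega>. e n \<omega> \<partial>\<mu>)"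
      using e_fin by (intro nn_integral_cong_AE) (auto elim!: eventually_mono simp: r_def ennreal_power less_top)
    finally show "(\<integral>\<^sup>+\<omega>. ennreal (r n \<omega>) \<partial>\<mu>)\<^sup>2 \<le> ennreal ((a n)\<^sup>2)" by (simp add: e_int emeasure_mu)
  qed (simp add: a_def L2_norm_nonneg)
  have r[measurable]: "r n \<in> borel_measurable \<mu>" for n unfolding r_def[abs_def] by measurable
  define G where "G \<omega> \<longleftrightarrow> (\<forall>n. e n \<omega> \<noteq> \<infinity>) \<and> (\<Sum>n. ennreal (r n \<omega>)) \<noteq> \<infinity>" for \<omega>
  have [measurable]: "Measurable.pred \<mu> G" unfolding G_def by measurable
  have G: "AE \<omega> in \<mu>. G \<omega>"
  proof -
    have "(\<integral>\<^sup>+\<omega>. (\<Sum>n. ennreal (r n \<omega>)) \<partial>\<mu>) = (\<Sum>n. \<integral>\<^sup>+\<omega>. ennreal (r n \<omega>) \<partial>\<mu>)"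
      by (rule nn_integral_suminf) measurable
    also have "\<dots> \<le> (\<Sum>n. ennreal (a n))" by (intro suminf_le r_int) auto
    also have "\<dots> < \<infinity>"
      using sum by (subst suminf_ennreal2) (auto simp: a_def[abs_def] L2_norm_nonneg)
    finally have "(\<integral>\<^sup>+\<omega>. (\<Sum>n. ennreal (r n \<omega>)) \<partial>\<mu>) \<noteq> \<infinity>" by simp
    then have "AE \<omega> in \<mu>. (\<Sum>n. ennreal (r n \<omega>)) \<noteq> \<infinity>" by (intro nn_integral_noteq_infinite) measurable
    with e_fin show ?thesis by eventually_elim (simp add: G_def)
  qed
  \<comment> \<open>The zero path on the exceptional set makes \<open>v\<close> a measurable map
    into \<open>CT T\<close> everywhere, as membership in \<open>paths\<close> demands.\<close>
  define v where "v \<omega> = (if G \<omega> then (\<lambda>t. lim (\<lambda>n. u n \<omega> t)) else (\<lambda>_. 0))" for \<omega>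
  have good: "v \<omega> \<in> CT T" "\<And>t. (\<lambda>n. u n \<omega> t) \<longlonglongrightarrow> v \<omega> t" if w: "\<omega> \<in> CT T" and g: "G \<omega>" for \<omega>
  proof -
    have uC: "u n \<omega> \<in> CT T" for n using paths_CT[OF u w] .
    have summ: "summable (\<lambda>n. r n \<omega>)"
      using g by (intro summable_suminf_not_top) (auto simp: G_def r_def)
    have bound: "\<bar>u (Suc n) \<omega> t - u n \<omega> t\<bar> \<le> r n \<omega>" if t: "t \<in> T" for n t
    proof -
      have "ennreal ((u (Suc n) \<omega> t - u n \<omega> t)\<^sup>2) \<le> e n \<omega>"
        unfolding e_def by (rule eval_square_le_energy[OF CT_algebra(2)[OF uC uC] t])
      also have "\<dots> = ennreal (enn2real (e n \<omega>))" using g by (simp add: G_def less_top)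
      finally have "(u (Suc n) \<omega> t - u n \<omega> t)\<^sup>2 \<le> enn2real (e n \<omega>)" by (simp add: ennreal_le_iff)
      then show ?thesis unfolding r_def by (rule real_le_rsqrt[of "\<bar>_\<bar>", unfolded power2_abs])
    qed
    have "uniform_limit T (\<lambda>n t. \<Sum>i<n. u (Suc i) \<omega> t - u i \<omega> t) (\<lambda>t. \<Sum>i. u (Suc i) \<omega> t - u i \<omega> t) sequentially"
      by (rule Weierstrass_m_test[OF _ summ]) (simp add: bound)
    moreover have "(\<Sum>i<n. u (Suc i) \<omega> t - u i \<omega> t) = u n \<omega> t - u 0 \<omega> t" for n t
      by (rule sum_lessThan_telescope[of "\<lambda>i. u i \<omega> t"])
    ultimately have "uniform_limit T (\<lambda>n t. u n \<omega> t - u 0 \<omega> t) (\<lambda>t. \<Sum>i. u (Suc i) \<omega> t - u i \<omega> t) sequentially"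
      by simp
    from uniform_limit_add[OF this uniform_limit_const[of "\<lambda>t. u 0 \<omega> t" T sequentially]]
    have ul: "uniform_limit T (\<lambda>n t. u n \<omega> t) (\<lambda>t. (\<Sum>i. u (Suc i) \<omega> t - u i \<omega> t) + u 0 \<omega> t) sequentially"
      by simp
    have conv: "convergent (\<lambda>n. u n \<omega> t)" for t
    proof (cases "t \<in> T")
      case True
      then show ?thesis using tendsto_uniform_limitI[OF ul True] by (auto simp: convergent_def)
    next
      case False
      then have "u n \<omega> t = 0" for n using uC by (simp add: CT_def)
      then show ?thesis by (simp add: convergent_const)
    qed
    show lim: "(\<lambda>n. u n \<omega> t) \<longlonglongrightarrow> v \<omega> t" for t
      using conv[of t] g by (simp add: v_def convergent_LIMSEQ_iff)
    have "continuous_on T (\<lambda>t. (\<Sum>i. u (Suc i) \<omega> t - u i \<omega> t) + u 0 \<omega> t)"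
      by (rule uniform_limit_theorem[OF _ ul]) (use uC in \<open>auto simp: CT_def\<close>)
    then have "continuous_on T (v \<omega>)"
      by (rule continuous_on_eq) (rule LIMSEQ_unique[OF tendsto_uniform_limitI[OF ul] lim])
    moreover have "v \<omega> t = 0" if "t \<notin> T \<or> t = 0" for t
    proof -
      have "u n \<omega> t = 0" for n using uC[of n] that by (auto simp: CT_def)
      then show ?thesis using lim[of t] by (simp add: LIMSEQ_const_iff)
    qed
    ultimately show "v \<omega> \<in> CT T" by (simp add: CT_def)
  qed
  have v: "v \<in> paths"
  proof (rule measurable_CT)
    show "v \<omega> \<in> CT T" if "\<omega> \<in> space (borel_CT T)" for \<omega>
      using that good(1)[of \<omega>] zero_CT by (cases "G \<omega>") (auto simp: v_def)
    have [measurable]: "Measurable.pred (borel_CT T) G"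
      using \<open>Measurable.pred \<mu> G\<close> by (simp cong: measurable_cong_sets add: sets_mu)
    have [measurable]: "(\<lambda>\<omega>. u n \<omega> t) \<in> borel_measurable (borel_CT T)" for n t by (rule paths_eval[OF u])
    have "(\<lambda>\<omega>. if G \<omega> then lim (\<lambda>n. u n \<omega> (dense_seq i)) else 0) \<in> borel_measurable (borel_CT T)" for i
      by measurable
    also have "(\<lambda>\<omega>. if G \<omega> then lim (\<lambda>n. u n \<omega> (dense_seq i)) else 0) = (\<lambda>\<omega>. v \<omega> (dense_seq i))" for i
      by (auto simp: v_def)
    finally show "(\<lambda>\<omega>. v \<omega> (dense_seq i)) \<in> borel_measurable (borel_CT T)" for i .
  qed
  have lim: "AE \<omega> in \<mu>. \<forall>t. (\<lambda>n. u n \<omega> t) \<longlonglongrightarrow> v \<omega> t"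
    using G AE_space by eventually_elim (use good(2) in simp)
  define tail where "tail n = (\<Sum>i. a (i + n))" for n
  have a0: "0 \<le> a n" for n by (simp add: a_def L2_norm_nonneg)
  have suma: "summable a" using sum by (simp add: a_def[abs_def])
  have dist: "L2_sq T \<mu> (u n - u m) < \<infinity> \<and> L2_norm (u n - u m) \<le> (\<Sum>i<m - n. a (i + n))" if "n \<le> m" for n m
    using that
  proof (induction m rule: dec_induct)
    case base
    have "u n - u n = 0" by (simp add: fun_eq_iff)
    then have z: "L2_sq T \<mu> (u n - u n) = 0" by (simp only: L2_sq_zero)
    show ?case unfolding L2_norm_def z by simp
  next
    case (step m)
    have c: "L2_sq T \<mu> (u m - u (Suc m)) = L2_sq T \<mu> (u (Suc m) - u m)" by (rule L2_sq_diff_commute[OF u u])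
    then have am: "L2_norm (u m - u (Suc m)) = a m" unfolding a_def L2_norm_def by (rule arg_cong)
    have IH: "L2_sq T \<mu> (u n - u m) < \<infinity>" "L2_norm (u n - u m) \<le> (\<Sum>i<m - n. a (i + n))"
      using step by blast+
    have "(\<Sum>i<Suc m - n. a (i + n)) = (\<Sum>i<m - n. a (i + n)) + a m"
      using step(1) by (simp add: Suc_diff_le)
    moreover note L2_dist_triangle[OF u u u IH(1) fin[of m, folded c]]
    ultimately show ?case using IH(2) am by (intro conjI) linarith+
  qed
  \<comment> \<open>Two passages to the limit are combined: lower semicontinuity of the energy along
    each path and Fatou's lemma for the integral.\<close>
  have tail: "L2_sq T \<mu> (u n - v) \<le> ennreal ((tail n)\<^sup>2)" for n
  proof -
    have "L2_sq T \<mu> (u n - v) = (\<integral>\<^sup>+\<omega>. energy T (\<lambda>t. u n \<omega> t - v \<omega> t) \<partial>\<mu>)"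
      by (simp add: L2_sq_paths paths_algebra u v) (simp add: plus_fun_def fun_diff_def)
    also have "\<dots> \<le> (\<integral>\<^sup>+\<omega>. liminf (\<lambda>m. energy T ((u n - u m) \<omega>)) \<partial>\<mu>)"
      using lim
    proof (intro nn_integral_mono_AE, eventually_elim)
      case (elim \<omega>)
      show ?case unfolding fun_diff_def by (rule energy_lsc) (intro tendsto_diff tendsto_const elim[rule_format])
    qed
    also have "\<dots> \<le> liminf (\<lambda>m. \<integral>\<^sup>+\<omega>. energy T ((u n - u m) \<omega>) \<partial>\<mu>)"
      by (intro nn_integral_liminf energy_paths_measurable paths_algebra u)
    also have "\<dots> = liminf (\<lambda>m. L2_sq T \<mu> (u n - u m))"
      by (simp add: L2_sq_paths paths_algebra u)
    also have "\<dots> \<le> ennreal ((tail n)\<^sup>2)"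
    proof -
      have "L2_sq T \<mu> (u n - u m) \<le> ennreal ((tail n)\<^sup>2)" if "n \<le> m" for m
      proof -
        have "(\<Sum>i<m - n. a (i + n)) \<le> tail n"
          unfolding tail_def using suma a0 by (intro sum_le_suminf) (auto simp: summable_iff_shift)
        then show ?thesis
          using dist[OF that] L2_norm_nonneg[of "u n - u m"] L2_sq_L2_norm[of "u n - u m"]
          by (auto intro!: ennreal_leI power_mono)
      qed
      then have "eventually (\<lambda>m. L2_sq T \<mu> (u n - u m) \<le> ennreal ((tail n)\<^sup>2)) sequentially"
        by (auto simp: eventually_sequentially)
      then show ?thesis by (intro order_trans[OF Liminf_le_Limsup Limsup_bounded]) auto
    qed
    finally show ?thesis .
  qed
  have tail0: "tail \<longlonglongrightarrow> 0"
  proof -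
    have "(\<lambda>n. suminf a - (\<Sum>i<n. a i)) \<longlonglongrightarrow> suminf a - suminf a"
      by (intro tendsto_diff tendsto_const summable_LIMSEQ suma)
    then show ?thesis by (simp add: tail_def[abs_def] suminf_minus_initial_segment[OF suma])
  qed
  have bnd: "L2_norm (u n - v) \<le> tail n" for n
    using tail[of n] suma a0 by (intro L2_norm_le) (auto simp: tail_def summable_iff_shift intro!: suminf_nonneg)
  have "(\<lambda>n. L2_norm (u n - v)) \<longlonglongrightarrow> 0"
  proof (rule Lim_null_comparison[OF _ tail0])
    show "eventually (\<lambda>n. norm (L2_norm (u n - v)) \<le> tail n) sequentially"
      using bnd by (intro always_eventually allI) (simp only: real_norm_def abs_of_nonneg[OF L2_norm_nonneg])
  qed
  moreover have "L2_sq T \<mu> (u n - v) < \<infinity>" for n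
    by (rule le_less_trans[OF tail]) simp
  ultimately show ?thesis using v lim by (intro that)
qed

end

section \<open>Translations of Brownian motion\<close>

lemma sets_Collect_mem: "f \<in> N \<rightarrow>\<^sub>M R \<Longrightarrow> A \<in> sets R \<Longrightarrow> {x \<in> space N. f x \<in> A} \<in> sets N"
  using measurable_sets[of f N R A] by (simp add: vimage_def Int_def conj_commute)

lemma tendsto_coordinatewise:
  fixes f :: "'a \<Rightarrow> 'b \<Rightarrow> 'c::topological_space"
  assumes "\<And>i. ((\<lambda>x. f x i) \<longlongrightarrow> l i) F"
  shows "(f \<longlongrightarrow> l) F"
  using assms limitin_componentwise[of "\<lambda>_. euclidean" UNIV f l F]
  by (simp add: euclidean_product_topology limitin_canonical_iff)

lemma (in time_scaled) sampled_path_measurable: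
  assumes "standard_BM M B"
  shows "(\<lambda>p t. if t \<in> T then B t p else 0) \<in> M \<rightarrow>\<^sub>M borel_CT T"
proof (rule measurable_CT)
  fix p assume "p \<in> space M"
  then have B: "B 0 p = 0" "continuous_on {0..1} (\<lambda>t. B t p)" using assms by (auto simp: standard_BM_def)
  have "continuous_on T (\<lambda>t. B t p)"
    using T_facts(5,6) by (intro continuous_on_subset[OF B(2)]) auto
  then have "continuous_on T (\<lambda>t. if t \<in> T then B t p else 0)" by (rule continuous_on_eq) simp
  then show "(\<lambda>t. if t \<in> T then B t p else 0) \<in> CT T" using B(1) by (simp add: CT_def)
next
  show "(\<lambda>p. if dense_seq i \<in> T then B (dense_seq i) p else 0) \<in> borel_measurable M" for i
    using assms dense_seq(1)[of i] T_facts(5,6) by (simp add: standard_BM_def)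
qed

text \<open>The underlying Brownian motion on all of \<open>{0..1}\<close> is kept because the
  Girsanov formula is applied to its dyadic increments, whose times may lie in gaps of
  \<open>T\<close> and are then invisible to the sampled path.\<close>

locale brownian = path_measure T \<mu> + P: prob_space M
  for T :: "real set" and \<mu> :: "(real \<Rightarrow> real) measure" and M :: "'p measure" +
  fixes B :: "real \<Rightarrow> 'p \<Rightarrow> real"
  assumes BM: "standard_BM M B" and mu: "\<mu> = sampled_wiener T M B"
begin

lemma B_measurable: "0 \<le> t \<Longrightarrow> t \<le> 1 \<Longrightarrow> B t \<in> borel_measurable M"
  and B_0: "p \<in> space M \<Longrightarrow> B 0 p = 0"
  and B_cont: "p \<in> space M \<Longrightarrow> continuous_on {0..1} (\<lambda>t. B t p)"
  and B_dist: "0 \<le> s \<Longrightarrow> s < t \<Longrightarrow> t \<le> 1 \<Longrightarrow>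
     distributed M lborel (\<lambda>p. B t p - B s p) (normal_density 0 (sqrt (t - s)))"
  and B_indep: "mono \<tau> \<Longrightarrow> range \<tau> \<subseteq> {0..1} \<Longrightarrow>
     P.indep_vars (\<lambda>_. borel) (\<lambda>i p. B (\<tau> (Suc i)) p - B (\<tau> i) p) {..<n}"
  using BM unfolding standard_BM_def by auto

definition sample :: "'p \<Rightarrow> real \<Rightarrow> real" where
  "sample p = (\<lambda>t. if t \<in> T then B t p else 0)"

text \<open>The raw filtration, without null sets. Drifts adapted to the augmented filtration enter
  through versions.\<close>

definition past :: "real \<Rightarrow> 'p measure" where
  "past t = sigma (space M) {B s -` A \<inter> space M | s A. s \<in> {0..t} \<and> A \<in> sets borel}"

lemma space_past[simp]: "space (past t) = space M"
  unfolding past_def by (rule space_measure_of) auto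

lemma sets_past: "sets (past t) = sigma_sets (space M) {B s -` A \<inter> space M | s A. s \<in> {0..t} \<and> A \<in> sets borel}"
  unfolding past_def by (rule sets_measure_of) auto

lemma past_subalgebra: "t \<le> 1 \<Longrightarrow> subalgebra M (past t)"
  unfolding subalgebra_def sets_past using B_measurable
  by (auto intro!: sets.sigma_sets_subset measurable_sets)

lemma past_mono: "s \<le> t \<Longrightarrow> subalgebra (past t) (past s)"
  unfolding subalgebra_def sets_past space_past by (intro conjI refl sigma_sets_mono') force

lemma B_past: "0 \<le> s \<Longrightarrow> s \<le> t \<Longrightarrow> B s \<in> borel_measurable (past t)"
  by (rule measurableI) (auto simp: sets_past)

lemma sample_measurable[measurable]: "sample \<in> M \<rightarrow>\<^sub>M borel_CT T"
  unfolding sample_def[abs_def] by (rule sampled_path_measurable[OF BM])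

lemma sample_CT: "p \<in> space M \<Longrightarrow> sample p \<in> CT T"
  using measurable_space[OF sample_measurable] by simp

lemma mu_distr: "\<mu> = distr M (borel_CT T) sample"
  by (simp add: mu sampled_wiener_def sample_def[abs_def])

lemma AE_sample: "AE \<omega> in \<mu>. Q \<omega> \<Longrightarrow> AE p in M. Q (sample p)"
  by (rule AE_distrD[OF sample_measurable]) (simp only: mu_distr[symmetric])

lemma emeasure_sample: "A \<in> sets (borel_CT T) \<Longrightarrow> emeasure \<mu> A = emeasure M (sample -` A \<inter> space M)"
  by (subst mu_distr) (simp add: emeasure_distr)

text \<open>Cylinder events are events about the independent increments along the sorted evaluation times.\<close>

lemma cylinder_independent:
  assumes J: "finite J" "J \<subseteq> {0..t}" and A: "\<And>s. A s \<in> sets borel" and C: "C \<in> sets borel"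
    and t: "0 \<le> t" "t \<le> u" "u \<le> 1"
  defines "E \<equiv> {p \<in> space M. \<forall>s\<in>J. B s p \<in> A s}" and "D \<equiv> (\<lambda>p. B u p - B t p) -` C \<inter> space M"
  shows "P.prob (E \<inter> D) = P.prob E * P.prob D"
proof -
  \<comment> \<open>Time 0 lets every value of \<open>B\<close> be a sum of increments; time
    \<open>t\<close> makes the step to \<open>u\<close> the increment following all the
    others.\<close>
  define S where "S = insert 0 (insert t J)"
  define xs where "xs = sorted_list_of_set S"
  define N where "N = length xs - 1"
  \<comment> \<open>Constant equal to \<open>u\<close> beyond the list: the times stay monotone on
    all indices, and increment number \<open>N\<close> is the one from \<open>t\<close> to
    \<open>u\<close>.\<close>
  define \<tau> where "\<tau> i = (if i < length xs then xs ! i else u)" for i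
  have fS: "finite S" using J by (simp add: S_def)
  have xs: "set xs = S" "sorted xs" using fS by (auto simp: xs_def)
  have len: "length xs = Suc N" using xs(1) by (cases xs) (auto simp: N_def S_def)
  have S: "S \<subseteq> {0..t}" using J t by (auto simp: S_def)
  have nth: "xs ! i \<in> {0..t}" if "i \<le> N" for i
    using nth_mem[of i xs] xs(1) S that len by auto
  have mono: "mono \<tau>"
  proof (rule monoI)
    fix i j :: nat assume "i \<le> j"
    then show "\<tau> i \<le> \<tau> j"
      using sorted_nth_mono[OF xs(2), of i j] nth[of i] t len by (auto simp: \<tau>_def)
  qed
  have tau01: "\<tau> i \<in> {0..1}" for i
    using nth[of i] t len by (cases "i \<le> N") (auto simp: \<tau>_def)
  then have range: "range \<tau> \<subseteq> {0..1}" by auto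
  have idx: "\<exists>i\<le>N. \<tau> i = s" if "s \<in> S" for s
    using that xs(1) len by (auto simp: \<tau>_def in_set_conv_nth less_Suc_eq_le)
  then obtain k where k: "\<And>s. s \<in> S \<Longrightarrow> k s \<le> N" "\<And>s. s \<in> S \<Longrightarrow> \<tau> (k s) = s" by metis
  have tau0: "\<tau> 0 = 0"
    using k[of 0] monoD[OF mono, of 0 "k 0"] tau01[of 0] by (simp add: S_def)
  have tauN: "\<tau> N = t"
  proof (rule antisym)
    show "\<tau> N \<le> t" using nth[of N] len by (simp add: \<tau>_def)
    show "t \<le> \<tau> N" using k[of t] monoD[OF mono, of "k t" N] by (simp add: S_def)
  qed
  have tauS: "\<tau> (Suc N) = u" using len by (simp add: \<tau>_def)
  define X where "X i p = B (\<tau> (Suc i)) p - B (\<tau> i) p" for i p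
  have Bsum: "B (\<tau> m) p = (\<Sum>i<m. X i p)" if "p \<in> space M" for m p
    using sum_lessThan_telescope[of "\<lambda>i. B (\<tau> i) p" m] B_0[OF that] by (simp add: X_def tau0)
  have ind: "P.indep_vars (\<lambda>_. borel) X {..<Suc N}"
    unfolding X_def by (rule B_indep[OF mono range])
  let ?P1 = "PiM {..<N} (\<lambda>_. borel :: real measure)" and ?P2 = "PiM {N} (\<lambda>_. borel :: real measure)"
  have ind2: "P.indep_var ?P1 (\<lambda>p. \<lambda>i\<in>{..<N}. X i p) ?P2 (\<lambda>p. \<lambda>i\<in>{N}. X i p)"
    by (rule P.indep_var_restrict[OF ind]) auto
  define E' where "E' = {x \<in> space ?P1. \<forall>s\<in>J. (\<Sum>i<k s. x i) \<in> A s}"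
  define D' where "D' = {x \<in> space ?P2. x N \<in> C}"
  have JS: "J \<subseteq> S" by (auto simp: S_def)
  have [measurable]: "A s \<in> sets borel" "C \<in> sets borel" for s by (fact A, fact C)
  have sum_meas: "(\<lambda>x. \<Sum>i<k s. x i) \<in> borel_measurable ?P1" if "s \<in> J" for s
    using k(1)[of s] that JS by (intro borel_measurable_sum measurable_component_singleton) auto
  have E': "E' \<in> sets ?P1" unfolding E'_def using J(1)
    by (intro sets.sets_Collect_finite_All sets_Collect_mem[OF sum_meas A])
  have D': "D' \<in> sets ?P2" unfolding D'_def by measurable
  have Eeq: "(\<lambda>p. \<lambda>i\<in>{..<N}. X i p) -` E' \<inter> space M = E"
  proof -
    have "(\<Sum>i<k s. (\<lambda>i\<in>{..<N}. X i p) i) = B s p" if "s \<in> J" "p \<in> space M" for s p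
    proof -
      have s: "s \<in> S" using that JS by auto
      have "(\<Sum>i<k s. (\<lambda>i\<in>{..<N}. X i p) i) = (\<Sum>i<k s. X i p)"
        using k(1)[OF s] by (intro sum.cong) auto
      then show ?thesis using Bsum[OF that(2), of "k s"] k(2)[OF s] by simp
    qed
    then show ?thesis by (auto simp: E'_def E_def space_PiM)
  qed
  have Deq: "(\<lambda>p. \<lambda>i\<in>{N}. X i p) -` D' \<inter> space M = D"
    by (auto simp: D'_def D_def space_PiM X_def tauN tauS)
  have "P.prob ((\<lambda>p. (\<lambda>i\<in>{..<N}. X i p, \<lambda>i\<in>{N}. X i p)) -` (E' \<times> D') \<inter> space M) = P.prob E * P.prob D"
    using P.indep_varD[OF ind2 E' D'] Eeq Deq by simp
  moreover have "(\<lambda>p. (\<lambda>i\<in>{..<N}. X i p, \<lambda>i\<in>{N}. X i p)) -` (E' \<times> D') \<inter> space M = E \<inter> D"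
    using Eeq Deq by blast
  ultimately show ?thesis by simp
qed

text \<open>Finite-dimensional cylinder events are intersection-stable and generate the past, so
  independence extends from them by the pi-lambda theorem.\<close>

lemma increment_independent:
  assumes t: "0 \<le> t" "t \<le> u" "u \<le> 1"
  shows "P.independent_of (past t) borel (\<lambda>p. B u p - B t p)"
proof -
  define \<xi> where "\<xi> p = B u p - B t p" for p
  have [measurable]: "\<xi> \<in> borel_measurable M"
    unfolding \<xi>_def[abs_def] using B_measurable t by (intro borel_measurable_diff) auto
  define G where "G = {{p \<in> space M. \<forall>s\<in>J. B s p \<in> A s} | J A. finite J \<and> J \<subseteq> {0..t} \<and> (\<forall>s. A s \<in> sets borel)}"
  define D where "D = {\<xi> -` C \<inter> space M | C. C \<in> sets borel}"
  have GM: "G \<subseteq> P.events"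
  proof
    fix E assume "E \<in> G"
    then obtain J A where JA: "E = {p \<in> space M. \<forall>s\<in>J. B s p \<in> A s}" "finite J" "J \<subseteq> {0..t}" "\<And>s. A s \<in> sets borel"
      by (auto simp: G_def)
    have "{p \<in> space M. B s p \<in> A s} \<in> P.events" if "s \<in> J" for s
      using B_measurable[of s] JA(3) that t by (intro sets_Collect_mem[OF _ JA(4)]) auto
    then show "E \<in> P.events" unfolding JA(1) using JA(2) by (intro sets.sets_Collect_finite_All) auto
  qed
  have "Int_stable G"
  proof (rule Int_stableI)
    fix a b assume "a \<in> G" "b \<in> G"
    then obtain J A J' A' where a: "a = {p \<in> space M. \<forall>s\<in>J. B s p \<in> A s}" "finite J" "J \<subseteq> {0..t}" "\<And>s. A s \<in> sets borel"
      and b: "b = {p \<in> space M. \<forall>s\<in>J'. B s p \<in> A' s}" "finite J'" "J' \<subseteq> {0..t}" "\<And>s. A' s \<in> sets borel"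
      by (auto simp: G_def)
    define A'' where "A'' s = (if s \<in> J then A s else UNIV) \<inter> (if s \<in> J' then A' s else UNIV)" for s
    have "a \<inter> b = {p \<in> space M. \<forall>s\<in>J \<union> J'. B s p \<in> A'' s}"
      by (auto simp: a(1) b(1) A''_def)
    moreover have "A'' s \<in> sets borel" for s using a(4) b(4) by (simp add: A''_def)
    ultimately show "a \<inter> b \<in> G" unfolding G_def using a(2,3) b(2,3) by blast
  qed
  moreover have "Int_stable D"
  proof (rule Int_stableI)
    fix a b assume "a \<in> D" "b \<in> D"
    then obtain C C' where "a = \<xi> -` C \<inter> space M" "b = \<xi> -` C' \<inter> space M" "C \<in> sets borel" "C' \<in> sets borel"
      by (auto simp: D_def)
    then show "a \<inter> b \<in> D" unfolding D_def by (intro CollectI exI[of _ "C \<inter> C'"]) auto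
  qed
  moreover have "P.indep_set G D"
    unfolding P.indep_sets2_eq
  proof (intro conjI ballI GM)
    show "D \<subseteq> P.events" by (auto simp: D_def)
    fix a b assume "a \<in> G" "b \<in> D"
    then obtain J A C where "a = {p \<in> space M. \<forall>s\<in>J. B s p \<in> A s}" "b = (\<lambda>p. B u p - B t p) -` C \<inter> space M"
      and JA: "finite J" "J \<subseteq> {0..t}" "\<And>s. A s \<in> sets borel" "C \<in> sets borel"
      by (auto simp: G_def D_def \<xi>_def[abs_def])
    then show "P.prob (a \<inter> b) = P.prob a * P.prob b"
      by (simp only:) (rule cylinder_independent[OF JA t])
  qed
  ultimately have "P.indep_set (sigma_sets (space M) G) (sigma_sets (space M) D)"
    by (intro P.indep_set_sigma_sets)
  then have prod: "P.prob (a \<inter> b) = P.prob a * P.prob b" if "a \<in> sigma_sets (space M) G" "b \<in> D" for a b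
    using that unfolding P.indep_sets2_eq by blast
  have sub: "sets (past t) \<subseteq> sigma_sets (space M) G"
    unfolding sets_past
  proof (rule sigma_sets_mono, safe)
    fix s and A :: "real set" assume s: "s \<in> {0..t}" and A: "A \<in> sets borel"
    have "B s -` A \<inter> space M \<in> G"
    proof -
      have "B s -` A \<inter> space M = {p \<in> space M. \<forall>s'\<in>{s}. B s' p \<in> A}" by auto
      moreover have "finite {s}" "{s} \<subseteq> {0..t}" "\<forall>_::real. A \<in> sets borel" using s A by auto
      ultimately show ?thesis
        unfolding G_def mem_Collect_eq by (intro exI[of _ "{s}"] exI[of _ "\<lambda>_. A"] conjI)
    qed
    then show "B s -` A \<inter> space M \<in> sigma_sets (space M) G" by (rule sigma_sets.Basic)
  qed
  have "P.independent_of (past t) borel \<xi>"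
    unfolding P.independent_of_def
  proof (intro conjI ballI)
    show "subalgebra M (past t)" using t by (intro past_subalgebra) auto
    fix A C assume "A \<in> sets (past t)" "C \<in> sets (borel :: real measure)"
    then show "P.prob (A \<inter> (\<xi> -` C \<inter> space M)) = P.prob A * P.prob (\<xi> -` C \<inter> space M)"
      by (intro prod[OF subsetD[OF sub]]) (simp_all only: D_def mem_Collect_eq, blast)
  qed fact+
  then show ?thesis by (simp add: \<xi>_def[abs_def])
qed

text \<open>At every level the sampled values of \<open>B\<close> and of the delayed shift are one
  and the same function of the plain and of the drifted increments. \<open>girsanov_compare\<close>
  bounds both directions with the constant \<open>exp c\<close> at all levels, and
  \<open>absolutely_continuous_limit\<close> is applied twice.\<close>

lemma shift_equivalent:
  fixes H :: "real \<Rightarrow> 'p \<Rightarrow> real" and d :: "nat \<Rightarrow> real" and G :: "nat \<Rightarrow> 'p \<Rightarrow> real"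
  assumes H: "\<And>t. 0 \<le> t \<Longrightarrow> t \<le> 1 \<Longrightarrow> H t \<in> borel_measurable (past t)"
    and energy: "AE p in M. \<forall>n. (\<Sum>k<2 ^ n. (H (real (Suc k) / 2 ^ n) p - H (real k / 2 ^ n) p)\<^sup>2 * 2 ^ n) \<le> c"
    and d: "\<And>i. 0 \<le> d i" "\<And>i. d i \<le> 1"
    and G: "\<And>i. G i \<in> borel_measurable M"
    and lim: "AE p in M. \<forall>i. (\<lambda>n. if nat \<lfloor>d i * 2 ^ n\<rfloor> = 0 then 0
        else H (real (nat \<lfloor>d i * 2 ^ n\<rfloor> - 1) / 2 ^ n) p - H 0 p) \<longlonglongrightarrow> G i p"
    and A: "A \<in> sets (borel :: (nat \<Rightarrow> real) measure)"
  shows "emeasure M ((\<lambda>p i. B (d i) p) -` A \<inter> space M) = 0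
     \<longleftrightarrow> emeasure M ((\<lambda>p i. B (d i) p + G i p) -` A \<inter> space M) = 0"
proof -
  define \<kappa> where "\<kappa> n i = nat \<lfloor>d i * 2 ^ n\<rfloor>" for n i
  note \<kappa> = dyadic_floor(1,2)[OF d, folded \<kappa>_def] and \<kappa>le = dyadic_floor(3)[OF d, folded \<kappa>_def]
  have unit: "0 \<le> real k / 2 ^ n" "real k / 2 ^ n \<le> 1" if "k \<le> 2 ^ n" for k n
    using of_nat_mono[OF that, where 'a=real] by (auto simp: divide_le_eq)
  define \<delta> where "\<delta> n = 1 / (2::real) ^ n" for n :: nat
  define \<xi> where "\<xi> n j p = B (real (Suc j) / 2 ^ n) p - B (real j / 2 ^ n) p" for n j p
  \<comment> \<open>The delayed drift: at grid index \<open>k\<close> it uses \<open>H\<close> at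
    index \<open>k - 1\<close>, and it vanishes at indices 0 and 1. Its increment over cell
    \<open>j\<close> is thus known at the start of that cell.\<close>
  define K where "K n k p = (if k = 0 then 0 else H (real (k - 1) / 2 ^ n) p - H 0 p)" for n k p
  define b where "b n j p = (K n (Suc j) p - K n j p) * 2 ^ n" for n j p
  define F where "F n j = past (real j / 2 ^ n)" for n j
  have \<delta>0: "0 < \<delta> n" for n by (simp add: \<delta>_def)
  have frac_mono: "real i / 2 ^ n \<le> real j / 2 ^ n" if "i \<le> j" for i j n :: nat
    using that by (intro divide_right_mono) auto
  have frac_diff: "real (Suc j) / 2 ^ n - real j / 2 ^ n = \<delta> n" for j n
    by (simp add: \<delta>_def diff_divide_distrib[symmetric])
  have ind: "P.independent_of (F n j) borel (\<xi> n j)" if "j < 2 ^ n" for n j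
    unfolding F_def \<xi>_def using unit[of "Suc j" n] unit(1)[of j n] frac_mono[of j "Suc j" n] that
    by (intro increment_independent) auto
  have F: "subalgebra (F n j) (F n i)" if "i \<le> j" for n i j
    unfolding F_def by (rule past_mono) (rule frac_mono[OF that])
  have FM: "subalgebra M (F n j)" if "j \<le> 2 ^ n" for n j
    unfolding F_def by (rule past_subalgebra) (rule unit[OF that])
  have Bk: "B (real i / 2 ^ n) \<in> borel_measurable (F n j)" if "i \<le> j" "j \<le> 2 ^ n" for n i j
    unfolding F_def using frac_mono[of i j n] unit[of i n] that by (intro B_past) auto
  have \<xi>: "\<xi> n i \<in> borel_measurable (F n j)" if "i < j" "j \<le> 2 ^ n" for n i j
    unfolding \<xi>_def using that by (intro borel_measurable_diff Bk) auto
  have Hk: "H (real i / 2 ^ n) \<in> borel_measurable (F n j)" if "i \<le> j" "j \<le> 2 ^ n" for n i j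
    unfolding F_def using that frac_mono[of i j n] unit[of i n]
    by (intro measurable_from_subalg[OF past_mono H]) auto
  have K: "K n i \<in> borel_measurable (F n j)" if "i \<le> Suc j" "j \<le> 2 ^ n" for n i j
    unfolding K_def[abs_def] using that Hk[of "i - 1" j n] Hk[of 0 j n] by (cases "i = 0") auto
  have b: "b n j \<in> borel_measurable (F n j)" if "j < 2 ^ n" for n j
    unfolding b_def using that by (intro borel_measurable_times borel_measurable_diff K) auto
  have dist: "distributed M lborel (\<xi> n j) (normal_density 0 (sqrt (\<delta> n)))" if "j < 2 ^ n" for n j
  proof -
    have "real j / 2 ^ n < real (Suc j) / 2 ^ n" by (intro divide_strict_right_mono) auto
    then show ?thesis
      using B_dist[of "real j / 2 ^ n" "real (Suc j) / 2 ^ n"] unit[of "Suc j" n] unit(1)[of j n] that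
      unfolding \<xi>_def frac_diff by auto
  qed
  have bsum: "AE p in M. (\<Sum>j<2 ^ n. (b n j p)\<^sup>2 * \<delta> n) \<le> c" for n
    using energy
  proof eventually_elim
    case (elim p)
    let ?D = "\<lambda>k. (H (real (Suc k) / 2 ^ n) p - H (real k / 2 ^ n) p)\<^sup>2 * 2 ^ n"
    \<comment> \<open>The delay shifts indices by one: slope number \<open>k + 1\<close> carries the
      energy of \<open>H\<close> over cell \<open>k\<close>, slope 0 vanishes, and the last cell of
      \<open>H\<close> drops out.\<close>
    have bS: "(b n (Suc k) p)\<^sup>2 * \<delta> n = ?D k" for k
      by (simp add: b_def K_def \<delta>_def power_mult_distrib) (simp add: power2_eq_square)
    have b0: "b n 0 p = 0" by (simp add: b_def K_def)
    have "(\<Sum>j<Suc m. (b n j p)\<^sup>2 * \<delta> n) = (\<Sum>k<m. ?D k)" for m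
      unfolding sum.lessThan_Suc_shift by (simp add: b0 bS)
    then have "(\<Sum>j<m. (b n j p)\<^sup>2 * \<delta> n) = (\<Sum>k<m - 1. ?D k)" for m
      by (cases m) auto
    also have "(\<Sum>k<2 ^ n - 1. ?D k) \<le> (\<Sum>k<2 ^ n. ?D k)"
      by (intro sum_mono2) auto
    also have "\<dots> \<le> c" using elim by blast
    finally show ?case .
  qed
  \<comment> \<open>Partial sums recover the values at the rounded times from the increments; these
    are the functions to which the comparison is applied.\<close>
  define V where "V n x i = (\<Sum>j<\<kappa> n i. x j)" for n and x :: "nat \<Rightarrow> real" and i
  have V: "V n \<in> borel_measurable (PiM {..<2 ^ n} (\<lambda>_. borel))" for n
  proof (rule measurable_coordinatewise_then_product)
    show "(\<lambda>x. V n x i) \<in> borel_measurable (PiM {..<2 ^ n} (\<lambda>_. borel))" for i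
      unfolding V_def using \<kappa>le[of n i] by (intro borel_measurable_sum measurable_component_singleton) auto
  qed
  define Bn where "Bn n p i = B (real (\<kappa> n i) / 2 ^ n) p" for n p i
  define Yn where "Yn n p i = B (real (\<kappa> n i) / 2 ^ n) p + K n (\<kappa> n i) p" for n p i
  have VB: "V n (\<lambda>j\<in>{..<2 ^ n}. \<xi> n j p) = Bn n p" if p: "p \<in> space M" for n p
  proof
    fix i
    have "V n (\<lambda>j\<in>{..<2 ^ n}. \<xi> n j p) i = (\<Sum>j<\<kappa> n i. \<xi> n j p)"
      unfolding V_def using \<kappa>le[of n i] by (intro sum.cong) auto
    also have "\<dots> = Bn n p i"
      unfolding \<xi>_def Bn_def using sum_lessThan_telescope[of "\<lambda>j. B (real j / 2 ^ n) p" "\<kappa> n i"] B_0[OF p] by simp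
    finally show "V n (\<lambda>j\<in>{..<2 ^ n}. \<xi> n j p) i = Bn n p i" .
  qed
  have VY: "V n (\<lambda>j\<in>{..<2 ^ n}. \<xi> n j p + b n j p * \<delta> n) = Yn n p" if p: "p \<in> space M" for n p
  proof
    fix i
    have "V n (\<lambda>j\<in>{..<2 ^ n}. \<xi> n j p + b n j p * \<delta> n) i = (\<Sum>j<\<kappa> n i. \<xi> n j p) + (\<Sum>j<\<kappa> n i. b n j p * \<delta> n)"
      unfolding V_def sum.distrib[symmetric] using \<kappa>le[of n i] by (intro sum.cong) auto
    also have "(\<Sum>j<\<kappa> n i. \<xi> n j p) = B (real (\<kappa> n i) / 2 ^ n) p"
      unfolding \<xi>_def using sum_lessThan_telescope[of "\<lambda>j. B (real j / 2 ^ n) p" "\<kappa> n i"] B_0[OF p] by simp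
    also have "(\<Sum>j<\<kappa> n i. b n j p * \<delta> n) = (\<Sum>j<\<kappa> n i. K n (Suc j) p - K n j p)"
      by (simp add: b_def \<delta>_def)
    also have "\<dots> = K n (\<kappa> n i) p"
      using sum_lessThan_telescope[of "\<lambda>j. K n j p" "\<kappa> n i"] by (simp add: K_def[of n 0])
    finally show "V n (\<lambda>j\<in>{..<2 ^ n}. \<xi> n j p + b n j p * \<delta> n) i = Yn n p i" unfolding Yn_def .
  qed
  have le1: "(\<integral>\<^sup>+p. f (Yn n p) \<partial>M)\<^sup>2 \<le> ennreal (exp c) * (\<integral>\<^sup>+p. (f (Bn n p))\<^sup>2 \<partial>M)"
    and le2: "(\<integral>\<^sup>+p. f (Bn n p) \<partial>M)\<^sup>2 \<le> ennreal (exp c) * (\<integral>\<^sup>+p. (f (Yn n p))\<^sup>2 \<partial>M)"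
    if f: "f \<in> borel_measurable borel" for f :: "(nat \<Rightarrow> real) \<Rightarrow> ennreal" and n
  proof -
    have fV: "(\<lambda>x. f (V n x)) \<in> borel_measurable (PiM {..<2 ^ n} (\<lambda>_. borel))"
      by (rule measurable_compose[OF V f])
    have eqB: "(\<integral>\<^sup>+p. g (V n (\<lambda>j\<in>{..<2 ^ n}. \<xi> n j p)) \<partial>M) = (\<integral>\<^sup>+p. g (Bn n p) \<partial>M)" for g :: "(nat \<Rightarrow> real) \<Rightarrow> ennreal"
      by (intro nn_integral_cong) (simp add: VB)
    have eqY: "(\<integral>\<^sup>+p. g (V n (\<lambda>j\<in>{..<2 ^ n}. \<xi> n j p + b n j p * \<delta> n)) \<partial>M) = (\<integral>\<^sup>+p. g (Yn n p) \<partial>M)" for g :: "(nat \<Rightarrow> real) \<Rightarrow> ennreal"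
      by (intro nn_integral_cong) (simp add: VY)
    note cmp = P.girsanov_compare[where F="F n" and \<xi>="\<xi> n" and b="b n" and n="2 ^ n", OF \<delta>0 ind F _ b dist bsum fV]
    show "(\<integral>\<^sup>+p. f (Yn n p) \<partial>M)\<^sup>2 \<le> ennreal (exp c) * (\<integral>\<^sup>+p. (f (Bn n p))\<^sup>2 \<partial>M)"
      using cmp(1) \<xi> unfolding eqY[of f] eqB[of "\<lambda>x. (f x)\<^sup>2"] by simp
    show "(\<integral>\<^sup>+p. f (Bn n p) \<partial>M)\<^sup>2 \<le> ennreal (exp c) * (\<integral>\<^sup>+p. (f (Yn n p))\<^sup>2 \<partial>M)"
      using cmp(2) \<xi> unfolding eqB[of f] eqY[of "\<lambda>x. (f x)\<^sup>2"] by simp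
  qed
  have Bmeas: "B (d i) \<in> borel_measurable M" for i using d B_measurable by auto
  have mB: "(\<lambda>p i. B (d i) p) \<in> borel_measurable M"
    using Bmeas by (intro measurable_coordinatewise_then_product)
  have mY: "(\<lambda>p i. B (d i) p + G i p) \<in> borel_measurable M"
    using Bmeas G by (intro measurable_coordinatewise_then_product borel_measurable_add)
  have Bkm: "B (real (\<kappa> n i) / 2 ^ n) \<in> borel_measurable M" for n i
    using unit[OF \<kappa>le[of n i]] by (intro B_measurable)
  have Kkm: "K n (\<kappa> n i) \<in> borel_measurable M" for n i
    using measurable_from_subalg[OF FM K, of "2 ^ n" n "\<kappa> n i"] \<kappa>le[of n i] by simp
  have mBn: "Bn n \<in> borel_measurable M" for n
    unfolding Bn_def[abs_def] using Bkm by (intro measurable_coordinatewise_then_product)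
  have mYn: "Yn n \<in> borel_measurable M" for n
    unfolding Yn_def[abs_def] using Bkm Kkm by (intro measurable_coordinatewise_then_product borel_measurable_add)
  have \<kappa>lim: "(\<lambda>n. real (\<kappa> n i) / 2 ^ n) \<longlonglongrightarrow> d i" for i
  proof (rule tendsto_sandwich[OF _ _ _ tendsto_const])
    have "(\<lambda>n. d i - (1/2) ^ n) \<longlonglongrightarrow> d i - 0" by (intro tendsto_diff tendsto_const LIMSEQ_power_zero) auto
    then show "(\<lambda>n. d i - 1 / 2 ^ n) \<longlonglongrightarrow> d i" by (simp add: power_one_over)
  qed (use \<kappa> in \<open>auto intro!: always_eventually\<close>)
  have limB: "(\<lambda>n. B (real (\<kappa> n i) / 2 ^ n) p) \<longlonglongrightarrow> B (d i) p" if "p \<in> space M" for p i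
    by (rule continuous_on_tendsto_compose[OF B_cont[OF that] \<kappa>lim])
       (use d unit[OF \<kappa>le] in \<open>auto intro!: always_eventually\<close>)
  have cB: "AE p in M. (\<lambda>n. Bn n p) \<longlonglongrightarrow> (\<lambda>i. B (d i) p)"
    using AE_space
  proof eventually_elim
    case (elim p)
    show ?case unfolding Bn_def[abs_def] by (rule tendsto_coordinatewise) (rule limB[OF elim])
  qed
  have cY: "AE p in M. (\<lambda>n. Yn n p) \<longlonglongrightarrow> (\<lambda>i. B (d i) p + G i p)"
    using AE_space lim
  proof eventually_elim
    case (elim p)
    have "(\<lambda>n. K n (\<kappa> n i) p) \<longlonglongrightarrow> G i p" for i using elim(2) by (simp add: K_def \<kappa>_def)
    then show ?case unfolding Yn_def[abs_def]
      by (intro tendsto_coordinatewise tendsto_add limB elim)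
  qed
  show ?thesis
    using P.absolutely_continuous_limit[OF mY mB mYn mBn cY cB le1 A]
      P.absolutely_continuous_limit[OF mB mY mBn mYn cB cY le2 A] by blast
qed

end

section \<open>Bounded adapted drifts\<close>

lemma null_sets_completion_vimage:
  assumes g: "g \<in> space \<nu> \<rightarrow> space \<mu>"
    and null: "\<And>A. A \<in> null_sets \<mu> \<Longrightarrow> g -` A \<inter> space \<nu> \<in> null_sets \<nu>"
    and N: "N \<in> null_sets (completion \<mu>)"
  shows "g -` N \<inter> space \<nu> \<in> null_sets (completion \<nu>)"
proof -
  obtain A where "A \<in> null_sets \<mu>" "N \<subseteq> A" using N by (auto simp: null_sets_completion_iff2)
  then show ?thesis
    unfolding null_sets_completion_iff2 using null[of A] by (intro bexI[of _ "g -` A \<inter> space \<nu>"]) auto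
qed

text \<open>The augmented target contains negligible sets besides those of \<open>F\<close>, so
  \<open>g\<close> has to pull null sets back to null sets. This applies to translations by drifts
  and, under \<open>\<nu>\<close>, to \<open>X\<close>.\<close>

lemma measurable_aug_aug:
  assumes F: "space F = space \<mu>" "space F' = space \<nu>" and g: "g \<in> space \<nu> \<rightarrow> space \<mu>"
    and F': "\<And>A. A \<in> sets F \<Longrightarrow> g -` A \<inter> space \<nu> \<in> sets (aug \<nu> F')"
    and null: "\<And>A. A \<in> null_sets \<mu> \<Longrightarrow> g -` A \<inter> space \<nu> \<in> null_sets \<nu>"
  shows "g \<in> aug \<nu> F' \<rightarrow>\<^sub>M aug \<mu> F"
proof (rule measurable_sigma_sets[OF sets_aug[OF F(1)]])
  show "sets F \<union> null_sets (completion \<mu>) \<subseteq> Pow (space \<mu>)"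
    using sets.sets_into_space[of _ F] sets.sets_into_space[of _ "completion \<mu>"] F by (auto simp: null_sets_def)
  show "g \<in> space (aug \<nu> F') \<rightarrow> space \<mu>" using g F by simp
  fix y assume "y \<in> sets F \<union> null_sets (completion \<mu>)"
  then show "g -` y \<inter> space (aug \<nu> F') \<in> sets (aug \<nu> F')"
  proof
    assume "y \<in> null_sets (completion \<mu>)"
    from null_sets_completion_vimage[OF g null this] show ?thesis
      using sets_aug_superset(2)[OF F(2)] F(2) by auto
  qed (use F(2) F' in simp)
qed

context path_measure
begin

lemma space_sigma_upto[simp]: "space (sigma_upto T X t) = CT T"
  unfolding sigma_upto_def by (rule space_measure_of) auto

lemma sets_sigma_upto:
  "sets (sigma_upto T X t) = sigma_sets (CT T) {{\<omega> \<in> CT T. X \<omega> s \<in> A} | s A. s \<in> {0..t} \<inter> T \<and> A \<in> sets borel}"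
  unfolding sigma_upto_def by (rule sets_measure_of) auto

lemma sigma_upto_eval:
  assumes "s \<in> T" "s \<le> t"
  shows "(\<lambda>\<omega>. X \<omega> s) \<in> borel_measurable (sigma_upto T X t)"
proof (rule measurableI)
  fix A :: "real set" assume "A \<in> sets borel"
  moreover have "(\<lambda>\<omega>. X \<omega> s) -` A \<inter> CT T = {\<omega> \<in> CT T. X \<omega> s \<in> A}" by auto
  ultimately show "(\<lambda>\<omega>. X \<omega> s) -` A \<inter> space (sigma_upto T X t) \<in> sets (sigma_upto T X t)"
    unfolding space_sigma_upto sets_sigma_upto using assms T_facts(5)[OF assms(1)]
    by (intro sigma_sets.Basic) auto
qed simp

lemma Filt_mono:
  assumes "s \<le> t"
  shows "f \<in> borel_measurable (Filt T \<mu> s) \<Longrightarrow> f \<in> borel_measurable (Filt T \<mu> t)"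
proof -
  have "sets (sigma_upto T id s) \<subseteq> sets (sigma_upto T id t)"
    unfolding sets_sigma_upto using assms by (intro sigma_sets_mono') force
  then have "sets (Filt T \<mu> s) \<subseteq> sets (Filt T \<mu> t)"
    unfolding Filt_def by (simp add: sets_aug) (intro sigma_sets_mono', auto)
  then show "f \<in> borel_measurable (Filt T \<mu> s) \<Longrightarrow> f \<in> borel_measurable (Filt T \<mu> t)"
    by (auto simp: measurable_def Filt_def)
qed

lemma Filt_eval: "s \<in> T \<Longrightarrow> s \<le> t \<Longrightarrow> (\<lambda>\<omega>. \<omega> s) \<in> borel_measurable (Filt T \<mu> t)"
  unfolding Filt_def using sigma_upto_eval[of s t id] by (intro measurable_aug) simp_all

lemma L2_aD:
  assumes "h \<in> L2_a T \<mu>"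
  shows "h \<in> paths" "L2_sq T \<mu> h < \<infinity>" "\<And>t. t \<in> T \<Longrightarrow> (\<lambda>\<omega>. h \<omega> t) \<in> borel_measurable (Filt T \<mu> t)"
    "\<And>t. t \<in> right_scattered T \<Longrightarrow> (\<lambda>\<omega>. delta_deriv T (h \<omega>) t) \<in> borel_measurable (Filt T \<mu> t)"
  using assms by (auto simp: L2_a_def L2_def)

lemma L2_aI:
  assumes "h \<in> paths" "L2_sq T \<mu> h < \<infinity>" "\<And>t. t \<in> T \<Longrightarrow> (\<lambda>\<omega>. h \<omega> t) \<in> borel_measurable (Filt T \<mu> t)"
    "\<And>t. t \<in> right_scattered T \<Longrightarrow> (\<lambda>\<omega>. delta_deriv T (h \<omega>) t) \<in> borel_measurable (Filt T \<mu> t)"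
  shows "h \<in> L2_a T \<mu>"
  unfolding L2_a_def L2_def using assms by blast

lemma L2_AE_HT:
  assumes u: "u \<in> paths" and fin: "L2_sq T \<mu> u < \<infinity>"
  shows "AE \<omega> in \<mu>. u \<omega> \<in> HT T"
proof -
  have "AE \<omega> in \<mu>. energy T (u \<omega>) \<noteq> \<infinity>"
    using fin u by (intro nn_integral_noteq_infinite energy_paths_measurable) (simp_all add: L2_sq_paths)
  then show ?thesis
    using AE_space by eventually_elim (auto simp: HT_iff_energy less_top intro: paths_CT[OF u])
qed

lemma L2_a_combine:
  assumes u: "u \<in> L2_a T \<mu>" and v: "v \<in> L2_a T \<mu>"
  shows "(\<lambda>\<omega> t. a * u \<omega> t + b * v \<omega> t) \<in> L2_a T \<mu>"
proof -
  note u' = L2_aD[OF u] and v' = L2_aD[OF v]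
  have eq: "(\<lambda>\<omega> t. a * u \<omega> t + b * v \<omega> t) = path_scale a u + path_scale b v"
    by (simp add: path_scale_def plus_fun_def)
  have p: "path_scale a u \<in> paths" "path_scale b v \<in> paths" using u' v' path_scale_paths by blast+
  show ?thesis
  proof (rule L2_aI)
    show "(\<lambda>\<omega> t. a * u \<omega> t + b * v \<omega> t) \<in> paths" unfolding eq using p by (rule paths_algebra(1))
    show "L2_sq T \<mu> (\<lambda>\<omega> t. a * u \<omega> t + b * v \<omega> t) < \<infinity>"
      unfolding eq using u' v' by (intro L2_add(1) p) (simp_all add: L2_sq_scale ennreal_mult_less_top)
    show "(\<lambda>\<omega>. a * u \<omega> t + b * v \<omega> t) \<in> borel_measurable (Filt T \<mu> t)" if "t \<in> T" for t
      using u'(3)[OF that] v'(3)[OF that] by measurable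
    show "(\<lambda>\<omega>. delta_deriv T (\<lambda>t. a * u \<omega> t + b * v \<omega> t) t) \<in> borel_measurable (Filt T \<mu> t)"
      if t: "t \<in> right_scattered T" for t
      unfolding Filt_def
    proof (rule aug_AE_cong)
      show "(\<lambda>\<omega>. a * delta_deriv T (u \<omega>) t + b * delta_deriv T (v \<omega>) t) \<in> borel_measurable (aug \<mu> (sigma_upto T id t))"
        using u'(4)[OF t] v'(4)[OF t] unfolding Filt_def by measurable
      show "AE \<omega> in \<mu>. delta_deriv T (\<lambda>t. a * u \<omega> t + b * v \<omega> t) t = a * delta_deriv T (u \<omega>) t + b * delta_deriv T (v \<omega>) t"
        using L2_AE_HT[OF u'(1,2)] L2_AE_HT[OF v'(1,2)] by eventually_elim (rule delta_deriv_combine[OF _ _ t])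
    qed simp_all
  qed
qed

text \<open>The argument takes place in the set of adapted drifts with almost surely bounded energy: it is closed,
  convex and invariant, and translations by its members preserve the null sets.\<close>

definition bounded_drift :: "real \<Rightarrow> ((real \<Rightarrow> real) \<Rightarrow> (real \<Rightarrow> real)) set" where
  "bounded_drift c = {h \<in> L2_a T \<mu>. AE \<omega> in \<mu>. energy T (h \<omega>) \<le> ennreal c}"

text \<open>Convergence holds pathwise at all times, so the energy bound survives by lower
  semicontinuity. Adaptedness survives because augmented sigma-fields are closed under almost sure
  limits, and slopes at right-scattered points converge as difference quotients.\<close>

lemma bounded_drift_closed:
  assumes u: "\<And>n. u n \<in> bounded_drift c" and sum: "summable (\<lambda>n. L2_norm (u (Suc n) - u n))"
  obtains v where "v \<in> bounded_drift c" "(\<lambda>n. L2_norm (u n - v)) \<longlonglongrightarrow> 0"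
proof -
  have ua: "u n \<in> L2_a T \<mu>" and ue: "AE \<omega> in \<mu>. energy T (u n \<omega>) \<le> ennreal c" for n
    using u[of n] unfolding bounded_drift_def by blast+
  note u' = L2_aD[OF ua]
  obtain v where v: "v \<in> paths" "AE \<omega> in \<mu>. \<forall>t. (\<lambda>n. u n \<omega> t) \<longlonglongrightarrow> v \<omega> t"
    "\<And>n. L2_sq T \<mu> (u n - v) < \<infinity>" "(\<lambda>n. L2_norm (u n - v)) \<longlonglongrightarrow> 0"
    using L2_complete[OF u'(1) L2_diff[OF u'(1) u'(1) u'(2) u'(2)] sum] by blast
  have ve: "AE \<omega> in \<mu>. energy T (v \<omega>) \<le> ennreal c"
  proof -
    have "AE \<omega> in \<mu>. \<forall>n. energy T (u n \<omega>) \<le> ennreal c" unfolding AE_all_countable using ue by blast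
    with v(2) show ?thesis
    proof eventually_elim
      case (elim \<omega>)
      have "energy T (v \<omega>) \<le> liminf (\<lambda>n. energy T (u n \<omega>))" using elim(1) by (intro energy_lsc) auto
      also have "\<dots> \<le> ennreal c"
        using elim(2) by (intro order_trans[OF Liminf_le_Limsup Limsup_bounded]) auto
      finally show ?case .
    qed
  qed
  have vfin: "L2_sq T \<mu> v < \<infinity>"
  proof -
    have "L2_sq T \<mu> v \<le> (\<integral>\<^sup>+\<omega>. ennreal c \<partial>\<mu>)"
      unfolding L2_sq_paths[OF v(1)] using ve by (rule nn_integral_mono_AE)
    also have "\<dots> < \<infinity>" by (simp add: emeasure_mu)
    finally show ?thesis .
  qed
  have ev: "(\<lambda>\<omega>. v \<omega> t) \<in> borel_measurable (Filt T \<mu> t)" if "t \<in> T" for t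
    unfolding Filt_def
  proof (rule aug_AE_limit)
    show "(\<lambda>\<omega>. u n \<omega> t) \<in> borel_measurable (aug \<mu> (sigma_upto T id t))" for n
      using u'(3)[OF that] unfolding Filt_def .
    show "AE \<omega> in \<mu>. (\<lambda>n. u n \<omega> t) \<longlonglongrightarrow> v \<omega> t" using v(2) by eventually_elim auto
  qed simp
  have dd: "(\<lambda>\<omega>. delta_deriv T (v \<omega>) t) \<in> borel_measurable (Filt T \<mu> t)" if t: "t \<in> right_scattered T" for t
    unfolding Filt_def
  proof (rule aug_AE_limit)
    show "(\<lambda>\<omega>. delta_deriv T (u n \<omega>) t) \<in> borel_measurable (aug \<mu> (sigma_upto T id t))" for n
      using u'(4)[OF t] unfolding Filt_def .
    have "AE \<omega> in \<mu>. \<forall>n. u n \<omega> \<in> HT T" using L2_AE_HT[OF u'(1,2)] by (simp add: AE_all_countable)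
    with v(2) L2_AE_HT[OF v(1) vfin]
    show "AE \<omega> in \<mu>. (\<lambda>n. delta_deriv T (u n \<omega>) t) \<longlonglongrightarrow> delta_deriv T (v \<omega>) t"
    proof eventually_elim
      case (elim \<omega>)
      have "u n \<omega> \<in> HT T" for n using elim(3) by auto
      note ueq = delta_deriv_right_scattered[OF this t]
      show ?case unfolding delta_deriv_right_scattered[OF elim(2) t] ueq
        using elim(1) right_scattered_next(3)[OF t] by (intro tendsto_divide tendsto_diff tendsto_const) auto
    qed
  qed simp
  have "v \<in> bounded_drift c"
    unfolding bounded_drift_def using ve L2_aI[OF v(1) vfin ev dd] by blast
  then show ?thesis using v(4) by (rule that)
qed

end

section \<open>Translations by bounded drifts preserve null sets and adaptedness\<close>

context brownian
begin

lemma sample_past: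
  assumes "s \<le> t"
  shows "sample \<in> past t \<rightarrow>\<^sub>M sigma_upto T id s"
proof (rule measurable_sigma_sets[OF sets_sigma_upto])
  show "sample \<in> space (past t) \<rightarrow> CT T" using sample_CT by auto
  fix y assume "y \<in> {{\<omega> \<in> CT T. id \<omega> r \<in> A} | r A. r \<in> {0..s} \<inter> T \<and> A \<in> sets borel}"
  then obtain r and A :: "real set" where y: "y = {\<omega> \<in> CT T. \<omega> r \<in> A}" "r \<in> {0..s}" "r \<in> T" "A \<in> sets borel" by auto
  have "sample -` y \<inter> space M = B r -` A \<inter> space M"
    using sample_CT y(3) by (auto simp: y(1)) (auto simp: sample_def)
  also have "\<dots> \<in> sets (past t)" unfolding sets_past using y assms
    by (intro sigma_sets.Basic CollectI exI[of _ r] exI[of _ A] conjI refl) auto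
  finally show "sample -` y \<inter> space (past t) \<in> sets (past t)" by simp
qed auto

text \<open>A time in a gap has a right-scattered point below it, and value and slope there are
  measurable at that point. Adaptedness of the values alone would only give measurability at the
  right end of the gap.\<close>

lemma interpolate_adapted:
  assumes h: "h \<in> L2_a T \<mu>" and t: "0 \<le> t" "t \<le> 1"
  shows "(\<lambda>\<omega>. interpolate (h \<omega>) t) \<in> borel_measurable (Filt T \<mu> (down_T T t))"
proof (cases "t \<in> T")
  case True
  then show ?thesis using L2_aD(3)[OF h True] by (simp add: interpolate_T down_T_eq)
next
  case False
  show ?thesis
    unfolding interpolate_def
    using L2_aD(3)[OF h down_T(1)[OF t(1)]] L2_aD(4)[OF h down_T_right_scattered[OF t False]]
    by measurable
qed

text \<open>\<open>shift_equivalent\<close> for the times \<open>dense_seq\<close>, with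
  \<open>H\<close> the interpolated drift read along the sampled Brownian path. Its dyadic energies
  are bounded by the energy of the drift, also where dyadic times fall into gaps.\<close>

lemma translation_null_iff:
  assumes h: "h \<in> bounded_drift c" and A: "A \<in> sets (borel_CT T)"
  shows "emeasure \<mu> A = 0 \<longleftrightarrow> emeasure \<mu> ((id + h) -` A \<inter> CT T) = 0"
proof -
  have ha: "h \<in> L2_a T \<mu>" and he: "AE \<omega> in \<mu>. energy T (h \<omega>) \<le> ennreal c"
    using h unfolding bounded_drift_def by blast+
  note h' = L2_aD[OF ha]
  \<comment> \<open>Versions for the raw filtration are needed because \<open>past\<close> contains
    no null sets. Only the countably many dyadic times matter later, so a single exceptional set
    suffices.\<close>
  have "\<exists>f. f \<in> borel_measurable (sigma_upto T id (down_T T t)) \<and> (AE \<omega> in \<mu>. interpolate (h \<omega>) t = f \<omega>)"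
    if "0 \<le> t" "t \<le> 1" for t
    by (rule aug_version[OF _ interpolate_adapted[OF ha that, unfolded Filt_def]]) auto
  then obtain f where f: "\<And>t. 0 \<le> t \<Longrightarrow> t \<le> 1 \<Longrightarrow> f t \<in> borel_measurable (sigma_upto T id (down_T T t))"
    "\<And>t. 0 \<le> t \<Longrightarrow> t \<le> 1 \<Longrightarrow> AE \<omega> in \<mu>. interpolate (h \<omega>) t = f t \<omega>"
    by metis
  define H where "H t p = f t (sample p)" for t p
  have H: "H t \<in> borel_measurable (past t)" if "0 \<le> t" "t \<le> 1" for t
    unfolding H_def[abs_def] by (rule measurable_compose[OF sample_past[OF down_T(2)] f(1)]) (use that in auto)
  have unit: "0 \<le> real k / 2 ^ n" "real k / 2 ^ n \<le> 1" if "k \<le> 2 ^ n" for k n :: nat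
    using of_nat_mono[OF that, where 'a=real] by (auto simp: divide_le_eq)
  have "AE p in M. \<forall>n k. k \<le> 2 ^ n \<longrightarrow> interpolate (h (sample p)) (real k / 2 ^ n) = H (real k / 2 ^ n) p"
    unfolding AE_all_countable
  proof (intro allI)
    fix n k :: nat
    show "AE p in M. k \<le> 2 ^ n \<longrightarrow> interpolate (h (sample p)) (real k / 2 ^ n) = H (real k / 2 ^ n) p"
    proof (cases "k \<le> 2 ^ n")
      case True
      from AE_sample[OF f(2)[OF unit[OF True]]] show ?thesis
        by eventually_elim (simp add: H_def)
    qed simp
  qed
  moreover have "AE p in M. h (sample p) \<in> HT T" by (rule AE_sample[OF L2_AE_HT[OF h'(1,2)]])
  \<comment> \<open>\<open>c\<close> may be negative, in which case \<open>ennreal c\<close> is 0;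
    \<open>max c 0\<close> is the corresponding real bound.\<close>
  moreover have "AE p in M. energy T (h (sample p)) \<le> ennreal (max c 0)"
    using AE_sample[OF he] by eventually_elim (erule order_trans, simp add: ennreal_leI)
  ultimately have good: "AE p in M. h (sample p) \<in> HT T \<and> enn2real (energy T (h (sample p))) \<le> max c 0 \<and>
     (\<forall>n k. k \<le> 2 ^ n \<longrightarrow> H (real k / 2 ^ n) p = interpolate (h (sample p)) (real k / 2 ^ n))"
    by eventually_elim (auto intro: enn2real_leI)
  have energy: "AE p in M. \<forall>n. (\<Sum>k<2 ^ n. (H (real (Suc k) / 2 ^ n) p - H (real k / 2 ^ n) p)\<^sup>2 * 2 ^ n) \<le> max c 0"
    using good
  proof (eventually_elim, intro allI)
    fix p n
    assume g: "h (sample p) \<in> HT T \<and> enn2real (energy T (h (sample p))) \<le> max c 0 \<and>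
     (\<forall>n k. k \<le> 2 ^ n \<longrightarrow> H (real k / 2 ^ n) p = interpolate (h (sample p)) (real k / 2 ^ n))"
    define x where "x k = real k / 2 ^ n" for k
    have xd: "x (Suc k) - x k = 1 / 2 ^ n" for k by (simp add: x_def diff_divide_distrib[symmetric])
    have "(\<Sum>k<2 ^ n. (H (real (Suc k) / 2 ^ n) p - H (real k / 2 ^ n) p)\<^sup>2 * 2 ^ n)
      = (\<Sum>k<2 ^ n. (interpolate (h (sample p)) (x (Suc k)) - interpolate (h (sample p)) (x k))\<^sup>2 / (x (Suc k) - x k))"
    proof (rule sum.cong[OF refl])
      fix k assume k: "k \<in> {..<(2::nat) ^ n}"
      have Hx: "H (real j / 2 ^ n) p = interpolate (h (sample p)) (x j)" if "j \<le> 2 ^ n" for j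
        unfolding x_def using g[THEN conjunct2, THEN conjunct2, rule_format, OF that] .
      have "k \<le> 2 ^ n" "Suc k \<le> 2 ^ n" using k by auto
      then show "(H (real (Suc k) / 2 ^ n) p - H (real k / 2 ^ n) p)\<^sup>2 * 2 ^ n
        = (interpolate (h (sample p)) (x (Suc k)) - interpolate (h (sample p)) (x k))\<^sup>2 / (x (Suc k) - x k)"
        unfolding xd by (simp only: Hx) simp
    qed
    also have "\<dots> \<le> enn2real (energy T (h (sample p)))"
      using g by (intro interpolate_energy_le) (auto simp: x_def intro!: monoI divide_right_mono)
    also have "\<dots> \<le> max c 0" using g by simp
    finally show "(\<Sum>k<2 ^ n. (H (real (Suc k) / 2 ^ n) p - H (real k / 2 ^ n) p)\<^sup>2 * 2 ^ n) \<le> max c 0" .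
  qed
  have d01: "0 \<le> dense_seq i" "dense_seq i \<le> 1" for i using dense_seq(1)[of i] T_facts(5,6) by auto
  have lim: "AE p in M. \<forall>i. (\<lambda>n. if nat \<lfloor>dense_seq i * 2 ^ n\<rfloor> = 0 then 0
        else H (real (nat \<lfloor>dense_seq i * 2 ^ n\<rfloor> - 1) / 2 ^ n) p - H 0 p) \<longlonglongrightarrow> h (sample p) (dense_seq i)"
    using good
  proof (eventually_elim, intro allI)
    fix p i
    assume g: "h (sample p) \<in> HT T \<and> enn2real (energy T (h (sample p))) \<le> max c 0 \<and>
     (\<forall>n k. k \<le> 2 ^ n \<longrightarrow> H (real k / 2 ^ n) p = interpolate (h (sample p)) (real k / 2 ^ n))"
    let ?h = "h (sample p)" and ?d = "dense_seq i" and ?c = "max c 0"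
    note hHT = g[THEN conjunct1] and gc = g[THEN conjunct2, THEN conjunct1]
      and gH = g[THEN conjunct2, THEN conjunct2, rule_format]
    have "?h \<in> CT T" using hHT[unfolded HT_iff_energy] by (rule conjunct1)
    then have "?h 0 = 0" by (simp add: CT_def)
    then have i0: "interpolate ?h 0 = 0" using T_facts(3) by (simp add: interpolate_T)
    have H0: "H 0 p = 0" using gH[of 0 0] i0 by simp
    define \<kappa> where "\<kappa> n = nat \<lfloor>?d * 2 ^ n\<rfloor>" for n
    note \<kappa> = dyadic_floor[OF d01[of i], folded \<kappa>_def]
    define K where "K n = (if \<kappa> n = 0 then 0 else H (real (\<kappa> n - 1) / 2 ^ n) p - H 0 p)" for n
    have incr: "(interpolate ?h t - interpolate ?h s)\<^sup>2 \<le> (t - s) * ?c" if "0 \<le> s" "s \<le> t" "t \<le> 1" for s t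
      using that by (intro order_trans[OF interpolate_diff_square_le[OF hHT that]] mult_left_mono gc) auto
    \<comment> \<open>Rounding down and the delay each cost at most one cell, whence the factor 2.
      At index 0 there is no delay, and the time itself is at most one cell long.\<close>
    have bound: "(?h ?d - K n)\<^sup>2 \<le> (2 * ?c) * (1/2) ^ n" for n
    proof (cases "\<kappa> n = 0")
      case True
      have "(?h ?d - K n)\<^sup>2 \<le> (?d - 0) * ?c"
        using incr[of 0 ?d] d01[of i] dense_seq(1)[of i] True i0 by (simp add: interpolate_T K_def)
      also have "\<dots> \<le> (2 * (1 / 2 ^ n)) * ?c"
      proof (rule mult_right_mono)
        have "0 < 1 / (2::real) ^ n" by simp
        moreover have "?d \<le> 1 / 2 ^ n" using \<kappa>(2)[of n] True by simp
        ultimately show "?d - 0 \<le> 2 * (1 / 2 ^ n)" by linarith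
      qed simp
      finally show ?thesis by (simp add: power_one_over mult_ac)
    next
      case False
      let ?s = "real (\<kappa> n - 1) / 2 ^ n"
      have s: "?s = real (\<kappa> n) / 2 ^ n - 1 / 2 ^ n" using False by (simp add: of_nat_diff diff_divide_distrib)
      have s': "0 \<le> ?s" "?s \<le> ?d" "?d - ?s \<le> 2 * (1 / 2 ^ n)" proof -
        have "0 < 1 / (2::real) ^ n" by simp
        then show "?s \<le> ?d" "?d - ?s \<le> 2 * (1 / 2 ^ n)" using \<kappa>(1,2)[of n] s by linarith+
        show "0 \<le> ?s" by simp
      qed
      have "\<kappa> n - 1 \<le> 2 ^ n" using \<kappa>(3)[of n] by linarith
      then have Hs: "H ?s p = interpolate ?h ?s" by (rule gH)
      have "K n = interpolate ?h ?s" unfolding K_def Hs H0 using False by (simp only: if_False diff_0_right)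
      then have "(?h ?d - K n)\<^sup>2 \<le> (?d - ?s) * ?c"
        using incr[of ?s ?d] s' d01[of i] dense_seq(1)[of i] by (simp add: interpolate_T)
      also have "\<dots> \<le> (2 * (1 / 2 ^ n)) * ?c" using s' by (intro mult_right_mono) auto
      finally show ?thesis by (simp add: power_one_over mult_ac)
    qed
    have "(\<lambda>n. (2 * ?c) * (1/2) ^ n) \<longlonglongrightarrow> (2 * ?c) * 0"
      by (intro tendsto_mult tendsto_const LIMSEQ_power_zero) auto
    then have c0: "(\<lambda>n. (2 * ?c) * (1/2) ^ n) \<longlonglongrightarrow> 0" by (simp only: mult_zero_right)
    have "eventually (\<lambda>n. norm ((?h ?d - K n)\<^sup>2) \<le> (2 * ?c) * (1/2) ^ n) sequentially"
      using bound by (intro always_eventually allI) (simp only: real_norm_def abs_power2)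
    then have "(\<lambda>n. (?h ?d - K n)\<^sup>2) \<longlonglongrightarrow> 0" using c0 by (rule Lim_null_comparison)
    then have "(\<lambda>n. sqrt ((?h ?d - K n)\<^sup>2)) \<longlonglongrightarrow> sqrt 0" by (rule tendsto_real_sqrt)
    then have "(\<lambda>n. ?h ?d - K n) \<longlonglongrightarrow> 0" by (simp add: tendsto_rabs_zero_iff)
    then have "(\<lambda>n. ?h ?d - (?h ?d - K n)) \<longlonglongrightarrow> ?h ?d - 0" by (rule tendsto_diff[OF tendsto_const])
    then show "(\<lambda>n. if nat \<lfloor>dense_seq i * 2 ^ n\<rfloor> = 0 then 0
        else H (real (nat \<lfloor>dense_seq i * 2 ^ n\<rfloor> - 1) / 2 ^ n) p - H 0 p) \<longlonglongrightarrow> ?h ?d"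
      unfolding K_def[abs_def, symmetric, unfolded \<kappa>_def] by simp
  qed
  obtain A' :: "(nat \<Rightarrow> real) set" where A': "A' \<in> sets borel" "A = (\<lambda>\<omega> i. \<omega> (dense_seq i)) -` A' \<inter> CT T"
    by (rule sets_borel_CT_vimage[OF A])
  have Gm: "(\<lambda>p. h (sample p) (dense_seq i)) \<in> borel_measurable M" for i
    by (rule measurable_compose[OF sample_measurable paths_eval[OF h'(1)]])
  have sd: "sample p (dense_seq i) = B (dense_seq i) p" for p i
    using dense_seq(1) by (simp add: sample_def)
  have idh: "id + h \<in> paths" by (rule paths_algebra(1)[OF id_paths h'(1)])
  have "sample p \<in> A \<longleftrightarrow> (\<lambda>i. B (dense_seq i) p) \<in> A'" if "p \<in> space M" for p
    unfolding A'(2) using sample_CT[OF that] by (simp only: Int_iff vimage_eq sd simp_thms)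
  then have "sample -` A \<inter> space M = (\<lambda>p i. B (dense_seq i) p) -` A' \<inter> space M" by blast
  then have 1: "emeasure \<mu> A = emeasure M ((\<lambda>p i. B (dense_seq i) p) -` A' \<inter> space M)"
    unfolding emeasure_sample[OF A] by (rule arg_cong)
  have inA: "(id + h) -` A \<inter> CT T \<in> sets (borel_CT T)" using measurable_sets[OF idh A] by simp
  have "(id + h) (sample p) \<in> A \<longleftrightarrow> (\<lambda>i. B (dense_seq i) p + h (sample p) (dense_seq i)) \<in> A'" if "p \<in> space M" for p
    unfolding A'(2) using paths_CT[OF idh sample_CT[OF that]]
    by (simp only: Int_iff vimage_eq simp_thms) (simp add: sd)
  then have "sample -` ((id + h) -` A \<inter> CT T) \<inter> space M
      = (\<lambda>p i. B (dense_seq i) p + h (sample p) (dense_seq i)) -` A' \<inter> space M"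
    using sample_CT by blast
  then have 2: "emeasure \<mu> ((id + h) -` A \<inter> CT T)
      = emeasure M ((\<lambda>p i. B (dense_seq i) p + h (sample p) (dense_seq i)) -` A' \<inter> space M)"
    unfolding emeasure_sample[OF inA] by (rule arg_cong)
  show ?thesis
    unfolding 1 2 by (rule shift_equivalent[OF H energy d01 Gm lim A'(1)])
qed

lemma translation_measure:
  assumes h: "h \<in> bounded_drift c"
  shows "A \<in> null_sets \<mu> \<Longrightarrow> (id + h) -` A \<inter> space \<mu> \<in> null_sets \<mu>"
proof -
  have "h \<in> paths" using h L2_aD(1) unfolding bounded_drift_def by blast
  then have idh: "id + h \<in> paths" by (rule paths_algebra(1)[OF id_paths])
  assume A: "A \<in> null_sets \<mu>"
  then have A': "A \<in> sets (borel_CT T)" "emeasure \<mu> A = 0" by (simp_all add: null_sets_def sets_mu)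
  then show ?thesis
    using translation_null_iff[OF h A'(1)] measurable_sets[OF idh A'(1)] by (simp add: null_sets_def sets_mu)
qed

lemma AE_translation:
  assumes h: "h \<in> bounded_drift c" and Q: "AE \<omega> in \<mu>. Q \<omega>"
  shows "AE \<omega> in \<mu>. Q ((id + h) \<omega>)"
proof -
  have hp: "h \<in> paths" using h L2_aD(1) unfolding bounded_drift_def by blast
  have idh: "id + h \<in> paths" by (rule paths_algebra(1)[OF id_paths hp])
  obtain N where N: "N \<in> null_sets \<mu>" "{\<omega> \<in> space \<mu>. \<not> Q \<omega>} \<subseteq> N"
    using Q by (auto simp: eventually_ae_filter)
  show ?thesis
  proof (rule AE_I'[OF translation_measure[OF h N(1)]], safe)
    fix \<omega> assume w: "\<omega> \<in> space \<mu>" and "\<not> Q ((id + h) \<omega>)"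
    moreover have "(id + h) \<omega> \<in> CT T" using paths_CT[OF idh] w by simp
    ultimately have "(id + h) \<omega> \<in> N" using N(2) by auto
    then show "\<omega> \<in> (id + h) -` N" by blast
  qed
qed

text \<open>Up to time \<open>t\<close> the translated path is adapted, and its preimages of null
  sets are null. The translation is therefore measurable from the augmented sigma-field at time
  \<open>t\<close> into itself.\<close>

lemma adapted_translation:
  assumes h: "h \<in> bounded_drift c" and f: "f \<in> borel_measurable (Filt T \<mu> t)"
  shows "(\<lambda>\<omega>. f ((id + h) \<omega>)) \<in> borel_measurable (Filt T \<mu> t)"
proof -
  have ha: "h \<in> L2_a T \<mu>" using h unfolding bounded_drift_def by blast
  note hp = L2_aD(1)[OF ha]
  have idh: "id + h \<in> paths" by (rule paths_algebra(1)[OF id_paths hp])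
  have idhC: "(id + h) \<omega> \<in> CT T" if "\<omega> \<in> CT T" for \<omega> by (rule paths_CT[OF idh that])
  have "id + h \<in> Filt T \<mu> t \<rightarrow>\<^sub>M Filt T \<mu> t"
    unfolding Filt_def
  proof (rule measurable_aug_aug)
    have "id + h \<in> aug \<mu> (sigma_upto T id t) \<rightarrow>\<^sub>M sigma_upto T id t"
    proof (rule measurable_sigma_sets[OF sets_sigma_upto])
      fix y assume "y \<in> {{\<omega> \<in> CT T. id \<omega> s \<in> A} | s A. s \<in> {0..t} \<inter> T \<and> A \<in> sets borel}"
      then obtain s and A :: "real set" where y: "y = {\<omega> \<in> CT T. \<omega> s \<in> A}" "s \<le> t" "s \<in> T" "A \<in> sets borel" by auto
      have "(\<lambda>\<omega>. \<omega> s + h \<omega> s) \<in> borel_measurable (Filt T \<mu> t)"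
        using Filt_eval[OF y(3,2)] Filt_mono[OF y(2) L2_aD(3)[OF ha y(3)]] by measurable
      from measurable_sets[OF this y(4)]
      have "(\<lambda>\<omega>. \<omega> s + h \<omega> s) -` A \<inter> CT T \<in> sets (aug \<mu> (sigma_upto T id t))" by (simp add: Filt_def)
      moreover have "(id + h) -` y \<inter> CT T = (\<lambda>\<omega>. \<omega> s + h \<omega> s) -` A \<inter> CT T"
        using idhC by (auto simp: y(1))
      ultimately show "(id + h) -` y \<inter> space (aug \<mu> (sigma_upto T id t)) \<in> sets (aug \<mu> (sigma_upto T id t))" by simp
    qed (use idhC in auto)
    from measurable_sets[OF this]
    show "(id + h) -` A \<inter> space \<mu> \<in> sets (aug \<mu> (sigma_upto T id t))" if "A \<in> sets (sigma_upto T id t)" for A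
      using that by simp
    show "(id + h) -` A \<inter> space \<mu> \<in> null_sets \<mu>" if "A \<in> null_sets \<mu>" for A
      by (rule translation_measure[OF h that])
  qed (use idhC in auto)
  from measurable_compose[OF this f] show ?thesis .
qed

lemma bounded_drift_translation:
  assumes h: "h \<in> bounded_drift c" and \<theta>: "\<theta> \<in> bounded_drift c"
  shows "\<theta> \<circ> (id + h) \<in> bounded_drift c"
proof -
  have ha: "h \<in> L2_a T \<mu>" and ta: "\<theta> \<in> L2_a T \<mu>" and te: "AE \<omega> in \<mu>. energy T (\<theta> \<omega>) \<le> ennreal c"
    using h \<theta> unfolding bounded_drift_def by blast+
  note hp = L2_aD(1)[OF ha] and tp = L2_aD(1)[OF ta]
  have idh: "id + h \<in> paths" by (rule paths_algebra(1)[OF id_paths hp])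
  have p: "\<theta> \<circ> (id + h) \<in> paths" by (rule measurable_comp[OF idh tp])
  have e: "AE \<omega> in \<mu>. energy T ((\<theta> \<circ> (id + h)) \<omega>) \<le> ennreal c"
    using AE_translation[OF h te] by (simp only: o_def)
  have "L2_sq T \<mu> (\<theta> \<circ> (id + h)) \<le> (\<integral>\<^sup>+\<omega>. ennreal c \<partial>\<mu>)"
    unfolding L2_sq_paths[OF p] using e by (rule nn_integral_mono_AE)
  also have "\<dots> < \<infinity>" by (simp add: emeasure_mu)
  finally have fin: "L2_sq T \<mu> (\<theta> \<circ> (id + h)) < \<infinity>" .
  have "\<theta> \<circ> (id + h) \<in> L2_a T \<mu>"
  proof (rule L2_aI[OF p fin])
    show "(\<lambda>\<omega>. (\<theta> \<circ> (id + h)) \<omega> t) \<in> borel_measurable (Filt T \<mu> t)" if "t \<in> T" for t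
      using adapted_translation[OF h L2_aD(3)[OF ta that]] by (simp only: o_def)
    show "(\<lambda>\<omega>. delta_deriv T ((\<theta> \<circ> (id + h)) \<omega>) t) \<in> borel_measurable (Filt T \<mu> t)" if "t \<in> right_scattered T" for t
      using adapted_translation[OF h L2_aD(4)[OF ta that]] by (simp only: o_def)
  qed
  with e show ?thesis unfolding bounded_drift_def by blast
qed

lemma kappa_eq:
  "kappa (id + \<theta>) h = (\<lambda>\<omega> t. (- 1) * h \<omega> t + (- 1) * (\<theta> \<circ> (id + h)) \<omega> t)"
  by (simp add: kappa_def fun_eq_iff)

lemma kappa_L2_a:
  assumes "h \<in> bounded_drift c" "\<theta> \<in> bounded_drift c"
  shows "kappa (id + \<theta>) h \<in> L2_a T \<mu>"
  unfolding kappa_eq using assms(1) bounded_drift_translation[OF assms] unfolding bounded_drift_def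
  by (intro L2_a_combine) blast+

lemma bounded_drift_step:
  assumes h: "h \<in> bounded_drift c" and \<theta>: "\<theta> \<in> bounded_drift c" and \<epsilon>: "0 < \<epsilon>" "\<epsilon> \<le> 1" and c: "0 \<le> c"
  shows "h + path_scale \<epsilon> (kappa (id + \<theta>) h) \<in> bounded_drift c"
proof -
  let ?\<psi> = "\<theta> \<circ> (id + h)"
  have eq: "h + path_scale \<epsilon> (kappa (id + \<theta>) h) = (\<lambda>\<omega> t. (1 - \<epsilon>) * h \<omega> t + (- \<epsilon>) * ?\<psi> \<omega> t)"
    unfolding kappa_eq path_scale_def by (simp add: fun_eq_iff algebra_simps)
  have \<psi>: "?\<psi> \<in> bounded_drift c" by (rule bounded_drift_translation[OF h \<theta>])
  have "(\<lambda>\<omega> t. (1 - \<epsilon>) * h \<omega> t + (- \<epsilon>) * ?\<psi> \<omega> t) \<in> L2_a T \<mu>"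
    using h \<psi> unfolding bounded_drift_def by (intro L2_a_combine) blast+
  moreover have "AE \<omega> in \<mu>. energy T (\<lambda>t. (1 - \<epsilon>) * h \<omega> t + (- \<epsilon>) * ?\<psi> \<omega> t) \<le> ennreal c"
  proof -
    have "AE \<omega> in \<mu>. energy T (h \<omega>) \<le> ennreal c" "AE \<omega> in \<mu>. energy T (?\<psi> \<omega>) \<le> ennreal c"
      using h \<psi> unfolding bounded_drift_def by blast+
    then show ?thesis
    proof eventually_elim
      case (elim \<omega>)
      have "energy T (\<lambda>t. (1 - \<epsilon>) * h \<omega> t + \<epsilon> * - ?\<psi> \<omega> t)
        \<le> ennreal (1 - \<epsilon>) * energy T (h \<omega>) + ennreal \<epsilon> * energy T (\<lambda>t. - ?\<psi> \<omega> t)"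
        using \<epsilon> by (intro energy_convex) auto
      also have "\<dots> \<le> ennreal (1 - \<epsilon>) * ennreal c + ennreal \<epsilon> * ennreal c"
        unfolding energy_uminus using elim by (intro add_mono mult_left_mono) auto
      also have "\<dots> = ennreal ((1 - \<epsilon>) * c + \<epsilon> * c)"
        using \<epsilon> c by (simp add: ennreal_mult ennreal_plus)
      also have "(1 - \<epsilon>) * c + \<epsilon> * c = c" by (simp add: algebra_simps)
      finally show ?case by (simp only: mult_minus_left mult_minus_right)
    qed
  qed
  ultimately show ?thesis unfolding eq bounded_drift_def by blast
qed

lemma Linf_a_bounded_drift:
  assumes "\<theta> \<in> Linf_a T \<mu>"
  obtains c where "0 \<le> c" "\<theta> \<in> bounded_drift c"
proof -
  obtain c where c: "0 < c" "AE \<omega> in \<mu>. HT_norm T (\<theta> \<omega>) < ennreal c" and ta: "\<theta> \<in> L2_a T \<mu>"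
    using assms unfolding Linf_a_def by blast
  have "AE \<omega> in \<mu>. energy T (\<theta> \<omega>) \<le> ennreal (c\<^sup>2)"
    using c(2) AE_space
  proof eventually_elim
    case (elim \<omega>)
    have "\<theta> \<omega> \<in> CT T" using paths_CT[OF L2_aD(1)[OF ta]] elim(2) by simp
    then have "energy T (\<theta> \<omega>) = (HT_norm T (\<theta> \<omega>))\<^sup>2" by (rule HT_norm_square[symmetric])
    also have "\<dots> \<le> (ennreal c)\<^sup>2" using elim(1) by (intro power_mono) auto
    finally show ?case using c(1) by (simp add: ennreal_power)
  qed
  then have "\<theta> \<in> bounded_drift (c\<^sup>2)" using ta unfolding bounded_drift_def by blast
  then show ?thesis by (intro that[of "c\<^sup>2"]) auto
qed

lemma zero_bounded_drift: "0 \<in> bounded_drift c"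
proof -
  have d0: "delta_deriv T (\<lambda>_. 0) t = 0" if t: "t \<in> right_scattered T" for t
  proof -
    have "(\<lambda>_. 0) \<in> HT T" by (simp add: HT_iff_energy energy_zero zero_CT)
    from delta_deriv_right_scattered[OF this t] show ?thesis by simp
  qed
  have "0 \<in> L2_a T \<mu>"
  proof (rule L2_aI[OF zero_paths])
    show "L2_sq T \<mu> 0 < \<infinity>" unfolding L2_sq_zero by simp
    show "(\<lambda>\<omega>. (0 :: (real \<Rightarrow> real) \<Rightarrow> real \<Rightarrow> real) \<omega> t) \<in> borel_measurable (Filt T \<mu> t)" for t
      unfolding zero_fun_def by simp
    show "(\<lambda>\<omega>. delta_deriv T (0 \<omega>) t) \<in> borel_measurable (Filt T \<mu> t)" if "t \<in> right_scattered T" for t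
      unfolding zero_fun_def d0[OF that] by simp
  qed
  moreover have "AE \<omega> in \<mu>. energy T (0 \<omega>) \<le> ennreal c" unfolding zero_fun_def energy_zero by simp
  ultimately show ?thesis unfolding bounded_drift_def by blast
qed

section \<open>Existence of a drift on which kappa vanishes\<close>

text \<open>A step moves by \<open>\<epsilon>\<close> times the norm of \<open>kappa X x\<close> and
  decreases that norm by at least \<open>(1 - sqrt K) * \<epsilon>\<close> times itself. The ratio
  is the constant \<open>1 / (1 - sqrt K)\<close>, independent of \<open>\<epsilon>\<close>, which
  is what the Caristi order requires.\<close>

lemma ex_kappa_zero:
  fixes \<theta> X :: "(real \<Rightarrow> real) \<Rightarrow> (real \<Rightarrow> real)" and K :: real
  assumes \<theta>: "\<theta> \<in> bounded_drift c" and c: "0 \<le> c" and X: "X = id + \<theta>"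
    and cont: "continuous_L2_a T \<mu> (kappa X)" and K: "0 \<le> K" "K < 1"
    and contr: "\<forall>h\<in>L2_a T \<mu>. \<exists>\<epsilon>. 0 < \<epsilon> \<and> \<epsilon> \<le> 1 \<and>
           L2_sq T \<mu> ((X \<circ> (id + (h + path_scale \<epsilon> (kappa X h)))) - (X \<circ> (id + h))
                     - path_scale \<epsilon> (kappa X h))
             \<le> ennreal (K * \<epsilon>\<^sup>2) * L2_sq T \<mu> (kappa X h)"
  shows "\<exists>h\<in>bounded_drift c. L2_norm (kappa X h) = 0"
proof (rule Caristi_zero[where d="\<lambda>x y. L2_norm (x - y)" and C="1 / (1 - sqrt K)"])
  have ba: "h \<in> L2_a T \<mu>" if "h \<in> bounded_drift c" for h using that unfolding bounded_drift_def by blast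
  note bp = L2_aD(1)[OF ba] and bf = L2_aD(2)[OF ba]
  have ka: "kappa X h \<in> L2_a T \<mu>" if "h \<in> bounded_drift c" for h
    unfolding X by (rule kappa_L2_a[OF that \<theta>])
  note kp = L2_aD(1)[OF ka] and kf = L2_aD(2)[OF ka]
  have sK: "0 \<le> sqrt K" "sqrt K < 1" using K by auto
  show "0 \<in> bounded_drift c" by (rule zero_bounded_drift)
  show "0 \<le> 1 / (1 - sqrt K)" using sK by simp
  show "0 \<le> L2_norm (kappa X x)" "0 \<le> L2_norm (x - y)" for x y by (rule L2_norm_nonneg)+
  show "L2_norm (x - x) = 0" for x
  proof -
    have "x - x = 0" by (simp add: fun_eq_iff)
    then have "L2_sq T \<mu> (x - x) = 0" by (simp only: L2_sq_zero)
    then show ?thesis unfolding L2_norm_def by (simp only: enn2real_0 real_sqrt_zero)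
  qed
  show "L2_norm (x - z) \<le> L2_norm (x - y) + L2_norm (y - z)"
    if "x \<in> bounded_drift c" "y \<in> bounded_drift c" "z \<in> bounded_drift c" for x y z
    by (intro L2_dist_triangle(1) bp L2_diff bf that)
  show "\<exists>y\<in>bounded_drift c. L2_norm (kappa X y) < L2_norm (kappa X x)
      \<and> L2_norm (x - y) \<le> 1 / (1 - sqrt K) * (L2_norm (kappa X x) - L2_norm (kappa X y))"
    if x: "x \<in> bounded_drift c" and pos: "0 < L2_norm (kappa X x)" for x
  proof -
    obtain \<epsilon> where \<epsilon>: "0 < \<epsilon>" "\<epsilon> \<le> 1" and le: "L2_sq T \<mu> ((X \<circ> (id + (x + path_scale \<epsilon> (kappa X x)))) - (X \<circ> (id + x))
                     - path_scale \<epsilon> (kappa X x)) \<le> ennreal (K * \<epsilon>\<^sup>2) * L2_sq T \<mu> (kappa X x)"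
      using contr ba[OF x] by blast
    define y where "y = x + path_scale \<epsilon> (kappa X x)"
    define R where "R = (X \<circ> (id + y)) - (X \<circ> (id + x)) - path_scale \<epsilon> (kappa X x)"
    have y: "y \<in> bounded_drift c" unfolding y_def X by (rule bounded_drift_step[OF x \<theta> \<epsilon> c])
    let ?a = "L2_norm (kappa X x)"
    have kx: "path_scale s (kappa X x) \<in> paths" for s by (rule path_scale_paths[OF kp[OF x]])
    \<comment> \<open>The expression in condition (ii) is exactly the deviation of
      \<open>kappa X y\<close> from \<open>(1 - \<epsilon>)\<close> times \<open>kappa X x\<close>;
      since \<open>X\<close> composed with a translation is the identity minus \<open>kappa\<close>,
      no expansion error occurs.\<close>
    have Req: "R = path_scale (1 - \<epsilon>) (kappa X x) - kappa X y"
      unfolding R_def by (auto simp: kappa_def path_scale_def fun_eq_iff algebra_simps)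
    have Rp: "R \<in> paths" unfolding Req by (rule paths_algebra(2)[OF kx kp[OF y]])
    have "L2_sq T \<mu> R \<le> ennreal (K * \<epsilon>\<^sup>2) * ennreal (?a\<^sup>2)"
      using le unfolding R_def y_def L2_sq_L2_norm[OF kf[OF x]] .
    also have "\<dots> = ennreal ((sqrt K * \<epsilon> * ?a)\<^sup>2)"
      using K by (simp add: power_mult_distrib flip: ennreal_mult)
    finally have Rle: "L2_sq T \<mu> R \<le> ennreal ((sqrt K * \<epsilon> * ?a)\<^sup>2)" .
    then have Rf: "L2_sq T \<mu> R < \<infinity>" by (rule le_less_trans) simp
    have Rn: "L2_norm R \<le> sqrt K * \<epsilon> * ?a"
      using Rle sK \<epsilon> by (intro L2_norm_le mult_nonneg_nonneg L2_norm_nonneg) auto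
    have sf: "L2_sq T \<mu> (path_scale s (kappa X x)) < \<infinity>" for s
      using kf[OF x] by (simp add: L2_sq_scale[OF kp[OF x]] ennreal_mult_less_top)
    have Rn': "L2_norm (path_scale (- 1) R) = L2_norm R" by (simp add: L2_norm_scale[OF Rp])
    have Rp': "path_scale (- 1) R \<in> paths" by (rule path_scale_paths[OF Rp])
    have Rf': "L2_sq T \<mu> (path_scale (- 1) R) < \<infinity>"
      using Rf by (simp add: L2_sq_scale[OF Rp])
    have keq: "kappa X y = path_scale (1 - \<epsilon>) (kappa X x) + path_scale (- 1) R"
      unfolding Req by (auto simp: path_scale_def fun_eq_iff)
    have "L2_norm (kappa X y) \<le> L2_norm (path_scale (1 - \<epsilon>) (kappa X x)) + L2_norm (path_scale (- 1) R)"
      unfolding keq by (rule L2_add(2)[OF kx Rp' sf Rf'])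
    also have "\<dots> \<le> (1 - \<epsilon>) * ?a + sqrt K * \<epsilon> * ?a"
      unfolding Rn' using Rn \<epsilon> by (simp add: L2_norm_scale[OF kp[OF x]])
    finally have ky: "L2_norm (kappa X y) \<le> ?a - \<epsilon> * (1 - sqrt K) * ?a" by (simp add: algebra_simps)
    have "x - y = path_scale (- \<epsilon>) (kappa X x)" unfolding y_def by (auto simp: path_scale_def fun_eq_iff)
    then have "L2_norm (x - y) = \<bar>- \<epsilon>\<bar> * ?a" by (simp only: L2_norm_scale[OF kp[OF x]])
    then have dxy: "L2_norm (x - y) = \<epsilon> * ?a" using \<epsilon> by simp
    have p: "0 < \<epsilon> * (1 - sqrt K) * ?a" using \<epsilon> sK pos by (intro mult_pos_pos) auto
    have lt: "L2_norm (kappa X y) < ?a" using ky p by linarith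
    have "(1 - sqrt K) * L2_norm (x - y) \<le> ?a - L2_norm (kappa X y)"
      using ky unfolding dxy by (simp add: algebra_simps)
    then have "L2_norm (x - y) \<le> 1 / (1 - sqrt K) * (?a - L2_norm (kappa X y))"
      using sK by (simp add: field_simps)
    with lt y show ?thesis by blast
  qed
  show "\<exists>x\<in>bounded_drift c. (\<lambda>n. L2_norm (s n - x)) \<longlonglongrightarrow> 0"
    if s: "\<And>n. s n \<in> bounded_drift c" and sum: "summable (\<lambda>n. L2_norm (s n - s (Suc n)))" for s
  proof -
    have "L2_norm (s n - s (Suc n)) = L2_norm (s (Suc n) - s n)" for n
      unfolding L2_norm_def by (simp only: L2_sq_diff_commute[OF bp[OF s] bp[OF s]])
    then have "summable (\<lambda>n. L2_norm (s (Suc n) - s n))" using sum by (simp only:)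
    from bounded_drift_closed[OF s this] show ?thesis by blast
  qed
  \<comment> \<open>Continuity of the operator gives convergence of \<open>kappa X (s n)\<close> in
    L2; the reverse triangle inequality transfers it to the norms.\<close>
  show "(\<lambda>n. L2_norm (kappa X (s n))) \<longlonglongrightarrow> L2_norm (kappa X x)"
    if s: "\<And>n. s n \<in> bounded_drift c" and x: "x \<in> bounded_drift c" and lim: "(\<lambda>n. L2_norm (s n - x)) \<longlonglongrightarrow> 0" for s x
  proof (rule LIMSEQ_I)
    fix e :: real assume e: "0 < e"
    obtain d where d: "0 < d" "\<And>k. k \<in> L2_a T \<mu> \<Longrightarrow> L2_sq T \<mu> (k - x) < ennreal (d\<^sup>2) \<Longrightarrow>
        L2_sq T \<mu> (kappa X k - kappa X x) < ennreal (e\<^sup>2)"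
      using cont ba[OF x] e unfolding continuous_L2_a_def by blast
    obtain N where N: "\<And>n. N \<le> n \<Longrightarrow> L2_norm (s n - x) < d"
      using order_tendstoD(2)[OF lim d(1)] by (auto simp: eventually_sequentially)
    have "norm (L2_norm (kappa X (s n)) - L2_norm (kappa X x)) < e" if n: "N \<le> n" for n
    proof -
      have fin: "L2_sq T \<mu> (s n - x) < \<infinity>" by (rule L2_diff[OF bp[OF s] bp[OF x] bf[OF s] bf[OF x]])
      have "L2_sq T \<mu> (s n - x) < ennreal (d\<^sup>2)"
        unfolding L2_sq_L2_norm[OF fin] using N[OF n] L2_norm_nonneg d(1)
        by (intro ennreal_lessI power_strict_mono) auto
      then have lt: "L2_sq T \<mu> (kappa X (s n) - kappa X x) < ennreal (e\<^sup>2)" by (rule d(2)[OF ba[OF s]])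
      have fk: "L2_sq T \<mu> (kappa X (s n) - kappa X x) < \<infinity>"
        by (rule L2_diff[OF kp[OF s] kp[OF x] kf[OF s] kf[OF x]])
      have "L2_norm (kappa X (s n) - kappa X x) < e"
      proof -
        have "(L2_norm (kappa X (s n) - kappa X x))\<^sup>2 < e\<^sup>2"
          using lt unfolding L2_sq_L2_norm[OF fk] by (subst (asm) ennreal_less_iff) auto
        then show ?thesis using e by (intro power2_less_imp_less[of _ e]) auto
      qed
      moreover have "L2_norm (kappa X x - kappa X (s n)) = L2_norm (kappa X (s n) - kappa X x)"
        unfolding L2_norm_def by (simp only: L2_sq_diff_commute[OF kp[OF s] kp[OF x]])
      moreover have tri: "L2_norm (kappa X u) \<le> L2_norm (kappa X u - kappa X v) + L2_norm (kappa X v)"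
        if "u \<in> bounded_drift c" "v \<in> bounded_drift c" for u v
      proof -
        have "kappa X u = (kappa X u - kappa X v) + kappa X v" by (simp add: fun_eq_iff)
        then show ?thesis
          using L2_add(2)[OF paths_algebra(2)[OF kp[OF that(1)] kp[OF that(2)]] kp[OF that(2)]
            L2_diff[OF kp[OF that(1)] kp[OF that(2)] kf[OF that(1)] kf[OF that(2)]] kf[OF that(2)]] by (simp only:)
      qed
      ultimately show ?thesis
        using tri[OF s[of n] x] tri[OF x s[of n]] unfolding real_norm_def by linarith
    qed
    then show "\<exists>N. \<forall>n\<ge>N. norm (L2_norm (kappa X (s n)) - L2_norm (kappa X x)) < e" by blast
  qed
qed

end

section \<open>From the right inverse to the generating sampled Brownian motion\<close>

context brownian
begin

lemma energy_eq_zeroD: "u \<in> CT T \<Longrightarrow> energy T u = 0 \<Longrightarrow> u = (\<lambda>_. 0)"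
proof (rule CT_eqI[OF _ zero_CT])
  assume u: "u \<in> CT T" "energy T u = 0"
  show "u t = 0" if "t \<in> T" for t
    using eval_square_le_energy[OF u(1) that] u(2) by simp
qed

text \<open>\<open>X\<close> is the identity plus an adapted drift, so it generates no more than the
  canonical filtration. Conversely the path is recovered as \<open>X\<close> plus \<open>h\<close>
  evaluated along \<open>X\<close>, which uses \<open>X\<close> only up to the present time because
  \<open>h\<close> is adapted.\<close>

lemma generating_of_right_inverse:
  assumes h: "h \<in> bounded_drift c" and \<theta>: "\<theta> \<in> bounded_drift c" and X: "X = id + \<theta>"
    and inv: "AE \<omega> in \<mu>. X ((id + h) \<omega>) = \<omega>"
  defines "\<nu> \<equiv> distr \<mu> (borel_CT T) (id + h)"
  shows "prob_space \<nu>" "sets \<nu> = sets (borel_CT T)" "absolutely_continuous \<mu> \<nu>" "absolutely_continuous \<nu> \<mu>"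
    "generating_sampled_BM T \<mu> \<nu> X"
proof -
  have ha: "h \<in> L2_a T \<mu>" and ta: "\<theta> \<in> L2_a T \<mu>" using h \<theta> unfolding bounded_drift_def by blast+
  note hp = L2_aD(1)[OF ha] and tp = L2_aD(1)[OF ta]
  have idh: "id + h \<in> paths" by (rule paths_algebra(1)[OF id_paths hp])
  have Xp: "X \<in> paths" unfolding X by (rule paths_algebra(1)[OF id_paths tp])
  have idh_mu: "id + h \<in> \<mu> \<rightarrow>\<^sub>M borel_CT T" using idh by (simp only: measurable_cong_sets[OF sets_mu refl])
  have X_mu: "X \<in> \<mu> \<rightarrow>\<^sub>M borel_CT T" using Xp by (simp only: measurable_cong_sets[OF sets_mu refl])
  show prob: "prob_space \<nu>" unfolding \<nu>_def by (rule prob_space_distr[OF idh_mu])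
  show sets: "sets \<nu> = sets (borel_CT T)" unfolding \<nu>_def by (rule sets_distr)
  have space: "space \<nu> = CT T" using sets_eq_imp_space_eq[OF sets] by simp
  have nu: "emeasure \<nu> A = emeasure \<mu> ((id + h) -` A \<inter> CT T)" if "A \<in> sets (borel_CT T)" for A
    unfolding \<nu>_def emeasure_distr[OF idh_mu that] by simp
  have null: "null_sets \<nu> = null_sets \<mu>"
    using nu translation_null_iff[OF h] by (auto simp only: null_sets_def sets sets_mu)
  show "absolutely_continuous \<mu> \<nu>" "absolutely_continuous \<nu> \<mu>" unfolding absolutely_continuous_def null by auto
  have nullc: "null_sets (completion \<nu>) = null_sets (completion \<mu>)"
    unfolding set_eq_iff null_sets_completion_iff2 null by blast
  \<comment> \<open>The two measures have the same null sets, so adaptedness known under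
    \<open>\<mu>\<close> can be used verbatim under \<open>\<nu>\<close>.\<close>
  have Filt_eq: "Filt T \<nu> t = Filt T \<mu> t" for t
    unfolding Filt_def aug_def nullc space space_mu by (rule refl)
  have X_nu: "X \<in> \<nu> \<rightarrow>\<^sub>M borel_CT T" using Xp by (simp only: measurable_cong_sets[OF sets refl])
  have "distr \<nu> (borel_CT T) X = distr \<mu> (borel_CT T) (X \<circ> (id + h))"
    unfolding \<nu>_def by (rule distr_distr[OF Xp idh_mu])
  also have "\<dots> = distr \<mu> (borel_CT T) (\<lambda>\<omega>. \<omega>)"
    using inv measurable_comp[OF idh_mu Xp] by (intro distr_cong_AE) (simp_all add: o_def sets_mu measurable_ident_sets)
  also have "\<dots> = \<mu>" by (rule distr_id2) (rule sets_mu[symmetric])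
  finally have law: "distr \<nu> (borel_CT T) X = \<mu>" .
  \<comment> \<open>The law of \<open>X\<close> under \<open>\<nu>\<close> is \<open>\<mu>\<close>,
    so \<open>X\<close> carries the \<open>\<mu>\<close>-augmentation of the canonical filtration
    back into the \<open>\<nu>\<close>-augmentation of its own.\<close>
  have null_X: "X -` A \<inter> space \<nu> \<in> null_sets \<nu>" if A: "A \<in> null_sets \<mu>" for A
  proof -
    have A': "A \<in> sets (borel_CT T)" "emeasure \<mu> A = 0" using A by (simp_all add: null_sets_def sets_mu)
    have "emeasure \<nu> (X -` A \<inter> space \<nu>) = emeasure (distr \<nu> (borel_CT T) X) A"
      by (rule emeasure_distr[OF X_nu A'(1), symmetric])
    also have "\<dots> = 0" unfolding law by (rule A'(2))
    finally show ?thesis using measurable_sets[OF X_nu A'(1)] by (simp add: null_sets_def)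
  qed
  have XC: "X \<omega> \<in> CT T" if "\<omega> \<in> CT T" for \<omega> by (rule paths_CT[OF Xp that])
  have "sets (GFilt T \<nu> X t) = sets (Filt T \<nu> t)" if t: "t \<in> T" for t
  proof
    have sX: "space (sigma_upto T X t) = space \<nu>" and sid: "space (sigma_upto T id t) = space \<nu>"
      and sid': "space (sigma_upto T id t) = space \<mu>" by (simp_all add: space)
    have spF: "space (Filt T \<nu> t) = space \<nu>" unfolding Filt_def by (rule space_aug[OF sid])
    have spG: "space (GFilt T \<nu> X t) = space \<nu>" unfolding GFilt_def by (rule space_aug[OF sX])
    show "sets (GFilt T \<nu> X t) \<subseteq> sets (Filt T \<nu> t)"
    proof -
      have "sets (sigma_upto T X t) \<subseteq> sets (Filt T \<nu> t)"
        unfolding sets_sigma_upto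
      proof (rule sets.sigma_sets_subset[of _ "Filt T \<nu> t", unfolded spF space], rule subsetI)
        fix y assume "y \<in> {{\<omega> \<in> CT T. X \<omega> s \<in> A} | s A. s \<in> {0..t} \<inter> T \<and> A \<in> sets borel}"
        then obtain s and A :: "real set" where y: "y = {\<omega> \<in> CT T. X \<omega> s \<in> A}" "s \<le> t" "s \<in> T" "A \<in> sets borel" by auto
        have "(\<lambda>\<omega>. \<omega> s + \<theta> \<omega> s) \<in> borel_measurable (Filt T \<mu> t)"
          using Filt_eval[OF y(3,2)] Filt_mono[OF y(2) L2_aD(3)[OF ta y(3)]] by measurable
        then have "(\<lambda>\<omega>. X \<omega> s) \<in> borel_measurable (Filt T \<nu> t)" unfolding Filt_eq X by simp
        from sets_Collect_mem[OF this y(4)] show "y \<in> sets (Filt T \<nu> t)" unfolding y(1) spF space .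
      qed
      then show ?thesis
        unfolding GFilt_def sets_aug[OF sX]
        using sets_aug_superset(2)[OF sid, folded Filt_def]
        by (intro sets.sigma_sets_subset[of _ "Filt T \<nu> t", unfolded spF] Un_least)
    qed
    show "sets (Filt T \<nu> t) \<subseteq> sets (GFilt T \<nu> X t)"
    proof -
      have Xmeas: "X \<in> GFilt T \<nu> X t \<rightarrow>\<^sub>M Filt T \<mu> t"
        unfolding GFilt_def Filt_def
      proof (rule measurable_aug_aug[OF sid' sX _ _ null_X])
        show "X \<in> space \<nu> \<rightarrow> space \<mu>" using XC by (simp add: space)
        have "X \<in> sigma_upto T X t \<rightarrow>\<^sub>M sigma_upto T id t"
        proof (rule measurable_sigma_sets[OF sets_sigma_upto])
          fix y assume "y \<in> {{\<omega> \<in> CT T. id \<omega> s \<in> A} | s A. s \<in> {0..t} \<inter> T \<and> A \<in> sets borel}"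
          then obtain s and A :: "real set" where y: "y = {\<omega> \<in> CT T. \<omega> s \<in> A}" "s \<in> {0..t} \<inter> T" "A \<in> sets borel" by auto
          have "X -` y \<inter> CT T = {\<omega> \<in> CT T. X \<omega> s \<in> A}" using XC by (auto simp: y(1))
          also have "\<dots> \<in> sets (sigma_upto T X t)"
            unfolding sets_sigma_upto using y(2,3) by (intro sigma_sets.Basic) blast
          finally show "X -` y \<inter> space (sigma_upto T X t) \<in> sets (sigma_upto T X t)" by simp
        qed (use XC in auto)
        from measurable_sets[OF this]
        show "X -` A \<inter> space \<nu> \<in> sets (aug \<nu> (sigma_upto T X t))" if "A \<in> sets (sigma_upto T id t)" for A
          using that sets_aug_superset(1)[OF sX] by (auto simp: space)
      qed
      \<comment> \<open>\<open>(id + h) (X \<omega>) = \<omega>\<close> holds at every point of the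
        form \<open>(id + h) \<eta>\<close> with \<open>X ((id + h) \<eta>) = \<eta>\<close>. Since
        \<open>\<nu>\<close> is the law of \<open>id + h\<close>, this is almost every point under
        \<open>\<nu>\<close>.\<close>
      have "(\<lambda>\<omega>. \<omega> s) \<in> borel_measurable (GFilt T \<nu> X t)" if s: "s \<in> T" "s \<le> t" for s
        unfolding GFilt_def
      proof (rule aug_AE_cong[OF sX])
        have "(\<lambda>\<omega>. \<omega> s + h \<omega> s) \<in> borel_measurable (Filt T \<mu> t)"
          using Filt_eval[OF s] Filt_mono[OF s(2) L2_aD(3)[OF ha s(1)]] by measurable
        from measurable_compose[OF Xmeas this]
        show "(\<lambda>\<omega>. (id + h) (X \<omega>) s) \<in> borel_measurable (aug \<nu> (sigma_upto T X t))" unfolding GFilt_def by simp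
        have m1: "(\<lambda>\<omega>. (id + h) (X \<omega>) s) \<in> borel_measurable (borel_CT T)"
          by (rule measurable_compose[OF Xp paths_eval[OF idh]])
        have "{\<omega> \<in> space (borel_CT T). \<omega> s = (id + h) (X \<omega>) s} \<in> sets (borel_CT T)"
          using m1 eval_measurable[of s] by (rule borel_measurable_eq[rotated])
        then show "AE \<omega> in \<nu>. \<omega> s = (id + h) (X \<omega>) s"
          unfolding \<nu>_def using inv by (subst AE_distr_iff[OF idh_mu]) (auto elim!: eventually_mono)
      qed simp
      then have ev: "{\<omega> \<in> CT T. \<omega> s \<in> A} \<in> sets (GFilt T \<nu> X t)" if "s \<in> T" "s \<le> t" "A \<in> sets borel" for s A
        using sets_Collect_mem[of _ "GFilt T \<nu> X t" borel A] that unfolding spG space by blast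
      have "sets (sigma_upto T id t) \<subseteq> sets (GFilt T \<nu> X t)"
        unfolding sets_sigma_upto
        by (rule sets.sigma_sets_subset[of _ "GFilt T \<nu> X t", unfolded spG space]) (auto intro: ev)
      then show ?thesis
        unfolding Filt_def sets_aug[OF sid]
        using sets_aug_superset(2)[OF sX, folded GFilt_def]
        by (intro sets.sigma_sets_subset[of _ "GFilt T \<nu> X t", unfolded spG] Un_least)
    qed
  qed
  moreover have "sampled_BM T \<mu> (completion \<nu>) X"
    unfolding sampled_BM_def distr_completion[OF X_nu]
    using prob_space.prob_space_completion[OF prob] measurable_completion[OF X_nu] law by blast
  ultimately show "generating_sampled_BM T \<mu> \<nu> X" unfolding generating_sampled_BM_def by blast
qed

end

theorem theorem5p1:
  fixes T :: "real set"
    and M :: "'p measure" and B :: "real \<Rightarrow> 'p \<Rightarrow> real"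
    and \<mu> :: "(real \<Rightarrow> real) measure"
    and \<theta> X :: "(real \<Rightarrow> real) \<Rightarrow> (real \<Rightarrow> real)"
    and K :: real
  assumes "time_scale T"
    and "standard_BM M B"
    and "\<mu> = sampled_wiener T M B"
    and "\<theta> \<in> Linf_a T \<mu>"
    and "X = id + \<theta>"
    and "continuous_L2_a T \<mu> (kappa X)"
    and "0 \<le> K" and "K < 1"
    and "\<forall>h\<in>L2_a T \<mu>. \<exists>\<epsilon>. 0 < \<epsilon> \<and> \<epsilon> \<le> 1 \<and>
           L2_sq T \<mu> ((X \<circ> (id + (h + path_scale \<epsilon> (kappa X h)))) - (X \<circ> (id + h))
                     - path_scale \<epsilon> (kappa X h))
             \<le> ennreal (K * \<epsilon>\<^sup>2) * L2_sq T \<mu> (kappa X h)"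
  shows "\<exists>\<nu>. prob_space \<nu> \<and> sets \<nu> = sets (borel_CT T) \<and>
             absolutely_continuous \<mu> \<nu> \<and> absolutely_continuous \<nu> \<mu> \<and>
             generating_sampled_BM T \<mu> \<nu> X \<and>
             (\<forall>t\<in>T. sets (GFilt T \<nu> X t) = sets (Filt T \<nu> t))"
proof -
  interpret time_scaled T by standard fact
  interpret P: prob_space M using assms(2) by (simp add: standard_BM_def)
  have mu: "\<mu> = distr M (borel_CT T) (\<lambda>p t. if t \<in> T then B t p else 0)"
    using assms(3) by (simp add: sampled_wiener_def)
  interpret \<mu>: prob_space \<mu> unfolding mu by (rule P.prob_space_distr[OF sampled_path_measurable[OF assms(2)]])
  have "sets \<mu> = sets (borel_CT T)" unfolding mu by (rule sets_distr)
  then interpret brownian T \<mu> M B using assms(2,3) by unfold_locales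
  obtain c where c: "0 \<le> c" "\<theta> \<in> bounded_drift c" by (rule Linf_a_bounded_drift[OF assms(4)])
  obtain h where h: "h \<in> bounded_drift c" "L2_norm (kappa X h) = 0"
    using ex_kappa_zero[OF c(2,1) assms(5-9)] by blast
  have ka: "kappa X h \<in> L2_a T \<mu>" unfolding assms(5) by (rule kappa_L2_a[OF h(1) c(2)])
  note kp = L2_aD(1)[OF ka]
  \<comment> \<open>Vanishing of \<open>L2_norm\<close> alone would not exclude an infinite second
    moment; membership of \<open>kappa X h\<close> in \<open>L2_a\<close> does.\<close>
  have "L2_sq T \<mu> (kappa X h) = 0" using L2_sq_L2_norm[OF L2_aD(2)[OF ka]] h(2) by simp
  then have "AE \<omega> in \<mu>. energy T (kappa X h \<omega>) = 0"
    unfolding L2_sq_paths[OF kp] by (subst (asm) nn_integral_0_iff_AE) (rule energy_paths_measurable[OF kp])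
  then have "AE \<omega> in \<mu>. X ((id + h) \<omega>) = \<omega>"
    using AE_space
  proof eventually_elim
    case (elim \<omega>)
    have "kappa X h \<omega> = (\<lambda>_. 0)"
      using elim by (intro energy_eq_zeroD paths_CT[OF kp]) simp_all
    then show ?case by (simp add: kappa_def fun_eq_iff)
  qed
  note gen = generating_of_right_inverse[OF h(1) c(2) assms(5) this]
  show ?thesis
    using gen gen(5)[unfolded generating_sampled_BM_def] by blast
qed

end
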